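(* Let $K$ be a number field, let $f\in K[x]$ be a polynomial of degree $2$, and let $n\in\{1,2\}$. Then both statements $\mathcal E^{\ast}(f,n)$ and $\mathcal E(f,n)$ hold, i.e.: (i) if $\Phi_{n,f}$ has no root in $K$, then $\delta(\mathcal S_{\Phi_{n,f}})<1$; and (ii) if for every prime $\mathfrak p$ of $K$ the polynomial $f$ has a point of period $n$ in $K_{\mathfrak p}$, then $f$ has a point of period $n$ in $K$.
   Context: A prime of a number field $K$ is a maximal ideal of its ring of integers; $K_{\mathfrak p}$ denotes the completion of $K$ at the prime $\mathfrak p$. For a map $\phi$ and a point $x$, $x$ has period $n$ if $\phi^n(x)=x$ and $\phi^m(x)\neq x$ for $0<m<n$ ($\phi^k$ is the $k$-fold composition). For a nonconstant polynomial $f$ over a field of characteristic $0$, the $n$-th dynatomic polynomial is $\Phi_{n,f}(x)=\prod_{d\mid n}(f^d(x)-x)^{\mu(n/d)}$ ($\mu$ the Möbius function); it is a polynomial. For $F\in K[x]$, $\mathcal S_F$ is the set of primes $\mathfrak p$ of $K$ such that $F$ has a root in $K_{\mathfrak p}$. The Dirichlet density of a set $S$ of primes of $K$ is $\delta(S)=\lim_{s\to1^+}\frac{\sum_{\mathfrak p\in S}N(\mathfrak p)^{-s}}{-\log(s-1)}$ when the limit exists ($N(\mathfrak p)$ the norm of $\mathfrak p$); for every $F$ this density exists. *)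

theory Defs
  imports
    "HOL-Computational_Algebra.Computational_Algebra"
    "HOL-Algebra.QuotRing"
    "HOL-Algebra.Ideal_Product"
    "HOL-Analysis.Infinite_Sum"
begin

section \<open>Number fields and their primes\<close>

class number_field = field_char_0 +
  assumes finite_dim_over_rat:
    "\<exists>B. finite B \<and> (\<forall>x. \<exists>c. x = (\<Sum>b\<in>B. of_rat (c b) * b))"

instance rat :: number_field
proof
  show "\<exists>B::rat set. finite B \<and> (\<forall>x. \<exists>c. x = (\<Sum>b\<in>B. of_rat (c b) * b))"
    by (rule exI[of _ "{1}"]) auto
qed

definition ring_of_integers :: "'k::number_field ring" where
  "ring_of_integers =
     \<lparr>carrier = {x. algebraic_int x}, mult = (*), one = 1, zero = 0, add = (+)\<rparr>"

definition primes_of_field :: "'k::number_field set set" where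
  "primes_of_field = {P. maximalideal P ring_of_integers}"

definition prime_norm :: "'k::number_field set \<Rightarrow> nat" where
  "prime_norm P = card (carrier (ring_of_integers Quot P))"


section \<open>The completion at a prime\<close>

text \<open>
  For a nonzero integer \<open>a\<close> this is the exponent of \<open>P\<close> in the factorization of the ideal
  generated by \<open>a\<close>, i.e. the largest \<open>n\<close> such that \<open>a\<close> lies in the \<open>n\<close>-th power of \<open>P\<close>.
\<close>
definition integer_ord :: "'k::number_field set \<Rightarrow> 'k \<Rightarrow> nat" where
  "integer_ord P a = (GREATEST n. a \<in> P [^]\<^bsub>ideals_set ring_of_integers\<^esub> n)"

text \<open>
  Every nonzero \<open>x\<close> is a quotient of nonzero integers; the value does not depend on the choice
  of numerator and denominator.
\<close>
definition prime_ord :: "'k::number_field set \<Rightarrow> 'k \<Rightarrow> int" where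
  "prime_ord P x =
     (THE k. \<exists>a b. algebraic_int a \<and> algebraic_int b \<and> a \<noteq> 0 \<and> b \<noteq> 0 \<and> x = a / b \<and>
                   k = int (integer_ord P a) - int (integer_ord P b))"

definition prime_abs :: "'k::number_field set \<Rightarrow> 'k \<Rightarrow> real" where
  "prime_abs P x = (if x = 0 then 0 else real (prime_norm P) powi (- prime_ord P x))"

definition prime_Cauchy :: "'k::number_field set \<Rightarrow> (nat \<Rightarrow> 'k) \<Rightarrow> bool" where
  "prime_Cauchy P X \<longleftrightarrow> (\<forall>\<epsilon>>0. \<exists>M. \<forall>i\<ge>M. \<forall>j\<ge>M. prime_abs P (X i - X j) < \<epsilon>)"

definition Cauchy_ring :: "'k::number_field set \<Rightarrow> (nat \<Rightarrow> 'k) ring" where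
  "Cauchy_ring P =
     \<lparr>carrier = {X. prime_Cauchy P X},
      mult = (\<lambda>X Y i. X i * Y i), one = (\<lambda>_. 1),
      zero = (\<lambda>_. 0), add = (\<lambda>X Y i. X i + Y i)\<rparr>"

definition null_sequences :: "'k::number_field set \<Rightarrow> (nat \<Rightarrow> 'k) set" where
  "null_sequences P = {X. (\<lambda>i. prime_abs P (X i)) \<longlonglongrightarrow> 0}"

definition completion :: "'k::number_field set \<Rightarrow> (nat \<Rightarrow> 'k) set ring" where
  "completion P = Cauchy_ring P Quot null_sequences P"

definition to_completion :: "'k::number_field set \<Rightarrow> 'k \<Rightarrow> (nat \<Rightarrow> 'k) set" where
  "to_completion P x = null_sequences P +>\<^bsub>Cauchy_ring P\<^esub> (\<lambda>_. x)"

definition poly_completion ::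
  "'k::number_field set \<Rightarrow> 'k poly \<Rightarrow> (nat \<Rightarrow> 'k) set \<Rightarrow> (nat \<Rightarrow> 'k) set" where
  "poly_completion P F \<alpha> =
     (\<Oplus>\<^bsub>completion P\<^esub> i\<in>{..degree F}.
        to_completion P (coeff F i) \<otimes>\<^bsub>completion P\<^esub> (\<alpha> [^]\<^bsub>completion P\<^esub> i))"


section \<open>Periodic points and dynatomic polynomials\<close>

definition has_period :: "('a \<Rightarrow> 'a) \<Rightarrow> nat \<Rightarrow> 'a \<Rightarrow> bool" where
  "has_period \<phi> n x \<longleftrightarrow> (\<phi> ^^ n) x = x \<and> (\<forall>m. 0 < m \<and> m < n \<longrightarrow> (\<phi> ^^ m) x \<noteq> x)"

definition moebius_mu :: "nat \<Rightarrow> int" where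
  "moebius_mu n = (if squarefree n then (-1) ^ card (prime_factors n) else 0)"

definition iterate_poly :: "'a::comm_semiring_1 poly \<Rightarrow> nat \<Rightarrow> 'a poly" where
  "iterate_poly f n = ((\<lambda>g. f \<circ>\<^sub>p g) ^^ n) [:0, 1:]"

text \<open>
  The product has negative exponents, so it is formed in the field of rational functions;
  the dynatomic polynomial is the polynomial that it equals.
\<close>
definition dynatomic :: "nat \<Rightarrow> 'a::field_char_0 poly \<Rightarrow> 'a poly" where
  "dynatomic n f =
     (THE p. to_fract p =
        (\<Prod>d | d dvd n. to_fract (iterate_poly f d - [:0, 1:]) powi moebius_mu (n div d)))"


section \<open>Local roots and Dirichlet density\<close>

definition local_root_primes :: "'k::number_field poly \<Rightarrow> 'k set set" where
  "local_root_primes F =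
     {P \<in> primes_of_field. \<exists>\<alpha>\<in>carrier (completion P). poly_completion P F \<alpha> = \<zero>\<^bsub>completion P\<^esub>}"

definition has_Dirichlet_density :: "'k::number_field set set \<Rightarrow> real \<Rightarrow> bool" where
  "has_Dirichlet_density S \<delta> \<longleftrightarrow>
     ((\<lambda>s. (\<Sum>\<^sub>\<infinity>P\<in>S. real (prime_norm P) powr (- s)) / (- ln (s - 1))) \<longlongrightarrow> \<delta>) (at_right 1)"

end

theory Submission
  imports Defs "HOL-Algebra.Algebraic_Closure_Type" "Jordan_Normal_Form.Char_Poly"
begin

text \<open>
  Both dynatomic polynomials are quadratic, so everything reduces to one fact: if \<open>D\<close> is a
  nonsquare integer of \<open>K\<close>, the primes at which \<open>D\<close> is locally a square have density \<open>1/2\<close>.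
  Put \<open>L = K(\<surd>D)\<close>. Counting ideals gives \<open>c/(s-1) \<le> \<zeta>(s) \<le> C/(s-1)\<close> on \<open>(1,2]\<close> for every
  number field, without the unit theorem. For the upper bound, the pigeonhole principle gives a
  small element \<open>\<alpha>\<close> of an ideal \<open>I\<close>, and \<open>I\<close> is determined by \<open>\<alpha>\<close> and the cofactor \<open>J\<close> in
  \<open>(\<alpha>) = I J\<close>, which has bounded norm. For the lower bound, elements near a large rational
  integer generate many distinct principal ideals. By the Euler product, the sum of
  \<open>N(\<pp>)\<^sup>-\<^sup>s\<close> over all primes is \<open>- ln (s-1) + O(1)\<close>, both for \<open>K\<close> and for \<open>L\<close>. Up to a bounded
  error the sum for \<open>L\<close> is twice the sum over the primes of \<open>K\<close> modulo which \<open>D\<close> is a square,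
  which is the density statement; comparison with the sum over all primes of \<open>K\<close> shows that
  some prime has no local root. If the second dynatomic polynomial has a root in \<open>K\<close> that is not
  of exact period 2, it is a double root fixed by \<open>f\<close>, hence also the only local root.
\<close>

text \<open>The field L depends on the element D, so it cannot be a type. It is taken as a subset of
  the algebraic closure of K, and integers, ideals, norms and zeta sums are treated in the locale
  \<open>number_subfield\<close> for a subset of a field, which is then used twice: for
  \<open>UNIV\<close> and for L. Crude constants are enough, because a logarithm turns a bounded
  factor of the zeta function into a bounded summand, and division by - ln (s - 1) removes it in the
  limit. Hence a Q-basis made of algebraic integers does the work of a Z-basis, and no field
  discriminant, regulator or class number occurs. The primes containing 2 D are set aside: there the
  integers of L may differ from K.ints + K.ints w, and X^2 - D may have a double root modulo the
  prime. They are finite in number, so no density changes.\<close>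

hide_const (open) Polynomials.degree Polynomials.lead_coeff up_ring.coeff up_ring.monom
  Coset.order Divisibility.prime

section \<open>The ring of algebraic integers\<close>

definition int_span :: "'a::field_char_0 set \<Rightarrow> 'a set" where
  "int_span V = range (\<lambda>c::'a \<Rightarrow> int. \<Sum>v\<in>V. of_int (c v) * v)"

lemma int_spanI: "x = (\<Sum>v\<in>V. of_int (c v) * v) \<Longrightarrow> x \<in> int_span V"
  unfolding int_span_def by (rule range_eqI)

lemma int_span_0: "0 \<in> int_span V"
  unfolding int_span_def by (rule range_eqI[of _ _ "\<lambda>_. 0"]) simp

lemma int_span_add: "x \<in> int_span V \<Longrightarrow> y \<in> int_span V \<Longrightarrow> x + y \<in> int_span V"
proof -
  assume "x \<in> int_span V" "y \<in> int_span V"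
  then obtain c d :: "'a \<Rightarrow> int"
    where "x = (\<Sum>v\<in>V. of_int (c v) * v)" "y = (\<Sum>v\<in>V. of_int (d v) * v)"
    unfolding int_span_def by auto
  hence "x + y = (\<Sum>v\<in>V. of_int (c v + d v) * v)"
    by (simp add: sum.distrib algebra_simps)
  thus ?thesis by (rule int_spanI)
qed

lemma int_span_of_int_mult: "x \<in> int_span V \<Longrightarrow> of_int k * x \<in> int_span V"
proof -
  assume "x \<in> int_span V"
  then obtain c :: "'a \<Rightarrow> int" where "x = (\<Sum>v\<in>V. of_int (c v) * v)"
    unfolding int_span_def by auto
  hence "of_int k * x = (\<Sum>v\<in>V. of_int (k * c v) * v)"
    by (simp add: sum_distrib_left algebra_simps)
  thus ?thesis by (rule int_spanI)
qed

lemma int_span_sum: "(\<And>i. i \<in> I \<Longrightarrow> g i \<in> int_span V) \<Longrightarrow> sum g I \<in> int_span V"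
  by (induction I rule: infinite_finite_induct) (auto simp: int_span_0 int_span_add)

lemma int_span_base: "finite V \<Longrightarrow> v \<in> V \<Longrightarrow> v \<in> int_span V"
proof -
  assume "finite V" "v \<in> V"
  hence "v = (\<Sum>w\<in>V. if w = v then w else 0)" by (simp add: sum.delta)
  also have "\<dots> = (\<Sum>w\<in>V. of_int (if w = v then 1 else 0) * w)"
    by (intro sum.cong) auto
  finally have "v = (\<Sum>w\<in>V. of_int (if w = v then 1 else 0) * w)" .
  thus ?thesis by (rule int_spanI)
qed

text \<open>The condition of the finitely generated module criterion for integrality. It is closed
  under sums and products, which is how integers turn out to form a ring.\<close>

definition int_stable :: "'a::field_char_0 set \<Rightarrow> 'a \<Rightarrow> bool" where
  "int_stable V x \<longleftrightarrow> (\<forall>v\<in>V. x * v \<in> int_span V)"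

lemma int_stable_mult_span:
  assumes "int_stable V x" "y \<in> int_span V"
  shows "x * y \<in> int_span V"
proof -
  from assms(2) obtain c :: "'a \<Rightarrow> int" where "y = (\<Sum>v\<in>V. of_int (c v) * v)"
    unfolding int_span_def by auto
  hence "x * y = (\<Sum>v\<in>V. of_int (c v) * (x * v))"
    by (simp add: sum_distrib_left mult_ac)
  also have "\<dots> \<in> int_span V"
    using assms(1) by (intro int_span_sum int_span_of_int_mult) (simp add: int_stable_def)
  finally show ?thesis .
qed

lemma int_stable_add: "int_stable V x \<Longrightarrow> int_stable V y \<Longrightarrow> int_stable V (x + y)"
  by (auto simp: int_stable_def distrib_right intro: int_span_add)

lemma int_stable_mult: "int_stable V x \<Longrightarrow> int_stable V y \<Longrightarrow> int_stable V (x * y)"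
  unfolding int_stable_def[of _ "x * y"] mult.assoc
  by (auto simp: int_stable_def[of _ y] intro: int_stable_mult_span)

text \<open>
  An element that stabilises a finitely generated group is an eigenvalue of an integer matrix.
\<close>
lemma int_stable_imp_algebraic_int:
  fixes x :: "'a::field_char_0"
  assumes V: "finite V" "v0 \<in> V" "v0 \<noteq> 0" and st: "int_stable V x"
  shows "algebraic_int x"
proof -
  obtain f where f: "bij_betw f {..<card V} V"
    using V(1) ex_bij_betw_nat_finite lessThan_atLeast0 by metis
  define m where "m = card V"
  have fV: "f i \<in> V" if "i < m" for i
    using f that by (auto simp: bij_betw_def m_def)
  have "\<forall>v\<in>V. \<exists>c::'a \<Rightarrow> int. x * v = (\<Sum>w\<in>V. of_int (c w) * w)"
    using st by (auto simp: int_stable_def int_span_def)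
  then obtain c :: "'a \<Rightarrow> 'a \<Rightarrow> int" where c: "x * v = (\<Sum>w\<in>V. of_int (c v w) * w)" if "v \<in> V" for v
    by metis
  define A where "A = mat m m (\<lambda>(i,j). c (f i) (f j))"
  define A' where "A' = mat m m (\<lambda>(i,j). of_int (c (f i) (f j)) :: 'a)"
  have A: "A \<in> carrier_mat m m" and A': "A' \<in> carrier_mat m m"
    by (auto simp: A_def A'_def)
  have AA': "A' = of_int_hom.mat_hom A"
    by (auto simp: A_def A'_def)
  define w where "w = vec m f"
  have "A' *\<^sub>v w = x \<cdot>\<^sub>v w"
  proof (rule eq_vecI)
    fix i assume i: "i < dim_vec (x \<cdot>\<^sub>v w)"
    hence im: "i < m" by (simp add: w_def)
    have "(A' *\<^sub>v w) $ i = (\<Sum>j<m. of_int (c (f i) (f j)) * f j)"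
      using im by (simp add: A'_def w_def scalar_prod_def lessThan_atLeast0)
    also have "\<dots> = (\<Sum>v\<in>V. of_int (c (f i) v) * v)"
      using sum.reindex_bij_betw[OF f, of "\<lambda>v. of_int (c (f i) v) * v"] by (simp add: m_def)
    also have "\<dots> = x * f i" using c[OF fV[OF im]] by simp
    finally show "(A' *\<^sub>v w) $ i = (x \<cdot>\<^sub>v w) $ i" using im by (simp add: w_def)
  qed (simp add: A'_def w_def)
  moreover have "w \<noteq> 0\<^sub>v m"
  proof -
    obtain i where "i < m" "f i = v0" using f V(2) unfolding bij_betw_def m_def by (metis imageE lessThan_iff)
    hence "w $ i \<noteq> 0\<^sub>v m $ i" using V(3) by (simp add: w_def)
    thus ?thesis by fastforce
  qed
  moreover have "w \<in> carrier_vec m" by (simp add: w_def)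
  ultimately have "eigenvalue A' x"
    using A' by (auto simp: eigenvalue_def eigenvector_def)
  hence "poly (char_poly A') x = 0" using eigenvalue_root_char_poly[OF A'] by simp
  moreover have "char_poly A' = map_poly of_int (char_poly A)"
    unfolding AA' by (rule of_int_hom.char_poly_hom[OF A])
  moreover have "lead_coeff (char_poly A) = 1"
    using degree_monic_char_poly[OF A] by simp
  ultimately show ?thesis
    unfolding algebraic_int_altdef_ipoly by metis
qed

lemma algebraic_int_imp_power_eq:
  fixes x :: "'a::field_char_0"
  assumes "algebraic_int x"
  obtains d and c :: "nat \<Rightarrow> int" where "d > 0" "x ^ d = (\<Sum>i<d. of_int (c i) * x ^ i)"
proof -
  from assms obtain p where p: "poly (map_poly of_int p) x = 0" "lead_coeff p = 1"
    unfolding algebraic_int_altdef_ipoly by auto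
  define d where "d = degree p"
  have d: "d > 0"
  proof (rule ccontr)
    assume "\<not> d > 0"
    hence "degree p = 0" by (simp add: d_def)
    then obtain a where "p = [:a:]" by (meson degree_eq_zeroE)
    thus False using p by (simp split: if_splits)
  qed
  have "0 = (\<Sum>i\<le>d. of_int (coeff p i) * x ^ i)"
    using p(1) by (simp add: poly_altdef d_def)
  also have "\<dots> = x ^ d + (\<Sum>i<d. of_int (coeff p i) * x ^ i)"
    using p(2) by (simp add: lessThan_Suc_atMost[symmetric] d_def)
  finally have "x ^ d = (\<Sum>i<d. of_int (- coeff p i) * x ^ i)"
    unfolding of_int_minus mult_minus_left sum_negf by (metis add_eq_0_iff2)
  thus ?thesis by (rule that[OF d])
qed

context
  fixes x y :: "'a::field_char_0" and d e :: nat and c :: "nat \<Rightarrow> int" and V :: "'a set"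
  assumes de: "d > 0" "e > 0"
    and y: "y ^ e = (\<Sum>i<e. of_int (c i) * y ^ i)"
  defines "V \<equiv> (\<lambda>(i,j). x ^ i * y ^ j) ` ({..<d} \<times> {..<e})"
  assumes x: "x ^ d \<in> int_span V"
begin

lemma monomials_finite: "finite V"
  by (simp add: V_def)

lemma monomials_memI: "i < d \<Longrightarrow> j < e \<Longrightarrow> x ^ i * y ^ j \<in> V"
  by (auto simp: V_def)

lemma monomials_spanI: "i < d \<Longrightarrow> j < e \<Longrightarrow> x ^ i * y ^ j \<in> int_span V"
  using monomials_memI monomials_finite int_span_base by blast

lemma monomials_stable_second: "int_stable V y"
  unfolding int_stable_def
proof
  fix v assume "v \<in> V"
  then obtain i j where ij: "i < d" "j < e" "v = x ^ i * y ^ j" by (auto simp: V_def)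
  show "y * v \<in> int_span V"
  proof (cases "Suc j < e")
    case True
    thus ?thesis using monomials_spanI[of i "Suc j"] ij by (simp add: mult_ac)
  next
    case False
    hence "Suc j = e" using ij by simp
    hence "y * v = x ^ i * y ^ e" using ij by (auto simp: mult_ac)
    also have "\<dots> = (\<Sum>k<e. of_int (c k) * (x ^ i * y ^ k))"
      unfolding y by (simp add: sum_distrib_left mult_ac)
    also have "\<dots> \<in> int_span V"
      using ij by (auto intro!: int_span_sum int_span_of_int_mult monomials_spanI)
    finally show ?thesis .
  qed
qed

lemma monomials_stable_power: "z \<in> int_span V \<Longrightarrow> y ^ j * z \<in> int_span V"
  by (induction j) (auto simp: mult.assoc intro: int_stable_mult_span[OF monomials_stable_second])

lemma monomials_stable_first: "int_stable V x"
  unfolding int_stable_def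
proof
  fix v assume "v \<in> V"
  then obtain i j where ij: "i < d" "j < e" "v = x ^ i * y ^ j" by (auto simp: V_def)
  show "x * v \<in> int_span V"
  proof (cases "Suc i < d")
    case True
    thus ?thesis using monomials_spanI[of "Suc i" j] ij by (simp add: mult_ac)
  next
    case False
    hence "Suc i = d" using ij by simp
    hence "x * v = y ^ j * x ^ d" using ij by (auto simp: mult_ac)
    thus ?thesis using monomials_stable_power[OF x] by simp
  qed
qed

lemma monomials_one: "1 \<in> V"
  using monomials_memI[of 0 0] de by simp

lemmas monomials_algebraic_int = int_stable_imp_algebraic_int[OF monomials_finite monomials_one one_neq_zero]

text \<open>Only \<open>x ^ d \<in> int_span V\<close> is required of x, not a monic integer
  equation. The same monomials therefore also give transitivity: an element integral over Z[y], with
  y integral, is integral.\<close>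

lemma algebraic_int_monomials:
  "algebraic_int x" "algebraic_int (x + y)" "algebraic_int (x * y)"
  by (intro monomials_algebraic_int int_stable_add int_stable_mult
      monomials_stable_first monomials_stable_second)+

end

lemma algebraic_int_add_mult:
  fixes x y :: "'a::field_char_0"
  assumes "algebraic_int x" "algebraic_int y"
  shows algebraic_int_add: "algebraic_int (x + y)"
    and algebraic_int_mult: "algebraic_int (x * y)"
proof -
  obtain d and c :: "nat \<Rightarrow> int" where d: "d > 0" "x ^ d = (\<Sum>i<d. of_int (c i) * x ^ i)"
    using algebraic_int_imp_power_eq assms(1) by blast
  obtain e and c' :: "nat \<Rightarrow> int" where e: "e > 0" "y ^ e = (\<Sum>i<e. of_int (c' i) * y ^ i)"
    using algebraic_int_imp_power_eq assms(2) by blast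
  define V where "V = (\<lambda>(i,j). x ^ i * y ^ j) ` ({..<d} \<times> {..<e})"
  have "x ^ i \<in> V" if "i < d" for i
    unfolding V_def using that e(1) by (intro image_eqI[of _ _ "(i,0)"]) auto
  moreover have "finite V" by (simp add: V_def)
  ultimately have "x ^ d \<in> int_span V"
    unfolding d(2) by (auto intro!: int_span_sum int_span_of_int_mult int_span_base)
  from algebraic_int_monomials[OF d(1) e this[unfolded V_def]]
  show "algebraic_int (x + y)" "algebraic_int (x * y)" by auto
qed

lemma algebraic_int_diff:
  fixes x y :: "'a::field_char_0"
  shows "algebraic_int x \<Longrightarrow> algebraic_int y \<Longrightarrow> algebraic_int (x - y)"
  using algebraic_int_add[of x "- y"] by auto

lemma algebraic_int_power:
  fixes x :: "'a::field_char_0"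
  shows "algebraic_int x \<Longrightarrow> algebraic_int (x ^ k)"
  by (induction k) (auto intro: algebraic_int_mult)

lemma algebraic_int_sum:
  fixes g :: "'b \<Rightarrow> 'a::field_char_0"
  shows "(\<And>i. i \<in> I \<Longrightarrow> algebraic_int (g i)) \<Longrightarrow> algebraic_int (sum g I)"
  by (induction I rule: infinite_finite_induct) (auto intro: algebraic_int_add)

text \<open>x is a root of the monic polynomial X^i - X^j - y over Z[y], where y is the given
  integral difference.\<close>

lemma algebraic_int_if_power_diff:
  fixes x :: "'a::field_char_0"
  assumes "j < i" "algebraic_int (x ^ i - x ^ j)"
  shows "algebraic_int x"
proof -
  define y where "y = x ^ i - x ^ j"
  obtain e and c :: "nat \<Rightarrow> int" where e: "e > 0" "y ^ e = (\<Sum>i<e. of_int (c i) * y ^ i)"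
    using algebraic_int_imp_power_eq assms(2) y_def by blast
  define V where "V = (\<lambda>(k,l). x ^ k * y ^ l) ` ({..<i} \<times> {..<e})"
  have "finite V" by (simp add: V_def)
  have xj: "x ^ j \<in> V"
    unfolding V_def using assms e(1) by (intro image_eqI[of _ _ "(j,0)"]) auto
  have "y \<in> int_span V"
  \<comment> \<open>For e = 1 the element y is not among the monomials, whose exponent of y stays
    below e. In that case y is a rational integer and lies in the span of 1.\<close>
  proof (cases "e = 1")
    case True
    have "y ^ e = of_int (c 0)" unfolding e(2) using True by simp
    hence "y = of_int (c 0)" using True by simp
    moreover have "1 \<in> V"
      unfolding V_def using assms e(1) by (intro image_eqI[of _ _ "(0,0)"]) auto
    ultimately show ?thesis using int_span_of_int_mult[OF int_span_base[OF \<open>finite V\<close>], of 1 "c 0"] by simp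
  next
    case False
    hence "y \<in> V"
      unfolding V_def using assms e(1) by (intro image_eqI[of _ _ "(0,1)"]) auto
    thus ?thesis by (rule int_span_base[OF \<open>finite V\<close>])
  qed
  hence "x ^ j + y \<in> int_span V"
    by (intro int_span_add int_span_base[OF \<open>finite V\<close> xj])
  moreover have "x ^ j + y = x ^ i" unfolding y_def by (rule trans[OF add.commute diff_add_cancel])
  ultimately have "x ^ i \<in> int_span V" by metis
  moreover have "i > 0" using assms(1) by linarith
  ultimately show ?thesis using algebraic_int_monomials(1)[OF _ e] unfolding V_def by blast
qed

section \<open>Number fields as subfields\<close>

locale number_subfield =
  fixes F :: "'a::field_char_0 set"
  assumes one_mem: "1 \<in> F"
    and diff_mem: "x \<in> F \<Longrightarrow> y \<in> F \<Longrightarrow> x - y \<in> F"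
    and mult_mem: "x \<in> F \<Longrightarrow> y \<in> F \<Longrightarrow> x * y \<in> F"
    and inverse_mem: "x \<in> F \<Longrightarrow> inverse x \<in> F"
    and finite_dim: "\<exists>S. finite S \<and> S \<subseteq> F \<and> (\<forall>x\<in>F. \<exists>c. x = (\<Sum>b\<in>S. of_rat (c b) * b))"
begin

definition ints :: "'a set" where "ints = {x \<in> F. algebraic_int x}"

lemma zero_mem: "0 \<in> F"
  using diff_mem[OF one_mem one_mem] by simp

lemma minus_mem: "x \<in> F \<Longrightarrow> - x \<in> F"
  using diff_mem[OF zero_mem] by simp

lemma add_mem: "x \<in> F \<Longrightarrow> y \<in> F \<Longrightarrow> x + y \<in> F"
  using diff_mem[of x "- y"] minus_mem by simp

lemma divide_mem: "x \<in> F \<Longrightarrow> y \<in> F \<Longrightarrow> x / y \<in> F"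
  by (simp add: divide_inverse mult_mem inverse_mem)

lemma power_mem: "x \<in> F \<Longrightarrow> x ^ k \<in> F"
  by (induction k) (auto intro: one_mem mult_mem)

lemma sum_mem: "(\<And>i. i \<in> I \<Longrightarrow> g i \<in> F) \<Longrightarrow> sum g I \<in> F"
  by (induction I rule: infinite_finite_induct) (auto intro: zero_mem add_mem)

lemma of_nat_mem: "of_nat k \<in> F"
  by (induction k) (auto intro: zero_mem one_mem add_mem)

lemma of_int_mem: "of_int k \<in> F"
  by (cases k) (auto intro!: of_nat_mem minus_mem[OF of_nat_mem] simp del: of_nat_Suc)

lemma of_rat_mem: "of_rat q \<in> F"
  by (cases q) (auto simp: of_rat_rat intro: divide_mem of_int_mem)

lemma ints_subset: "x \<in> ints \<Longrightarrow> x \<in> F"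
  by (simp add: ints_def)

lemma ints_diff: "x \<in> ints \<Longrightarrow> y \<in> ints \<Longrightarrow> x - y \<in> ints"
  by (simp add: ints_def diff_mem algebraic_int_diff)

lemma ints_add: "x \<in> ints \<Longrightarrow> y \<in> ints \<Longrightarrow> x + y \<in> ints"
  by (simp add: ints_def add_mem algebraic_int_add)

lemma ints_mult: "x \<in> ints \<Longrightarrow> y \<in> ints \<Longrightarrow> x * y \<in> ints"
  by (simp add: ints_def mult_mem algebraic_int_mult)

lemma ints_minus: "x \<in> ints \<Longrightarrow> - x \<in> ints"
  by (simp add: ints_def minus_mem algebraic_int_minus)

lemma ints_of_int: "of_int k \<in> ints"
  by (simp add: ints_def of_int_mem)

lemma ints_of_nat: "of_nat k \<in> ints"
  by (simp add: ints_def of_nat_mem)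

lemma ints_0: "0 \<in> ints" and ints_1: "1 \<in> ints"
  by (simp_all add: ints_def zero_mem one_mem)

lemma ints_power: "x \<in> ints \<Longrightarrow> x ^ k \<in> ints"
  by (simp add: ints_def power_mem algebraic_int_power)

lemma ints_sum: "(\<And>i. i \<in> I \<Longrightarrow> g i \<in> ints) \<Longrightarrow> sum g I \<in> ints"
  by (simp add: ints_def sum_mem algebraic_int_sum)

end

section \<open>Linear algebra over the rationals and clearing of denominators\<close>

interpretation rat_vs: vector_space "\<lambda>(q::rat) (x::'a::field_char_0). of_rat q * x"
  by standard (auto simp: algebra_simps of_rat_add of_rat_mult)

lemma common_denominator:
  fixes q :: "'b \<Rightarrow> rat"
  assumes "finite I"
  shows "\<exists>m>0. \<forall>i\<in>I. of_nat m * q i \<in> \<int>"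
  using assms
proof (induction I)
  case (insert i I)
  then obtain m where m: "m > 0" "\<forall>i\<in>I. of_nat m * q i \<in> \<int>" by blast
  obtain a b where ab: "q i = of_int a / of_int b" "b > 0"
    by (cases "q i") (auto simp: Fract_of_int_quotient)
  have "of_nat (m * nat b) * q j \<in> \<int>" if "j \<in> insert i I" for j
  proof (cases "j = i")
    case True
    have "of_nat (m * nat b) * q j = of_int (int m * a)"
      using ab by (simp add: True of_nat_nat)
    thus ?thesis by (metis Ints_of_int)
  next
    case False
    hence "of_nat m * q j \<in> \<int>" using m that by auto
    hence "of_nat (nat b) * (of_nat m * q j) \<in> \<int>" by (rule Ints_mult[OF Ints_of_nat])
    moreover have "of_nat (nat b) * (of_nat m * q j) = of_nat (m * nat b) * q j"
      by (simp add: mult_ac del: of_nat_nat)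
    ultimately show ?thesis by metis
  qed
  moreover have "m * nat b > 0" using m ab by simp
  ultimately show ?case by blast
qed auto

context number_subfield
begin

lemma power_relation:
  assumes x: "x \<in> F"
  obtains N and c :: "nat \<Rightarrow> int" where "(\<Sum>i\<le>N. of_int (c i) * x ^ i) = 0" "\<exists>i\<le>N. c i \<noteq> 0"
proof -
  obtain S where S: "finite S" "\<forall>y\<in>F. \<exists>c. y = (\<Sum>b\<in>S. of_rat (c b) * b)"
    using finite_dim by blast
  define N where "N = card S"
  have span: "y \<in> rat_vs.span S" if "y \<in> F" for y
    unfolding rat_vs.span_finite[OF S(1)] using S(2) that by blast
  show ?thesis
  \<comment> \<open>Linear dependence is a property of sets and does not see repeated powers. A
    repetition gives the relation x^i - x^j = 0 directly; otherwise the powers form a set of N + 1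
    elements in the span of N elements.\<close>
  proof (cases "inj_on (\<lambda>i. x ^ i) {..N}")
    case False
    then obtain i j where ij: "i \<le> N" "j \<le> N" "i \<noteq> j" "x ^ i = x ^ j"
      by (auto simp: inj_on_def)
    define c :: "nat \<Rightarrow> int" where "c k = (if k = i then 1 else if k = j then -1 else 0)" for k
    have "(\<Sum>k\<le>N. of_int (c k) * x ^ k) = (\<Sum>k\<in>{i,j}. of_int (c k) * x ^ k)"
      using ij by (intro sum.mono_neutral_right) (auto simp: c_def)
    also have "\<dots> = 0" using ij by (simp add: c_def)
    finally have "(\<Sum>k\<le>N. of_int (c k) * x ^ k) = 0" .
    moreover have "\<exists>k\<le>N. c k \<noteq> 0" using ij by (intro exI[of _ i]) (simp add: c_def)
    ultimately show ?thesis by (rule that)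
  next
    case True
    define T where "T = (\<lambda>i. x ^ i) ` {..N}"
    have finT: "finite T" by (simp add: T_def)
    have "card T = Suc N" unfolding T_def by (simp add: card_image[OF True])
    moreover have "T \<subseteq> rat_vs.span S" using span power_mem[OF x] by (auto simp: T_def)
    ultimately have "rat_vs.dependent T"
      using rat_vs.independent_span_bound[OF S(1)] unfolding N_def by (metis Suc_n_not_le_n)
    then obtain u where u: "\<exists>v\<in>T. u v \<noteq> 0" "(\<Sum>v\<in>T. of_rat (u v) * v) = 0"
      using rat_vs.dependent_finite[OF finT] by blast
    obtain m where m: "m > 0" "\<forall>v\<in>T. of_nat m * u v \<in> \<int>"
      using common_denominator[OF finT, of u] by blast
    define c where "c v = \<lfloor>of_nat m * u v\<rfloor>" for v
    have c: "of_nat m * u v = of_int (c v)" if "v \<in> T" for v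
    proof -
      from m(2) that obtain k where "of_nat m * u v = of_int k" by (auto elim: Ints_cases)
      thus ?thesis by (simp add: c_def)
    qed
    have cT: "of_int (c v) * v = of_nat m * (of_rat (u v) * v)" if "v \<in> T" for v
    proof -
      have "of_int (c v) = (of_rat (of_nat m * u v) :: 'a)" using c[OF that] by simp
      thus ?thesis by (simp add: of_rat_mult mult.assoc)
    qed
    have "(\<Sum>i\<le>N. of_int (c (x ^ i)) * x ^ i) = (\<Sum>v\<in>T. of_int (c v) * v)"
      unfolding T_def by (simp add: sum.reindex[OF True])
    also have "\<dots> = (\<Sum>v\<in>T. of_nat m * (of_rat (u v) * v))"
      using cT by (intro sum.cong) auto
    also have "\<dots> = 0" unfolding sum_distrib_left[symmetric] u(2) by simp
    finally have 1: "(\<Sum>i\<le>N. of_int (c (x ^ i)) * x ^ i) = 0" .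
    obtain v where "v \<in> T" "u v \<noteq> 0" using u(1) by blast
    hence "c v \<noteq> 0" using c[of v] m(1) by auto
    hence "\<exists>i\<le>N. c (x ^ i) \<noteq> 0" using \<open>v \<in> T\<close> by (auto simp: T_def)
    with 1 show ?thesis by (rule that)
  qed
qed

lemma multiple_integral:
  assumes x: "x \<in> F"
  obtains m :: int where "m \<noteq> 0" "of_int m * x \<in> ints"
proof -
  obtain N and c :: "nat \<Rightarrow> int"
    where c: "(\<Sum>i\<le>N. of_int (c i) * x ^ i) = 0" "\<exists>i\<le>N. c i \<noteq> 0"
    using power_relation[OF x] by metis
  define d where "d = Max {i. i \<le> N \<and> c i \<noteq> 0}"
  have fin: "finite {i. i \<le> N \<and> c i \<noteq> 0}" by simp
  have "d \<in> {i. i \<le> N \<and> c i \<noteq> 0}"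
    unfolding d_def using c(2) by (intro Max_in) auto
  hence d: "d \<le> N" "c d \<noteq> 0" by auto
  have d_max: "c i = 0" if "i \<le> N" "d < i" for i
    using Max_ge[OF fin, of i] that unfolding d_def by fastforce
  have "0 = (\<Sum>i\<le>d. of_int (c i) * x ^ i)"
    unfolding c(1)[symmetric] using d d_max by (intro sum.mono_neutral_right) auto
  hence rel: "(\<Sum>i<d. of_int (c i) * x ^ i) + of_int (c d) * x ^ d = 0"
    by (simp add: lessThan_Suc_atMost[symmetric])
  \<comment> \<open>Multiplying the relation by the (d - 1)-st power of its leading coefficient
    makes it monic in y.\<close>
  define y where "y = of_int (c d) * x"
  have "algebraic_int y"
  proof (cases d)
    case 0
    thus ?thesis using rel d by simp
  next
    case (Suc d')
    \<comment> \<open>The factor \<open>1 ^ 0\<close> puts the terms into the shape of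
      \<open>algebraic_int_monomials\<close>, whose second variable is 1 here.\<close>
    have *: "of_int (c d ^ d') * (of_int (c i) * x ^ i) = of_int (c i * c d ^ (d' - i)) * (y ^ i * 1 ^ 0)"
      if "i < d" for i
    proof -
      have "d' = (d' - i) + i" using that Suc by simp
      hence "c d ^ d' = c d ^ (d' - i) * c d ^ i" by (metis power_add)
      thus ?thesis by (simp add: y_def power_mult_distrib mult_ac)
    qed
    have 1: "of_int (c d ^ d') * (\<Sum>i<d. of_int (c i) * x ^ i)
        = (\<Sum>i<d. of_int (c i * c d ^ (d' - i)) * (y ^ i * 1 ^ 0))"
      unfolding sum_distrib_left using * by (intro sum.cong) auto
    have 2: "of_int (c d ^ d') * (of_int (c d) * x ^ d) = y ^ d"
      by (simp add: y_def power_mult_distrib Suc mult_ac)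
    have "of_int (c d ^ d') * ((\<Sum>i<d. of_int (c i) * x ^ i) + of_int (c d) * x ^ d) = 0"
      unfolding rel by (rule mult_zero_right)
    hence "(\<Sum>i<d. of_int (c i * c d ^ (d' - i)) * (y ^ i * 1 ^ 0)) + y ^ d = 0"
      unfolding distrib_left 1 2 .
    hence "y ^ d = - (\<Sum>i<d. of_int (c i * c d ^ (d' - i)) * (y ^ i * 1 ^ 0))"
      by (metis add_eq_0_iff)
    also have "\<dots> = of_int (-1) * (\<Sum>i<d. of_int (c i * c d ^ (d' - i)) * (y ^ i * 1 ^ 0))"
      by simp
    also have "\<dots> \<in> int_span ((\<lambda>(i, j). y ^ i * 1 ^ j) ` ({..<d} \<times> {..<1}))"
    proof (intro int_span_of_int_mult int_span_sum int_span_base)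
      fix i assume "i \<in> {..<d}"
      thus "y ^ i * 1 ^ 0 \<in> (\<lambda>(i, j). y ^ i * 1 ^ j) ` ({..<d} \<times> {..<1})"
        by (intro image_eqI[of _ _ "(i,0)"]) auto
    qed simp
    finally have "y ^ d \<in> int_span ((\<lambda>(i, j). y ^ i * 1 ^ j) ` ({..<d} \<times> {..<1}))" .
    moreover have "d > 0" using Suc by simp
    ultimately show ?thesis
      by (intro algebraic_int_monomials(1)[of d 1 1 "\<lambda>_. 1" y]) simp_all
  qed
  moreover have "y \<in> F" unfolding y_def using x by (intro mult_mem of_int_mem)
  ultimately show ?thesis using that[of "c d"] d by (simp add: ints_def y_def)
qed

end

section \<open>Rational coordinates and boxes\<close>

locale integral_basis = number_subfield F for F :: "'a::field_char_0 set" +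
  fixes B :: "'a set"
  assumes finite_B: "finite B"
    and B_ints: "B \<subseteq> ints"
    and indep_B: "\<And>q b. (\<Sum>b\<in>B. of_rat (q b) * b) = 0 \<Longrightarrow> b \<in> B \<Longrightarrow> q b = 0"
    and span_B: "\<And>x. x \<in> F \<Longrightarrow> \<exists>q. x = (\<Sum>b\<in>B. of_rat (q b) * b)"

lemma (in number_subfield) integral_basis_exists: "\<exists>B. integral_basis F B"
proof -
  obtain S where S: "finite S" "\<forall>y\<in>F. \<exists>c. y = (\<Sum>b\<in>S. of_rat (c b) * b)"
    using finite_dim by blast
  obtain B where B: "B \<subseteq> ints" "rat_vs.independent B" "ints \<subseteq> rat_vs.span B"
    using rat_vs.maximal_independent_subset by blast
  have "B \<subseteq> rat_vs.span S"
  proof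
    fix b assume "b \<in> B"
    hence "b \<in> F" using B(1) by (auto simp: ints_def)
    thus "b \<in> rat_vs.span S"
      unfolding rat_vs.span_finite[OF S(1)] using S(2) by blast
  qed
  hence fin: "finite B"
    using rat_vs.independent_span_bound[OF S(1) B(2)] by blast
  have span: "\<exists>q. x = (\<Sum>b\<in>B. of_rat (q b) * b)" if x: "x \<in> F" for x
  proof -
    obtain m :: int where m: "m \<noteq> 0" "of_int m * x \<in> ints"
      using multiple_integral[OF x] by metis
    hence "of_int m * x \<in> rat_vs.span B" using B(3) by auto
    then obtain q where q: "of_int m * x = (\<Sum>b\<in>B. of_rat (q b) * b)"
      unfolding rat_vs.span_finite[OF fin] by auto
    have "x = (\<Sum>b\<in>B. of_rat (q b) * b) / of_int m" using m(1) by (simp add: q[symmetric])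
    also have "\<dots> = (\<Sum>b\<in>B. of_rat (q b / of_int m) * b)"
      by (simp add: sum_divide_distrib of_rat_divide)
    finally show ?thesis by (rule exI[of _ "\<lambda>b. q b / of_int m"])
  qed
  have "q b = 0" if "(\<Sum>b\<in>B. of_rat (q b) * b) = 0" "b \<in> B" for q b
  proof (rule ccontr)
    assume "q b \<noteq> 0"
    hence "\<exists>u. (\<exists>v\<in>B. u v \<noteq> 0) \<and> (\<Sum>v\<in>B. of_rat (u v) * v) = 0"
      using that by (intro exI[of _ q]) auto
    thus False using B(2) rat_vs.dependent_finite[OF fin] by simp
  qed
  with fin B(1) span have "integral_basis F B"
    by unfold_locales blast+
  thus ?thesis by blast
qed

context integral_basis
begin

text \<open>\<open>B\<close> is a basis over Q only, so an algebraic integer may have fractional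
  coordinates.\<close>

definition cd :: "'a \<Rightarrow> 'a \<Rightarrow> rat" where
  "cd x = (SOME q. x = (\<Sum>b\<in>B. of_rat (q b) * b))"

text \<open>The ball of radius t for the maximum norm of the coordinates. It takes over the role of
  the archimedean absolute values.\<close>

definition box :: "rat \<Rightarrow> 'a set" where
  "box t = {x \<in> F. \<forall>b\<in>B. \<bar>cd x b\<bar> \<le> t}"

lemma B_mem: "b \<in> B \<Longrightarrow> b \<in> F"
  using B_ints ints_subset by blast

lemma cd_sum: "x \<in> F \<Longrightarrow> (\<Sum>b\<in>B. of_rat (cd x b) * b) = x"
  using someI_ex[OF span_B[of x]] unfolding cd_def by simp

lemma cd_unique:
  assumes "x = (\<Sum>b\<in>B. of_rat (q b) * b)" "b \<in> B"
  shows "cd x b = q b"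
proof -
  have "x \<in> F" unfolding assms(1) by (intro sum_mem mult_mem of_rat_mem B_mem)
  hence "(\<Sum>b\<in>B. of_rat (cd x b) * b) = (\<Sum>b\<in>B. of_rat (q b) * b)"
    using cd_sum assms(1) by simp
  hence "(\<Sum>b\<in>B. of_rat (cd x b - q b) * b) = 0"
    by (simp add: of_rat_diff left_diff_distrib sum_subtractf)
  hence "cd x b - q b = 0" using indep_B[of "\<lambda>b. cd x b - q b"] assms(2) by blast
  thus ?thesis by simp
qed

lemma cd_add: "x \<in> F \<Longrightarrow> y \<in> F \<Longrightarrow> b \<in> B \<Longrightarrow> cd (x + y) b = cd x b + cd y b"
  by (rule cd_unique) (simp_all add: of_rat_add distrib_right sum.distrib cd_sum)

lemma cd_diff: "x \<in> F \<Longrightarrow> y \<in> F \<Longrightarrow> b \<in> B \<Longrightarrow> cd (x - y) b = cd x b - cd y b"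
  by (rule cd_unique) (simp_all add: of_rat_diff left_diff_distrib sum_subtractf cd_sum)

lemma cd_scale: "x \<in> F \<Longrightarrow> b \<in> B \<Longrightarrow> cd (of_rat q * x) b = q * cd x b"
proof (rule cd_unique)
  assume "x \<in> F"
  hence "of_rat q * x = of_rat q * (\<Sum>b\<in>B. of_rat (cd x b) * b)" by (simp add: cd_sum)
  thus "of_rat q * x = (\<Sum>b\<in>B. of_rat (q * cd x b) * b)"
    unfolding sum_distrib_left of_rat_mult mult.assoc .
qed

lemma cd_0: "b \<in> B \<Longrightarrow> cd 0 b = 0"
  by (rule cd_unique[of _ "\<lambda>_. 0"]) simp_all

lemma cd_sum_mult:
  assumes "\<And>i. i \<in> I \<Longrightarrow> g i \<in> F" "b \<in> B"
  shows "cd (\<Sum>i\<in>I. of_rat (q i) * g i) b = (\<Sum>i\<in>I. q i * cd (g i) b)"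
  using assms
  by (induction I rule: infinite_finite_induct)
     (auto simp: cd_0 cd_add cd_scale sum_mem mult_mem of_rat_mem)

lemma cd_zero_imp: "x \<in> F \<Longrightarrow> (\<And>b. b \<in> B \<Longrightarrow> cd x b = 0) \<Longrightarrow> x = 0"
  using cd_sum[of x] by (metis (no_types, lifting) mult_zero_left of_rat_0 sum.neutral)

lemma card_B_pos: "card B > 0"
proof (rule ccontr)
  assume "\<not> card B > 0"
  hence "B = {}" using finite_B by simp
  thus False using cd_sum[OF one_mem] by simp
qed

lemma boxI: "x \<in> F \<Longrightarrow> (\<And>b. b \<in> B \<Longrightarrow> \<bar>cd x b\<bar> \<le> t) \<Longrightarrow> x \<in> box t"
  by (simp add: box_def)

lemma box_subset: "x \<in> box t \<Longrightarrow> x \<in> F"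
  by (simp add: box_def)

lemma boxD: "x \<in> box t \<Longrightarrow> b \<in> B \<Longrightarrow> \<bar>cd x b\<bar> \<le> t"
  by (simp add: box_def)

lemma box_mono: "s \<le> t \<Longrightarrow> x \<in> box s \<Longrightarrow> x \<in> box t"
  unfolding box_def by fastforce

lemma box_nonneg: "x \<in> box t \<Longrightarrow> t \<ge> 0"
proof -
  assume x: "x \<in> box t"
  obtain b where "b \<in> B" using card_B_pos by (metis card_gt_0_iff ex_in_conv)
  from boxD[OF x this] show ?thesis by linarith
qed

lemma box_add: "x \<in> box s \<Longrightarrow> y \<in> box t \<Longrightarrow> x + y \<in> box (s + t)"
  by (rule boxI) (auto simp: cd_add box_subset add_mem intro: order_trans[OF abs_triangle_ineq] add_mono boxD)

lemma box_diff: "x \<in> box s \<Longrightarrow> y \<in> box t \<Longrightarrow> x - y \<in> box (s + t)"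
  by (rule boxI) (auto simp: cd_diff box_subset diff_mem intro: order_trans[OF abs_triangle_ineq4] add_mono boxD)

lemma in_some_box:
  assumes "x \<in> F"
  obtains k :: nat where "x \<in> box (of_nat k)"
proof -
  obtain k :: nat where k: "(\<Sum>b\<in>B. \<bar>cd x b\<bar>) \<le> of_nat k"
    using real_arch_simple[of "real_of_rat (\<Sum>b\<in>B. \<bar>cd x b\<bar>)"]
    by (metis of_rat_less_eq of_rat_of_nat_eq)
  have "\<bar>cd x b\<bar> \<le> of_nat k" if "b \<in> B" for b
    using member_le_sum[OF that, of "\<lambda>b. \<bar>cd x b\<bar>"] finite_B k by fastforce
  with assms that show ?thesis by (blast intro: boxI)
qed

lemma finite_in_some_box:
  assumes "finite A" "A \<subseteq> F"
  shows "\<exists>k::nat. A \<subseteq> box (of_nat k)"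
  using assms
proof (induction A)
  case (insert x A)
  then obtain k :: nat where k: "A \<subseteq> box (of_nat k)" by blast
  obtain l :: nat where l: "x \<in> box (of_nat l)" using insert in_some_box by blast
  have "insert x A \<subseteq> box (of_nat (max k l))"
    using k l box_mono[of "of_nat k" "of_nat (max k l)"] box_mono[of "of_nat l" "of_nat (max k l)"]
    by auto
  thus ?case by blast
qed auto

text \<open>C dominates the sum of the absolute values of all structure constants of multiplication
  in the basis \<open>B\<close>.\<close>

lemma box_mult_const: "\<exists>C::nat. \<forall>x y s t. x \<in> box s \<longrightarrow> y \<in> box t \<longrightarrow> x * y \<in> box (of_nat C * s * t)"
proof -
  define S where "S = (\<Sum>p\<in>B\<times>B. \<Sum>b\<in>B. \<bar>cd (fst p * snd p) b\<bar>)"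
  obtain C :: nat where C: "S \<le> of_nat C"
    using real_arch_simple[of "real_of_rat S"]
    by (metis of_rat_less_eq of_rat_of_nat_eq)
  have "x * y \<in> box (of_nat C * s * t)" if x: "x \<in> box s" and y: "y \<in> box t" for x y s t
  proof (rule boxI)
    show "x * y \<in> F" using x y box_subset mult_mem by blast
    fix b assume b: "b \<in> B"
    have st: "0 \<le> s" "0 \<le> t" using x y box_nonneg by auto
    have "x * y = (\<Sum>p\<in>B\<times>B. of_rat (cd x (fst p) * cd y (snd p)) * (fst p * snd p))"
    proof -
      have "x * y = (\<Sum>b\<in>B. of_rat (cd x b) * b) * (\<Sum>b\<in>B. of_rat (cd y b) * b)"
        by (simp add: cd_sum box_subset[OF x] box_subset[OF y])
      also have "\<dots> = (\<Sum>p\<in>B\<times>B. (of_rat (cd x (fst p)) * fst p) * (of_rat (cd y (snd p)) * snd p))"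
        by (simp add: sum_product sum.cartesian_product case_prod_beta)
      also have "\<dots> = (\<Sum>p\<in>B\<times>B. of_rat (cd x (fst p) * cd y (snd p)) * (fst p * snd p))"
        by (intro sum.cong refl) (simp only: of_rat_mult mult_ac)
      finally show ?thesis .
    qed
    hence "cd (x * y) b = (\<Sum>p\<in>B\<times>B. (cd x (fst p) * cd y (snd p)) * cd (fst p * snd p) b)"
      using b by (simp only:) (rule cd_sum_mult, auto intro!: mult_mem intro: B_mem)
    also have "\<bar>\<dots>\<bar> \<le> (\<Sum>p\<in>B\<times>B. \<bar>(cd x (fst p) * cd y (snd p)) * cd (fst p * snd p) b\<bar>)"
      by (rule sum_abs)
    also have "\<dots> \<le> (\<Sum>p\<in>B\<times>B. (s * t) * (\<Sum>b\<in>B. \<bar>cd (fst p * snd p) b\<bar>))"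
    proof (rule sum_mono)
      fix p assume p: "p \<in> B \<times> B"
      have 1: "\<bar>cd (fst p * snd p) b\<bar> \<le> (\<Sum>b\<in>B. \<bar>cd (fst p * snd p) b\<bar>)"
        using finite_B b by (intro member_le_sum) auto
      have 2: "\<bar>cd x (fst p)\<bar> * \<bar>cd y (snd p)\<bar> \<le> s * t"
        using p x y st by (intro mult_mono boxD) auto
      show "\<bar>(cd x (fst p) * cd y (snd p)) * cd (fst p * snd p) b\<bar>
          \<le> (s * t) * (\<Sum>b\<in>B. \<bar>cd (fst p * snd p) b\<bar>)"
        unfolding abs_mult by (rule mult_mono[OF 2 1]) (use st in auto)
    qed
    also have "\<dots> = (s * t) * S" by (simp add: S_def sum_distrib_left)
    also have "\<dots> \<le> (s * t) * of_nat C" using C st by (intro mult_left_mono) auto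
    finally show "\<bar>cd (x * y) b\<bar> \<le> of_nat C * s * t" by (simp add: mult_ac)
  qed
  thus ?thesis by blast
qed

definition mult_const :: nat where
  "mult_const = (SOME C. \<forall>x y s t. x \<in> box s \<longrightarrow> y \<in> box t \<longrightarrow> x * y \<in> box (of_nat C * s * t))"

lemma box_mult: "x \<in> box s \<Longrightarrow> y \<in> box t \<Longrightarrow> x * y \<in> box (of_nat mult_const * s * t)"
  using someI_ex[OF box_mult_const] unfolding mult_const_def by blast

lemma box_power: "x \<in> box t \<Longrightarrow> x ^ Suc k \<in> box (t * (of_nat mult_const * t) ^ k)"
proof (induction k)
  case (Suc k)
  have "x * x ^ Suc k \<in> box (of_nat mult_const * t * (t * (of_nat mult_const * t) ^ k))"
    using Suc by (intro box_mult) auto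
  thus ?case by (simp add: mult_ac)
qed simp

text \<open>M clears the denominators of the first d powers, and the recurrence given by a monic
  integer equation passes this on to all later ones.\<close>

lemma powers_bounded_denominator:
  assumes y: "y \<in> ints"
  obtains M :: nat where "M > 0" "\<And>k b. b \<in> B \<Longrightarrow> of_nat M * cd (y ^ k) b \<in> \<int>"
proof -
  have yF: "y ^ k \<in> F" for k using y by (intro power_mem ints_subset)
  from y obtain d and c :: "nat \<Rightarrow> int" where d: "d > 0" "y ^ d = (\<Sum>i<d. of_int (c i) * y ^ i)"
    using algebraic_int_imp_power_eq[of y] unfolding ints_def by blast
  obtain M where M: "M > 0" "\<forall>p\<in>{..<d}\<times>B. of_nat M * cd (y ^ fst p) (snd p) \<in> \<int>"
    using common_denominator[of "{..<d} \<times> B" "\<lambda>p. cd (y ^ fst p) (snd p)"] finite_B by auto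
  have "of_nat M * cd (y ^ k) b \<in> \<int>" if b: "b \<in> B" for k b
  proof (induction k rule: less_induct)
    case (less k)
    show ?case
    proof (cases "k < d")
      case True
      thus ?thesis using M(2) b by force
    next
      case False
      hence "y ^ k = y ^ (k - d) * y ^ d" by (simp add: power_add[symmetric])
      also have "\<dots> = (\<Sum>i<d. of_rat (of_int (c i)) * y ^ (k - d + i))"
        unfolding d(2) sum_distrib_left by (intro sum.cong refl) (simp add: power_add mult_ac)
      finally have "cd (y ^ k) b = cd (\<Sum>i<d. of_rat (of_int (c i)) * y ^ (k - d + i)) b" by simp
      also have "\<dots> = (\<Sum>i<d. of_int (c i) * cd (y ^ (k - d + i)) b)"
        by (rule cd_sum_mult) (auto intro: yF b)
      finally have "of_nat M * cd (y ^ k) b = (\<Sum>i<d. of_int (c i) * (of_nat M * cd (y ^ (k - d + i)) b))"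
        by (simp add: sum_distrib_left mult_ac)
      also have "\<dots> \<in> \<int>"
        using False by (intro Ints_sum Ints_mult Ints_of_int less.IH) auto
      finally show ?thesis .
    qed
  qed
  with M(1) show ?thesis by (rule that)
qed

text \<open>
  The powers of an algebraic integer have bounded denominators, so they cannot tend to zero
  without vanishing.
\<close>
lemma small_int_eq_0:
  assumes y: "y \<in> ints" "y \<in> box t" and t: "of_nat mult_const * t < 1"
  shows "y = 0"
proof -
  obtain M :: nat where M: "M > 0" "\<And>k b. b \<in> B \<Longrightarrow> of_nat M * cd (y ^ k) b \<in> \<int>"
    using powers_bounded_denominator[OF y(1)] by metis
  have t0: "t \<ge> 0" using box_nonneg y(2) by blast
  have "(\<lambda>k. real M * (real_of_rat t * (real mult_const * real_of_rat t) ^ k))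
      \<longlonglongrightarrow> real M * (real_of_rat t * 0)"
  proof (intro tendsto_intros LIMSEQ_power_zero)
    have "real_of_rat (of_nat mult_const * t) < real_of_rat 1" using t by (simp only: of_rat_less)
    thus "norm (real mult_const * real_of_rat t) < 1" using t0 by (simp add: of_rat_mult)
  qed
  hence "\<forall>\<^sub>F k in sequentially. real M * (real_of_rat t * (real mult_const * real_of_rat t) ^ k) < 1"
    by (intro order_tendstoD(2)) auto
  then obtain k where "real M * (real_of_rat t * (real mult_const * real_of_rat t) ^ k) < 1"
    by (auto simp: eventually_sequentially)
  hence "real_of_rat (of_nat M * (t * (of_nat mult_const * t) ^ k)) < real_of_rat 1"
    by (simp add: of_rat_mult of_rat_power)
  hence k: "of_nat M * (t * (of_nat mult_const * t) ^ k) < 1" by (simp only: of_rat_less)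
  have "cd (y ^ Suc k) b = 0" if b: "b \<in> B" for b
  proof -
    obtain z where z: "of_nat M * cd (y ^ Suc k) b = of_int z"
      using M(2)[OF b, of "Suc k"] by (auto elim: Ints_cases)
    have "\<bar>cd (y ^ Suc k) b\<bar> \<le> t * (of_nat mult_const * t) ^ k"
      by (rule boxD[OF box_power[OF y(2)] b])
    hence "of_nat M * \<bar>cd (y ^ Suc k) b\<bar> \<le> of_nat M * (t * (of_nat mult_const * t) ^ k)"
      by (intro mult_left_mono) auto
    hence "\<bar>of_nat M * cd (y ^ Suc k) b\<bar> < 1" using k by (simp add: abs_mult)
    hence "z = 0" unfolding z by simp
    thus ?thesis using z M(1) by simp
  qed
  hence "y ^ Suc k = 0"
    using cd_zero_imp[of "y ^ Suc k"] y(1) ints_subset power_mem by blast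
  thus ?thesis by auto
qed

end

section \<open>Counting integers in boxes\<close>

lemma card_PiE_const: "finite B \<Longrightarrow> card (B \<rightarrow>\<^sub>E A) = card A ^ card B"
  by (simp add: card_PiE)

context integral_basis
begin

text \<open>The reciprocal of \<open>grid\<close> is a radius at which \<open>small_int_eq_0\<close>
  applies, so it serves as the mesh width when integers are counted. The exact excess of 1 over
  \<open>mult_const\<close> is used in \<open>central_quotient_box\<close>.\<close>

definition grid :: nat where "grid = mult_const + 1"

abbreviation rk :: nat where "rk \<equiv> card B"

lemma ints_separated:
  assumes "y \<in> ints" "\<And>b. b \<in> B \<Longrightarrow> \<bar>cd y b\<bar> < 1 / of_nat grid"
  shows "y = 0"
proof (rule small_int_eq_0)
  show "y \<in> box (1 / of_nat grid)"
    using assms by (intro boxI ints_subset) (auto simp: less_imp_le)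
  have "of_nat mult_const < (of_nat grid :: rat)" by (simp add: grid_def)
  thus "of_nat mult_const * (1 / of_nat grid) < (1::rat)" by (simp add: grid_def)
qed (use assms in auto)

text \<open>Rounding the coordinates down to multiples of 1 / \<open>grid\<close> is injective on
  integers, because two integers in one cell differ by an integer too small to be nonzero.\<close>

lemma card_ints_box:
  assumes "A \<subseteq> ints" "A \<subseteq> box (of_nat N)"
  shows finite_ints_box: "finite A"
    and card_ints_box_le: "card A \<le> (2 * N * grid + 1) ^ rk"
proof -
  define g where "g x = restrict (\<lambda>b. \<lfloor>cd x b * of_nat grid\<rfloor>) B" for x
  define T where "T = (B \<rightarrow>\<^sub>E {- int (N * grid)..int (N * grid)})"
  have inj: "inj_on g A"
  proof (rule inj_onI)
    fix x y assume xy: "x \<in> A" "y \<in> A" and g: "g x = g y"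
    have "\<bar>cd (x - y) b\<bar> < 1 / of_nat grid" if b: "b \<in> B" for b
    proof -
      have "\<lfloor>cd x b * of_nat grid\<rfloor> = \<lfloor>cd y b * of_nat grid\<rfloor>"
        using fun_cong[OF g, of b] b by (simp add: g_def)
      hence "\<bar>cd x b * of_nat grid - cd y b * of_nat grid\<bar> < 1" by linarith
      hence "\<bar>cd x b - cd y b\<bar> * of_nat grid < 1"
        by (simp only: left_diff_distrib[symmetric] abs_mult abs_of_nat)
      moreover have "cd (x - y) b = cd x b - cd y b"
        using xy assms b by (intro cd_diff ints_subset) auto
      ultimately show ?thesis by (simp add: pos_less_divide_eq grid_def)
    qed
    moreover have "x - y \<in> ints" using xy assms by (intro ints_diff) auto
    ultimately show "x = y" using ints_separated[of "x - y"] by simp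
  qed
  have sub: "g ` A \<subseteq> T"
  proof
    fix h assume "h \<in> g ` A"
    then obtain x where x: "x \<in> A" "h = g x" by blast
    have "\<lfloor>cd x b * of_nat grid\<rfloor> \<in> {- int (N * grid)..int (N * grid)}" if b: "b \<in> B" for b
    proof -
      have "\<bar>cd x b\<bar> \<le> of_nat N" using assms(2) x b by (auto intro: boxD)
      hence "\<bar>cd x b\<bar> * of_nat grid \<le> of_nat N * of_nat grid" by (rule mult_right_mono) simp
      hence "\<bar>cd x b * of_nat grid\<bar> \<le> of_nat (N * grid)"
        by (simp only: abs_mult abs_of_nat of_nat_mult)
      hence "cd x b * of_nat grid \<le> of_int (int (N * grid))"
        "of_int (- int (N * grid)) \<le> cd x b * of_nat grid"
        by (simp_all only: of_int_minus of_int_of_nat_eq)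
      thus ?thesis unfolding atLeastAtMost_iff by linarith
    qed
    thus "h \<in> T" unfolding x T_def g_def by auto
  qed
  have finT: "finite T" unfolding T_def using finite_B by (intro finite_PiE) auto
  have cT: "card T = (2 * N * grid + 1) ^ rk"
    unfolding T_def by (simp add: card_PiE_const[OF finite_B] nat_add_distrib nat_mult_distrib algebra_simps)
  show "finite A" using finite_imageD[OF finite_subset[OF sub finT] inj] .
  show "card A \<le> (2 * N * grid + 1) ^ rk"
    using card_inj_on_le[OF inj sub finT] cT by simp
qed

definition comb :: "('a \<Rightarrow> nat) \<Rightarrow> 'a" where "comb a = (\<Sum>b\<in>B. of_nat (a b) * b)"

lemma comb_ints: "comb a \<in> ints"
  unfolding comb_def using B_ints by (intro ints_sum ints_mult ints_of_nat) auto

lemma cd_comb: "b \<in> B \<Longrightarrow> cd (comb a) b = of_nat (a b)"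
  by (rule cd_unique) (simp_all add: comb_def)

lemma comb_box: "(\<And>b. b \<in> B \<Longrightarrow> a b \<le> m) \<Longrightarrow> comb a \<in> box (of_nat m)"
  by (rule boxI) (auto simp: cd_comb ints_subset[OF comb_ints])

lemma comb_inj: "a \<in> B \<rightarrow>\<^sub>E A \<Longrightarrow> a' \<in> B \<rightarrow>\<^sub>E A \<Longrightarrow> comb a = comb a' \<Longrightarrow> a = a'"
proof (rule PiE_ext)
  fix b assume "comb a = comb a'" "b \<in> B"
  hence "(of_nat (a b) :: rat) = of_nat (a' b)" using cd_comb[of b a] cd_comb[of b a'] by simp
  thus "a b = a' b" by simp
qed

lemma one_in_box: "\<exists>k::nat. 1 \<in> box (of_nat k)"
  using in_some_box[OF one_mem] by blast

definition one_bound :: nat where "one_bound = (SOME k. 1 \<in> box (of_nat k))"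

lemma one_box: "1 \<in> box (of_nat one_bound)"
  unfolding one_bound_def by (rule someI_ex[OF one_in_box])

text \<open>
  Packing: representatives of distinct cosets, translated by the multiples of \<open>\<alpha>\<close>
  in a large box, are distinct elements of a box that is larger by a bounded factor.
\<close>
lemma card_incongruent:
  assumes \<alpha>: "\<alpha> \<in> ints" "\<alpha> \<noteq> 0" "\<alpha> \<in> box (of_nat t)" and t: "t \<ge> 1"
    and R: "finite R" "R \<subseteq> ints"
    and inc: "\<And>r r' \<beta>. r \<in> R \<Longrightarrow> r' \<in> R \<Longrightarrow> \<beta> \<in> ints \<Longrightarrow> r - r' = \<alpha> * \<beta> \<Longrightarrow> r = r'"
  shows "card R \<le> ((2 * grid * grid + 1) * t) ^ rk"
proof -
  have "R \<subseteq> F" using R(2) ints_subset by blast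
  then obtain k :: nat where "R \<subseteq> box (of_nat k)"
    using finite_in_some_box[OF R(1)] by blast
  define Y where "Y = max k 1"
  have RY: "R \<subseteq> box (of_nat Y)"
    using \<open>R \<subseteq> box (of_nat k)\<close> box_mono[of "of_nat k" "of_nat Y"] by (auto simp: Y_def)
  \<comment> \<open>The multipliers fill a box of the same size Y as the one holding
    \<open>R\<close>. The factor (Y + 1)^rk then occurs on both sides and cancels, which makes the
    final bound independent of \<open>R\<close>.\<close>
  define P where "P = (B \<rightarrow>\<^sub>E {..Y})"
  define \<phi> where "\<phi> = (\<lambda>(r, a). r + \<alpha> * comb a)"
  have inj: "inj_on \<phi> (R \<times> P)"
  proof (rule inj_onI)
    fix p p' assume p: "p \<in> R \<times> P" "p' \<in> R \<times> P" "\<phi> p = \<phi> p'"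
    obtain r a r' a' where eq: "p = (r, a)" "p' = (r', a')" by (cases p, cases p') blast
    have *: "r \<in> R" "a \<in> P" "r' \<in> R" "a' \<in> P" "r + \<alpha> * comb a = r' + \<alpha> * comb a'"
      using p by (simp_all add: eq \<phi>_def)
    have "r - r' = \<alpha> * (comb a' - comb a)" using *(5) by (simp add: algebra_simps)
    moreover have "comb a' - comb a \<in> ints" by (intro ints_diff comb_ints)
    ultimately have "r = r'" using inc * by blast
    hence "comb a = comb a'" using *(5) \<alpha>(2) by simp
    hence "a = a'" using comb_inj *(2,4) unfolding P_def by blast
    thus "p = p'" using \<open>r = r'\<close> eq by simp
  qed
  have sub: "\<phi> ` (R \<times> P) \<subseteq> box (of_nat ((mult_const * t + 1) * Y))"
  proof
    fix x assume "x \<in> \<phi> ` (R \<times> P)"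
    then obtain r a where "r \<in> R" "a \<in> P" and x: "x = r + \<alpha> * comb a"
      by (auto simp: \<phi>_def)
    hence "r \<in> box (of_nat Y)" "comb a \<in> box (of_nat Y)"
      using RY by (auto intro!: comb_box simp: P_def)
    hence "r + \<alpha> * comb a \<in> box (of_nat Y + of_nat mult_const * of_nat t * of_nat Y)"
      by (intro box_add box_mult \<alpha>(3))
    thus "x \<in> box (of_nat ((mult_const * t + 1) * Y))"
      unfolding x by (simp add: algebra_simps)
  qed
  have sub': "\<phi> ` (R \<times> P) \<subseteq> ints"
    unfolding \<phi>_def using R(2) by (auto intro!: ints_add ints_mult \<alpha>(1) comb_ints)
  have "card R * (Y + 1) ^ rk = card (\<phi> ` (R \<times> P))"
    unfolding card_image[OF inj] unfolding card_cartesian_product P_def card_PiE_const[OF finite_B] by simp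
  also have "\<dots> \<le> (2 * ((mult_const * t + 1) * Y) * grid + 1) ^ rk"
    by (rule card_ints_box_le[OF sub' sub])
  also have "\<dots> \<le> (((2 * grid * grid + 1) * t) * (Y + 1)) ^ rk"
  proof (rule power_mono)
    have "mult_const * t + 1 \<le> grid * t" using t by (simp add: grid_def)
    hence "2 * ((mult_const * t + 1) * Y) * grid \<le> 2 * (grid * t * Y) * grid"
      by (intro mult_le_mono order_refl)
    hence "2 * ((mult_const * t + 1) * Y) * grid + 1 \<le> 2 * grid * grid * t * Y + t * (Y + 1)"
      using t by (simp add: algebra_simps)
    also have "\<dots> \<le> ((2 * grid * grid + 1) * t) * (Y + 1)" by (simp add: algebra_simps)
    finally show "2 * ((mult_const * t + 1) * Y) * grid + 1 \<le> ((2 * grid * grid + 1) * t) * (Y + 1)" .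
  qed simp
  also have "\<dots> = ((2 * grid * grid + 1) * t) ^ rk * (Y + 1) ^ rk" by (rule power_mult_distrib)
  finally show ?thesis by simp
qed

text \<open>The elements \<open>central m a\<close> are dominated by their rational part, so a quotient of two of
  them has coordinates bounded independently of \<open>m\<close>.\<close>

definition central :: "nat \<Rightarrow> ('a \<Rightarrow> nat) \<Rightarrow> 'a" where
  "central m a = of_nat (m * grid) + comb a"

text \<open>In a coordinate of \<open>central m a\<close> the rational part contributes at most m *
  grid * one_bound and \<open>comb a\<close> at most m.\<close>

definition central_bound :: nat where "central_bound = grid * one_bound + 1"

lemma central_ints: "central m a \<in> ints"
  unfolding central_def by (intro ints_add ints_of_nat comb_ints)

lemma central_box:
  assumes "\<And>b. b \<in> B \<Longrightarrow> a b \<le> m"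
  shows "central m a \<in> box (of_nat (m * central_bound))"
proof -
  have "of_nat (m * grid) \<in> box (of_nat (m * grid) * of_nat one_bound)"
  proof (rule boxI[OF of_nat_mem])
    fix b assume b: "b \<in> B"
    have "cd (of_nat (m * grid)) b = of_nat (m * grid) * cd 1 b"
      using cd_scale[OF one_mem b, of "of_nat (m * grid)"] by (simp only: of_rat_of_nat_eq mult_1_right)
    hence "\<bar>cd (of_nat (m * grid)) b\<bar> = of_nat (m * grid) * \<bar>cd 1 b\<bar>"
      by (simp only: abs_mult abs_of_nat)
    also have "\<dots> \<le> of_nat (m * grid) * of_nat one_bound"
      by (intro mult_left_mono boxD[OF one_box b]) (rule of_nat_0_le_iff)
    finally show "\<bar>cd (of_nat (m * grid)) b\<bar> \<le> of_nat (m * grid) * of_nat one_bound" .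
  qed
  hence "central m a \<in> box (of_nat (m * grid) * of_nat one_bound + of_nat m)"
    unfolding central_def using assms by (intro box_add comb_box) auto
  thus ?thesis by (simp add: central_bound_def algebra_simps)
qed

text \<open>Let U be the largest absolute coordinate of u. Writing m * grid * u as
  \<open>central m a * u - comb a * u\<close> gives grid * U \<le> T + mult_const * U, and grid -
  mult_const = 1.\<close>

lemma central_quotient_box:
  assumes a: "\<And>b. b \<in> B \<Longrightarrow> a b \<le> m" and m: "m \<ge> 1"
    and u: "u \<in> F" and w: "central m a * u \<in> box (of_nat m * T)"
  shows "u \<in> box T"
proof -
  define U where "U = Max ((\<lambda>b. \<bar>cd u b\<bar>) ` B)"
  have ne: "B \<noteq> {}" using card_B_pos by auto
  have uU: "u \<in> box U" unfolding U_def using finite_B u by (intro boxI) auto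
  have "U \<in> (\<lambda>b. \<bar>cd u b\<bar>) ` B" unfolding U_def using finite_B ne by (intro Max_in) auto
  then obtain b where b: "b \<in> B" "U = \<bar>cd u b\<bar>" by blast
  have "of_rat (of_nat (m * grid)) * u = central m a * u - comb a * u"
    unfolding of_rat_of_nat_eq central_def distrib_right by (rule add_diff_cancel_right'[symmetric])
  moreover have "central m a * u - comb a * u \<in> box (of_nat m * T + of_nat mult_const * of_nat m * U)"
    using a by (intro box_diff w box_mult comb_box uU) auto
  ultimately have "\<bar>of_nat (m * grid) * cd u b\<bar> \<le> of_nat m * T + of_nat mult_const * of_nat m * U"
    using boxD[OF _ b(1)] cd_scale[OF u b(1)] by metis
  hence "of_nat m * (of_nat grid * U) \<le> of_nat m * (T + of_nat mult_const * U)"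
    unfolding b(2) by (simp add: abs_mult algebra_simps)
  hence "of_nat grid * U \<le> T + of_nat mult_const * U"
    using m by (simp only: mult_le_cancel_left_pos of_nat_0_less_iff)
  hence "U \<le> T" by (simp add: grid_def algebra_simps)
  thus ?thesis using box_mono uU by blast
qed

lemma central_nonzero:
  assumes "\<And>b. b \<in> B \<Longrightarrow> a b \<le> m" "m \<ge> 1"
  shows "central m a \<noteq> 0"
proof
  assume 0: "central m a = 0"
  have "1 \<in> box (0::rat)"
  proof (rule central_quotient_box[OF assms one_mem])
    show "central m a * 1 \<in> box (of_nat m * 0)" unfolding 0
      by (rule boxI) (auto simp: cd_0 zero_mem)
  qed
  hence "cd 1 b = 0" if "b \<in> B" for b using boxD[of 1 0 b] that by simp
  thus False using cd_zero_imp[OF one_mem] by simp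
qed

text \<open>Bounds, independently of m, how many central elements can generate the same principal
  ideal. The quotients by a fixed one are distinct integers in a box that does not depend on
  m.\<close>

lemma card_central_multiples:
  assumes A: "A \<subseteq> (B \<rightarrow>\<^sub>E {..m})" "m \<ge> 1" and a0: "a0 \<in> A"
    and mult: "\<And>a. a \<in> A \<Longrightarrow> \<exists>u\<in>ints. central m a = central m a0 * u"
  shows "card A \<le> (2 * central_bound * grid + 1) ^ rk"
proof -
  have le: "a b \<le> m" if "a \<in> A" "b \<in> B" for a b using A(1) that by auto
  define v where "v a = (SOME u. u \<in> ints \<and> central m a = central m a0 * u)" for a
  have v: "v a \<in> ints" "central m a = central m a0 * v a" if "a \<in> A" for a
    using someI_ex[OF mult[OF that, unfolded Bex_def]] unfolding v_def by auto
  have inj: "inj_on v A"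
  proof (rule inj_onI)
    fix a a' assume *: "a \<in> A" "a' \<in> A" "v a = v a'"
    hence "central m a = central m a'" using v(2)[OF *(1)] v(2)[OF *(2)] by simp
    hence "comb a = comb a'" by (simp add: central_def)
    thus "a = a'" using comb_inj A(1) * by blast
  qed
  have "v ` A \<subseteq> box (of_nat central_bound)"
  proof
    fix w assume "w \<in> v ` A"
    then obtain a where a: "a \<in> A" "w = v a" by blast
    have "central m a \<in> box (of_nat (m * central_bound))" using a le by (intro central_box) auto
    hence 1: "central m a0 * v a \<in> box (of_nat m * of_nat central_bound)"
      using v(2)[OF a(1)] by simp
    show "w \<in> box (of_nat central_bound)"
      unfolding a(2)
      by (rule central_quotient_box[OF le[OF a0] A(2) ints_subset[OF v(1)[OF a(1)]] 1])
  qed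
  hence "card (v ` A) \<le> (2 * central_bound * grid + 1) ^ rk"
    using v(1) by (intro card_ints_box_le) auto
  thus ?thesis by (simp add: card_image[OF inj])
qed

end

section \<open>Ideals of the ring of integers\<close>

context number_subfield
begin

definition idl :: "'a set \<Rightarrow> bool" where
  "idl I \<longleftrightarrow> I \<subseteq> ints \<and> 0 \<in> I \<and> (\<forall>x\<in>I. \<forall>y\<in>I. x + y \<in> I) \<and> (\<forall>x\<in>I. \<forall>r\<in>ints. r * x \<in> I)"

definition nzidl :: "'a set \<Rightarrow> bool" where
  "nzidl I \<longleftrightarrow> idl I \<and> I \<noteq> {0}"

definition maxidl :: "'a set \<Rightarrow> bool" where
  "maxidl P \<longleftrightarrow> idl P \<and> P \<noteq> ints \<and> (\<forall>J. idl J \<longrightarrow> P \<subseteq> J \<longrightarrow> J = P \<or> J = ints)"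

text \<open>Written with the ideal on the left, like the cosets of the quotient ring in HOL-Algebra;
  \<open>prime_norm_eq\<close> compares the two.\<close>

definition residue :: "'a set \<Rightarrow> 'a \<Rightarrow> 'a set" where
  "residue I x = (\<lambda>i. i + x) ` I"

text \<open>An infinite quotient would get norm 0; \<open>finite_quotient\<close> excludes this for
  nonzero ideals.\<close>

definition N :: "'a set \<Rightarrow> nat" where "N I = card (residue I ` ints)"

lemma idlI:
  assumes "I \<subseteq> ints" "0 \<in> I" "\<And>x y. x \<in> I \<Longrightarrow> y \<in> I \<Longrightarrow> x + y \<in> I"
    "\<And>x r. x \<in> I \<Longrightarrow> r \<in> ints \<Longrightarrow> r * x \<in> I"
  shows "idl I"
  using assms unfolding idl_def by blast

lemma idl_ints: "idl I \<Longrightarrow> x \<in> I \<Longrightarrow> x \<in> ints"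
  and idl_0: "idl I \<Longrightarrow> 0 \<in> I"
  and idl_add: "idl I \<Longrightarrow> x \<in> I \<Longrightarrow> y \<in> I \<Longrightarrow> x + y \<in> I"
  and idl_mult: "idl I \<Longrightarrow> x \<in> I \<Longrightarrow> r \<in> ints \<Longrightarrow> r * x \<in> I"
  unfolding idl_def by blast+

lemma idl_mult_right: "idl I \<Longrightarrow> x \<in> I \<Longrightarrow> r \<in> ints \<Longrightarrow> x * r \<in> I"
  using idl_mult[of I x r] by (simp add: mult.commute)

lemma idl_minus: "idl I \<Longrightarrow> x \<in> I \<Longrightarrow> - x \<in> I"
  using idl_mult[of I x "- 1"] ints_minus[OF ints_1] by simp

lemma idl_diff: "idl I \<Longrightarrow> x \<in> I \<Longrightarrow> y \<in> I \<Longrightarrow> x - y \<in> I"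
  using idl_add[of I x "- y"] idl_minus[of I y] by simp

lemma idl_one: "idl I \<Longrightarrow> 1 \<in> I \<longleftrightarrow> I = ints"
  using idl_mult[of I 1] idl_ints[of I] ints_1 by auto

lemma ints_idl: "idl ints"
  by (rule idlI) (auto intro: ints_0 ints_add ints_mult)

lemma nz_idl: "nzidl I \<Longrightarrow> idl I" by (simp add: nzidl_def)

lemma nzidlE:
  assumes "nzidl I"
  obtains a where "a \<in> I" "a \<noteq> 0"
  using assms idl_0[of I] unfolding nzidl_def by blast

lemma nzidlI: "idl I \<Longrightarrow> a \<in> I \<Longrightarrow> a \<noteq> 0 \<Longrightarrow> nzidl I"
  unfolding nzidl_def by blast

lemma ints_nzidl: "nzidl ints"
  by (rule nzidlI[OF ints_idl ints_1]) simp

lemma nzidl_mono: "nzidl I \<Longrightarrow> idl J \<Longrightarrow> I \<subseteq> J \<Longrightarrow> nzidl J"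
  by (meson nzidlE nzidlI subsetD)

definition principal :: "'a \<Rightarrow> 'a set" where "principal a = (*) a ` ints"

lemma principalI: "r \<in> ints \<Longrightarrow> a * r \<in> principal a"
  unfolding principal_def by (rule imageI)

lemma principal_idl: "a \<in> ints \<Longrightarrow> idl (principal a)"
proof (rule idlI)
  assume a: "a \<in> ints"
  show "principal a \<subseteq> ints" using a by (auto simp: principal_def intro: ints_mult)
  show "0 \<in> principal a" using principalI[OF ints_0, of a] by simp
  show "x + y \<in> principal a" if "x \<in> principal a" "y \<in> principal a" for x y
    using that by (auto simp: principal_def distrib_left[symmetric] intro: ints_add)
  show "r * x \<in> principal a" if "x \<in> principal a" "r \<in> ints" for x r
    using that by (auto simp: principal_def mult.left_commute[of r] intro: ints_mult)
qed

lemma principal_self: "a \<in> principal a"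
  using principalI[OF ints_1, of a] by simp

lemma principal_nzidl: "a \<in> ints \<Longrightarrow> a \<noteq> 0 \<Longrightarrow> nzidl (principal a)"
  by (rule nzidlI[OF principal_idl principal_self])

lemma principal_subset: "idl I \<Longrightarrow> a \<in> I \<Longrightarrow> principal a \<subseteq> I"
  by (auto simp: principal_def intro: idl_mult_right)

lemma residue_eq_iff: "idl I \<Longrightarrow> residue I x = residue I y \<longleftrightarrow> x - y \<in> I"
proof
  assume I: "idl I" and "residue I x = residue I y"
  moreover have "x \<in> residue I x" unfolding residue_def using idl_0[OF I] by force
  ultimately show "x - y \<in> I" by (auto simp: residue_def)
next
  have sub: "residue I x \<subseteq> residue I y" if I: "idl I" and xy: "x - y \<in> I" for x y
  proof
    fix z assume "z \<in> residue I x"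
    then obtain i where i: "i \<in> I" "z = i + x" by (auto simp: residue_def)
    have "i + (x - y) \<in> I" by (rule idl_add[OF I i(1) xy])
    moreover have "z = (i + (x - y)) + y" using i by simp
    ultimately show "z \<in> residue I y" unfolding residue_def by blast
  qed
  assume "idl I" "x - y \<in> I"
  moreover from this have "y - x \<in> I" using idl_minus[of I "x - y"] by simp
  ultimately show "residue I x = residue I y" using sub by blast
qed

lemma residue_reps:
  obtains R where "R \<subseteq> ints" "inj_on (residue I) R" "residue I ` R = residue I ` ints"
  using subset_image_inj[of "residue I ` ints" "residue I" ints] by (metis order_refl)

text \<open>The packing bound holds for every finite part of a system of representatives modulo
  \<alpha>. This yields finiteness of the quotient and the estimate of its size together.\<close>

lemma (in integral_basis) principal_bound:
  assumes \<alpha>: "\<alpha> \<in> ints" "\<alpha> \<noteq> 0" "\<alpha> \<in> box (of_nat t)" and t: "t \<ge> 1"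
  shows finite_principal_quotient: "finite (residue (principal \<alpha>) ` ints)"
    and N_principal_le: "N (principal \<alpha>) \<le> ((2 * grid * grid + 1) * t) ^ rk"
proof -
  let ?b = "((2 * grid * grid + 1) * t) ^ rk"
  obtain R where R: "R \<subseteq> ints" "inj_on (residue (principal \<alpha>)) R"
      "residue (principal \<alpha>) ` R = residue (principal \<alpha>) ` ints"
    using residue_reps by blast
  have bound: "card S \<le> ?b" if S: "S \<subseteq> R" "finite S" for S
  proof (rule card_incongruent[OF \<alpha> t S(2)])
    show "S \<subseteq> ints" using S R by blast
    fix r r' \<beta> assume *: "r \<in> S" "r' \<in> S" "\<beta> \<in> ints" "r - r' = \<alpha> * \<beta>"
    hence "residue (principal \<alpha>) r = residue (principal \<alpha>) r'"
      unfolding residue_eq_iff[OF principal_idl[OF \<alpha>(1)]] by (simp add: principalI)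
    thus "r = r'" using R(2) S * by (meson inj_onD subsetD)
  qed
  have fin: "finite R"
  proof (rule ccontr)
    assume "infinite R"
    then obtain S where S: "S \<subseteq> R" "finite S" "card S = Suc ?b"
      using infinite_arbitrarily_large by blast
    show False using bound[OF S(1,2)] unfolding S(3) by (rule Suc_n_not_le_n[THEN notE])
  qed
  show "finite (residue (principal \<alpha>) ` ints)" unfolding R(3)[symmetric] using fin by simp
  show "N (principal \<alpha>) \<le> ?b"
    unfolding N_def R(3)[symmetric] card_image[OF R(2)] using bound fin by blast
qed

lemma finite_quotient_principal:
  assumes "a \<in> ints" "a \<noteq> 0"
  shows "finite (residue (principal a) ` ints)"
proof -
  obtain B where "integral_basis F B" using integral_basis_exists by blast
  then interpret integral_basis F B .
  obtain k :: nat where "a \<in> box (of_nat k)" using in_some_box ints_subset assms by blast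
  hence "a \<in> box (of_nat (Suc k))" using box_mono[of "of_nat k" "of_nat (Suc k)"] by simp
  thus ?thesis using finite_principal_quotient assms by fastforce
qed

lemma residue_superset:
  assumes "idl I" "idl J" "I \<subseteq> J"
  shows "\<exists>g. \<forall>x. residue J x = g (residue I x)"
proof -
  have "residue J x = residue J (SOME y. residue I y = residue I x)" for x
  proof -
    have "residue I (SOME y. residue I y = residue I x) = residue I x" by (rule someI) (rule refl)
    thus ?thesis using assms residue_eq_iff by (metis subsetD)
  qed
  thus ?thesis by (intro exI[of _ "\<lambda>r. residue J (SOME y. residue I y = r)"]) blast
qed

lemma finite_quotient:
  assumes "nzidl I"
  shows "finite (residue I ` ints)"
proof -
  obtain a where a: "a \<in> I" "a \<noteq> 0" using nzidlE[OF assms] by blast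
  have I: "idl I" using nz_idl assms by blast
  have "principal a \<subseteq> I" by (rule principal_subset[OF I a(1)])
  then obtain g where "\<forall>x. residue I x = g (residue (principal a) x)"
    using residue_superset[OF principal_idl I] idl_ints[OF I a(1)] by blast
  hence "residue I ` ints = g ` (residue (principal a) ` ints)" by (auto simp: image_iff)
  thus ?thesis using finite_quotient_principal[OF idl_ints[OF I a(1)] a(2)] by simp
qed

lemma N_pos: "nzidl I \<Longrightarrow> N I > 0"
  unfolding N_def using finite_quotient ints_0 by (metis card_gt_0_iff empty_iff image_is_empty)

text \<open>Makes the norm a termination measure: the inductions over growing ideals below run on it
  in place of a chain condition.\<close>

lemma N_less:
  assumes "nzidl I" "idl J" "I \<subset> J"
  shows "N J < N I"
proof -
  have I: "idl I" using nz_idl assms by blast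
  obtain g where g: "\<forall>x. residue J x = g (residue I x)"
    using residue_superset[OF I assms(2)] assms(3) by blast
  have im: "residue J ` ints = g ` (residue I ` ints)" using g by (auto simp: image_iff)
  obtain x where x: "x \<in> J" "x \<notin> I" using assms(3) by blast
  have "\<not> inj_on g (residue I ` ints)"
  proof
    assume inj: "inj_on g (residue I ` ints)"
    have "residue J x = residue J 0" using residue_eq_iff[OF assms(2)] x by simp
    hence "g (residue I x) = g (residue I 0)" using g by simp
    hence "residue I x = residue I 0"
      using inj idl_ints[OF assms(2) x(1)] ints_0 by (simp add: inj_on_eq_iff)
    thus False using residue_eq_iff[OF I] x by simp
  qed
  moreover have fin: "finite (residue I ` ints)" by (rule finite_quotient[OF assms(1)])
  ultimately have "card (g ` (residue I ` ints)) \<noteq> card (residue I ` ints)"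
    using eq_card_imp_inj_on by blast
  moreover have "card (g ` (residue I ` ints)) \<le> card (residue I ` ints)"
    by (rule card_image_le[OF fin])
  ultimately show ?thesis unfolding N_def im by linarith
qed

lemma N_ints: "N ints = 1"
proof -
  have "residue ints x = residue ints 0" if "x \<in> ints" for x
    using residue_eq_iff[OF ints_idl, of x 0] that by simp
  hence "residue ints ` ints = {residue ints 0}" using ints_0 by blast
  thus ?thesis by (simp add: N_def)
qed

section \<open>Maximal ideals\<close>

lemma max_idl: "maxidl P \<Longrightarrow> idl P" by (simp add: maxidl_def)

lemma maxidlD: "maxidl P \<Longrightarrow> idl J \<Longrightarrow> P \<subseteq> J \<Longrightarrow> J \<noteq> ints \<Longrightarrow> J = P"
  unfolding maxidl_def by blast

lemma maxidl_one: "maxidl P \<Longrightarrow> 1 \<notin> P"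
  unfolding maxidl_def using idl_one by blast

text \<open>The element 2 works: a rational algebraic integer is an ordinary integer, and 1/2 is not
  one. Hence the zero ideal is not maximal.\<close>

lemma not_all_units: "\<exists>a\<in>ints. a \<noteq> 0 \<and> inverse a \<notin> ints"
proof (rule bexI[of _ 2])
  have "(of_rat (1/2) :: 'a) = inverse 2" by (simp add: of_rat_divide inverse_eq_divide)
  hence r: "inverse (2::'a) \<in> \<rat>" by (metis Rats_of_rat)
  have "inverse (2::'a) \<notin> \<int>"
  proof
    assume "inverse (2::'a) \<in> \<int>"
    then obtain k where "inverse (2::'a) = of_int k" by (auto elim: Ints_cases)
    hence "(1::'a) = of_int (2 * k)" by (simp add: field_simps)
    hence "(of_int 1 :: 'a) = of_int (2 * k)" by simp
    hence "1 = 2 * k" by (simp only: of_int_eq_iff)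
    thus False by presburger
  qed
  hence "\<not> algebraic_int (inverse (2::'a))" using rational_algebraic_int_is_int r by blast
  thus "(2::'a) \<noteq> 0 \<and> inverse 2 \<notin> ints" by (simp add: ints_def)
  show "2 \<in> ints" using ints_of_nat[of 2] by simp
qed

lemma max_nzidl:
  assumes P: "maxidl P"
  shows "nzidl P"
proof (rule ccontr)
  assume "\<not> nzidl P"
  hence P0: "P = {0}" using max_idl[OF P] by (simp add: nzidl_def)
  obtain a where a: "a \<in> ints" "a \<noteq> 0" "inverse a \<notin> ints" using not_all_units by blast
  have "principal a = P \<or> principal a = ints"
    using P principal_idl[OF a(1)] idl_0[OF principal_idl[OF a(1)]] unfolding maxidl_def P0 by blast
  moreover have "principal a \<noteq> P" unfolding P0 using principal_self a(2) by blast
  ultimately have "1 \<in> principal a" using ints_1 by simp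
  then obtain r where "r \<in> ints" "1 = a * r" by (auto simp: principal_def)
  thus False using a by (metis inverse_unique)
qed

definition isum :: "'a set \<Rightarrow> 'a set \<Rightarrow> 'a set" where
  "isum I J = (\<lambda>(x,y). x + y) ` (I \<times> J)"

lemma isumI: "x \<in> I \<Longrightarrow> y \<in> J \<Longrightarrow> x + y \<in> isum I J"
  by (auto simp: isum_def)

lemma isum_idl:
  assumes "idl I" "idl J"
  shows "idl (isum I J)"
proof (rule idlI)
  show "isum I J \<subseteq> ints" using assms by (auto simp: isum_def intro: ints_add idl_ints)
  show "0 \<in> isum I J" using isumI[OF idl_0 idl_0] assms by force
  show "x + y \<in> isum I J" if "x \<in> isum I J" "y \<in> isum I J" for x y
  proof -
    from that obtain a b c d where *: "a \<in> I" "b \<in> J" "c \<in> I" "d \<in> J" "x = a + b" "y = c + d"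
      by (auto simp: isum_def)
    have "x + y = (a + c) + (b + d)" using * by simp
    thus ?thesis using isumI[OF idl_add[OF assms(1) *(1,3)] idl_add[OF assms(2) *(2,4)]] by metis
  qed
  show "r * x \<in> isum I J" if "x \<in> isum I J" "r \<in> ints" for x r
    using that assms by (auto simp: isum_def distrib_left intro!: image_eqI[of _ _ "(r * _, r * _)"] idl_mult)
qed

lemma isum_upper: "idl I \<Longrightarrow> idl J \<Longrightarrow> I \<subseteq> isum I J \<and> J \<subseteq> isum I J"
  using isumI[of _ I 0 J] isumI[of 0 I _ J] idl_0 by force

lemma maxidl_unit_mod:
  assumes P: "maxidl P" and a: "a \<in> ints" "a \<notin> P"
  obtains u p where "u \<in> ints" "p \<in> P" "u * a + p = 1"
proof -
  have I: "idl (principal a)" "idl P" using principal_idl a max_idl P by auto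
  have "isum (principal a) P = ints"
    using maxidlD[OF P isum_idl[OF I]] isum_upper[OF I] principal_self a by blast
  hence "1 \<in> isum (principal a) P" using ints_1 by simp
  then obtain u p where "u \<in> ints" "p \<in> P" "1 = a * u + p"
    by (auto simp: isum_def principal_def)
  thus ?thesis using that by (metis mult.commute)
qed

lemma maxidl_prime:
  assumes P: "maxidl P" and ab: "a \<in> ints" "b \<in> ints" "a * b \<in> P"
  shows "a \<in> P \<or> b \<in> P"
proof (rule ccontr)
  assume "\<not> (a \<in> P \<or> b \<in> P)"
  then obtain u p where u: "u \<in> ints" "p \<in> P" "u * a + p = 1"
    using maxidl_unit_mod[OF P ab(1)] by blast
  have "b = (u * a + p) * b" using u by simp
  also have "\<dots> = u * (a * b) + b * p" by (simp add: algebra_simps)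
  also have "\<dots> \<in> P"
    by (intro idl_add[OF max_idl[OF P]] idl_mult[OF max_idl[OF P] ab(3) u(1)]
        idl_mult[OF max_idl[OF P] u(2) ab(2)])
  finally show False using \<open>\<not> (a \<in> P \<or> b \<in> P)\<close> by blast
qed

lemma maxidl_exists:
  assumes "nzidl I" "I \<noteq> ints"
  shows "\<exists>P. maxidl P \<and> I \<subseteq> P"
  using assms
proof (induction "N I" arbitrary: I rule: less_induct)
  case less
  show ?case
  proof (cases "maxidl I")
    case False
    then obtain J where J: "idl J" "I \<subseteq> J" "J \<noteq> I" "J \<noteq> ints"
      unfolding maxidl_def using less.prems nz_idl by blast
    hence "I \<subset> J" by blast
    hence "\<exists>P. maxidl P \<and> J \<subseteq> P"
      using less.hyps[OF N_less[OF less.prems(1) J(1)] nzidl_mono[OF less.prems(1) J(1,2)] J(4)] by blast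
    thus ?thesis using J(2) by blast
  qed blast
qed

end

section \<open>Products of ideals\<close>

inductive_set iprod :: "'a::field set \<Rightarrow> 'a set \<Rightarrow> 'a set" for I J where
  prod: "i \<in> I \<Longrightarrow> j \<in> J \<Longrightarrow> i * j \<in> iprod I J"
| sum: "x \<in> iprod I J \<Longrightarrow> y \<in> iprod I J \<Longrightarrow> x + y \<in> iprod I J"

lemma iprod_subsetI:
  assumes "\<And>i j. i \<in> I \<Longrightarrow> j \<in> J \<Longrightarrow> i * j \<in> S" "\<And>x y. x \<in> S \<Longrightarrow> y \<in> S \<Longrightarrow> x + y \<in> S"
  shows "iprod I J \<subseteq> S"
proof
  fix x assume "x \<in> iprod I J"
  thus "x \<in> S" by induction (use assms in auto)
qed

lemma iprod_mono: "I \<subseteq> I' \<Longrightarrow> J \<subseteq> J' \<Longrightarrow> iprod I J \<subseteq> iprod I' J'"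
  by (rule iprod_subsetI) (auto intro: iprod.intros)

lemma iprod_comm: "iprod I J = iprod J I"
proof -
  have "iprod I J \<subseteq> iprod J I" for I J :: "'a::field set"
    by (rule iprod_subsetI) (metis iprod.prod mult.commute, rule iprod.sum)
  thus ?thesis by blast
qed

lemma iprod_assoc_subset: "iprod (iprod I J) K \<subseteq> iprod I (iprod J K)"
proof (rule iprod_subsetI)
  fix i j assume "i \<in> iprod I J" "j \<in> K"
  thus "i * j \<in> iprod I (iprod J K)"
  proof (induction i)
    case (prod x y)
    have "x * (y * j) \<in> iprod I (iprod J K)" using prod by (intro iprod.prod) auto
    thus ?case by (simp add: mult.assoc)
  next
    case (sum x y)
    thus ?case unfolding distrib_right by (intro iprod.sum) auto
  qed
qed (rule iprod.sum)

lemma iprod_assoc: "iprod (iprod I J) K = iprod I (iprod J K)"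
proof (rule subset_antisym[OF iprod_assoc_subset])
  have "iprod (iprod K J) I \<subseteq> iprod K (iprod J I)" by (rule iprod_assoc_subset)
  thus "iprod I (iprod J K) \<subseteq> iprod (iprod I J) K" by (metis iprod_comm)
qed

context number_subfield
begin

lemma iprod_subset_right: "idl I \<Longrightarrow> idl J \<Longrightarrow> iprod I J \<subseteq> J"
  by (rule iprod_subsetI) (auto intro: idl_mult idl_ints idl_add)

lemma iprod_subset_left: "idl I \<Longrightarrow> idl J \<Longrightarrow> iprod I J \<subseteq> I"
  using iprod_subset_right[of J I] iprod_comm[of I J] by simp

lemma iprod_idl:
  assumes "idl I" "idl J"
  shows "idl (iprod I J)"
proof (rule idlI)
  show "iprod I J \<subseteq> ints" using iprod_subset_left[OF assms] idl_ints[OF assms(1)] by blast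
  show "0 \<in> iprod I J" using iprod.prod[OF idl_0 idl_0] assms by force
  show "r * x \<in> iprod I J" if "x \<in> iprod I J" "r \<in> ints" for x r
    using that(1)
  proof induction
    case (prod i j)
    thus ?case using iprod.prod[OF idl_mult[OF assms(1) prod(1) that(2)] prod(2)] by (simp add: mult.assoc)
  next
    case (sum x y)
    thus ?case unfolding distrib_left by (intro iprod.sum)
  qed
qed (rule iprod.sum)

lemma iprod_nzidl:
  assumes "nzidl I" "nzidl J"
  shows "nzidl (iprod I J)"
proof -
  obtain a b where "a \<in> I" "a \<noteq> 0" "b \<in> J" "b \<noteq> 0" using assms nzidlE by metis
  thus ?thesis using nzidlI[OF iprod_idl iprod.prod, of I J a b] assms nz_idl by simp
qed

lemma iprod_ints: "idl J \<Longrightarrow> iprod ints J = J"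
proof
  assume J: "idl J"
  show "iprod ints J \<subseteq> J" by (rule iprod_subset_right[OF ints_idl J])
  show "J \<subseteq> iprod ints J" using iprod.prod[OF ints_1, of _ J] by auto
qed

section \<open>Invertibility of maximal ideals and unique factorization\<close>

lemma power_pigeonhole:
  assumes I: "nzidl I" and z: "\<And>k. z k \<in> ints"
  shows "\<exists>i j::nat. i < j \<and> z j - z i \<in> I"
proof -
  have "finite (range (\<lambda>k. residue I (z k)))"
    by (rule finite_subset[OF _ finite_quotient[OF I]]) (use z in auto)
  hence "\<not> inj (\<lambda>k. residue I (z k))" using finite_imageD infinite_UNIV_nat by blast
  then obtain i j where "i \<noteq> j" "residue I (z i) = residue I (z j)" unfolding inj_on_def by blast
  then obtain i j where "i < j" "residue I (z j) = residue I (z i)" by (metis linorder_neqE_nat)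
  thus ?thesis using residue_eq_iff[OF nz_idl[OF I]] by blast
qed

text \<open>For a nonzero a in I all x^k a are integers, and two of them agree modulo (a) because
  that quotient is finite. So x^j - x^i is integral for some i < j, and no finite generation of I
  enters.\<close>

lemma multiplier_integral:
  assumes I: "nzidl I" and x: "x \<in> F" and st: "\<And>a. a \<in> I \<Longrightarrow> x * a \<in> I"
  shows "x \<in> ints"
proof -
  obtain a where a: "a \<in> I" "a \<noteq> 0" using nzidlE[OF I] by blast
  have aI: "a \<in> ints" using idl_ints[OF nz_idl[OF I] a(1)] .
  have pw: "x ^ k * a \<in> I" for k
  proof (induction k)
    case (Suc k)
    thus ?case using st[of "x ^ k * a"] by (simp add: mult.assoc)
  qed (use a in simp)
  hence "x ^ k * a \<in> ints" for k using idl_ints[OF nz_idl[OF I]] by blast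
  then obtain i j where ij: "i < j" "x ^ j * a - x ^ i * a \<in> principal a"
    using power_pigeonhole[OF principal_nzidl[OF aI a(2)], of "\<lambda>k. x ^ k * a"] by blast
  then obtain r where r: "r \<in> ints" "x ^ j * a - x ^ i * a = a * r" by (auto simp: principal_def)
  hence "(x ^ j - x ^ i) * a = r * a" by (simp only: left_diff_distrib mult.commute[of a])
  hence "x ^ j - x ^ i = r" using a(2) by simp
  hence "algebraic_int (x ^ j - x ^ i)" using r(1) by (simp add: ints_def)
  hence "algebraic_int x" by (rule algebraic_int_if_power_diff[OF ij(1)])
  thus ?thesis using x by (simp add: ints_def)
qed

definition colon :: "'a set \<Rightarrow> 'a \<Rightarrow> 'a set" where "colon I y = {z \<in> ints. z * y \<in> I}"

lemma colon_idl: "idl I \<Longrightarrow> y \<in> ints \<Longrightarrow> idl (colon I y)"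
  by (rule idlI) (auto simp: colon_def distrib_right mult.assoc
      intro: ints_0 ints_add ints_mult idl_0 idl_add idl_mult)

lemma colon_upper: "idl I \<Longrightarrow> y \<in> ints \<Longrightarrow> I \<subseteq> colon I y"
  by (auto simp: colon_def idl_ints intro: idl_mult_right)

text \<open>The powers of y repeat modulo I, so y^k (1 - y^m) lies in I for some k and some m > 0.
  For the least such k, positive because 1 - y^m is outside P, the element with exponent k - 1 is
  not in I but is killed by y.\<close>

lemma zero_divisor_mod:
  assumes I: "nzidl I" and P: "maxidl P" "I \<subseteq> P" and y: "y \<in> P"
  shows "\<exists>w\<in>ints. w \<notin> I \<and> w * y \<in> I"
proof -
  have II: "idl I" and PP: "idl P" using I P nz_idl max_idl by blast+
  have yi: "y \<in> ints" using idl_ints[OF PP y] .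
  define Q where "Q k \<longleftrightarrow> (\<exists>m>0. y ^ k * (1 - y ^ m) \<in> I)" for k
  obtain i j where ij: "i < j" "y ^ j - y ^ i \<in> I"
    using power_pigeonhole[OF I, of "\<lambda>k. y ^ k"] ints_power[OF yi] by blast
  have "y ^ j = y ^ i * y ^ (j - i)" using ij(1) by (simp add: power_add[symmetric])
  hence "y ^ i * (1 - y ^ (j - i)) = - (y ^ j - y ^ i)" by (simp add: algebra_simps)
  hence "y ^ i * (1 - y ^ (j - i)) \<in> I" using idl_minus[OF II ij(2)] by simp
  hence "Q i" unfolding Q_def using ij(1) by (intro exI[of _ "j - i"]) auto
  define k where "k = (LEAST k. Q k)"
  have "Q k" unfolding k_def using \<open>Q i\<close> by (rule LeastI)
  then obtain m where m: "m > 0" "y ^ k * (1 - y ^ m) \<in> I" unfolding Q_def by blast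
  have ymP: "y ^ m \<in> P"
    using idl_mult_right[OF PP y ints_power[OF yi]] m(1) by (cases m) auto
  have "k \<noteq> 0"
  proof
    assume "k = 0"
    hence "1 - y ^ m \<in> P" using m(2) P(2) by auto
    hence "1 - y ^ m + y ^ m \<in> P" using ymP by (intro idl_add[OF PP])
    thus False using maxidl_one[OF P(1)] by simp
  qed
  then obtain k' where k': "k = Suc k'" using not0_implies_Suc by blast
  define w where "w = y ^ k' * (1 - y ^ m)"
  have "\<not> Q k'" using not_less_Least[of k' Q] unfolding k_def[symmetric] k' by simp
  hence "w \<notin> I" unfolding Q_def w_def using m(1) by blast
  moreover have "w * y = y ^ k * (1 - y ^ m)" by (simp add: w_def k' mult_ac)
  moreover have "w \<in> ints" unfolding w_def by (intro ints_mult ints_power ints_diff ints_1 yi)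
  ultimately show ?thesis using m(2) by metis
qed

text \<open>P is an associated prime of the quotient by I. The induction replaces I by a strictly
  larger \<open>colon I z\<close> inside P; a witness b for the colon ideal gives the witness b z
  for I.\<close>

lemma maxidl_annihilator:
  assumes "nzidl I" "maxidl P" "I \<subseteq> P"
  shows "\<exists>b\<in>ints. b \<notin> I \<and> (\<forall>p\<in>P. b * p \<in> I)"
  using assms
proof (induction "N I" arbitrary: I rule: less_induct)
  case less
  note I = less.prems(1) and P = less.prems(2) and IP = less.prems(3)
  have II: "idl I" and PP: "idl P" using I P nz_idl max_idl by blast+
  show ?case
  proof (cases "I = P")
    case True
    thus ?thesis using maxidl_one[OF P] ints_1 by (intro bexI[of _ 1]) auto
  next
    case False
    then obtain y where y: "y \<in> P" "y \<notin> I" using IP by blast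
    have yi: "y \<in> ints" using idl_ints[OF PP y(1)] .
    obtain w where w: "w \<in> ints" "w \<notin> I" "w * y \<in> I"
      using zero_divisor_mod[OF I P IP y(1)] by blast
    have "\<exists>z\<in>ints. z \<notin> I \<and> I \<subset> colon I z \<and> colon I z \<subseteq> P"
    \<comment> \<open>If the annihilator of y modulo I lies in P, take z = y. Otherwise some z
      outside P kills y; then primality keeps \<open>colon I z\<close> inside P, and y itself makes
      it larger than I.\<close>
    proof (cases "colon I y \<subseteq> P")
      case True
      moreover have "w \<in> colon I y" using w by (simp add: colon_def)
      ultimately show ?thesis using colon_upper[OF II yi] w(2) y(2) yi by blast
    next
      case False
      then obtain z where z: "z \<in> ints" "z * y \<in> I" "z \<notin> P" by (auto simp: colon_def)
      have "colon I z \<subseteq> P"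
      proof
        fix v assume "v \<in> colon I z"
        hence "v \<in> ints" "v * z \<in> P" using IP by (auto simp: colon_def)
        thus "v \<in> P" using maxidl_prime[OF P _ z(1)] z(3) by blast
      qed
      moreover have "y \<in> colon I z" using yi z(2) by (simp add: colon_def mult.commute)
      ultimately show ?thesis using colon_upper[OF II z(1)] z y(2) IP by blast
    qed
    then obtain z where z: "z \<in> ints" "I \<subset> colon I z" "colon I z \<subseteq> P" by blast
    have "nzidl (colon I z)" using nzidl_mono[OF I colon_idl[OF II z(1)]] z(2) by blast
    then obtain b where b: "b \<in> ints" "b \<notin> colon I z" "\<forall>p\<in>P. b * p \<in> colon I z"
      using less.hyps[OF N_less[OF I colon_idl[OF II z(1)] z(2)]] P z(3) by blast
    have "b * z \<notin> I" using b by (simp add: colon_def)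
    moreover have "b * z * p \<in> I" if "p \<in> P" for p
      using b(3) that by (auto simp: colon_def mult_ac)
    ultimately show ?thesis using ints_mult[OF b(1) z(1)] by blast
  qed
qed

definition scale :: "'a \<Rightarrow> 'a set \<Rightarrow> 'a set" where "scale x I = (*) x ` I"

lemma scale_idl:
  assumes I: "idl I" and "\<And>a. a \<in> I \<Longrightarrow> x * a \<in> ints"
  shows "idl (scale x I)"
proof (rule idlI)
  show "scale x I \<subseteq> ints" using assms(2) by (auto simp: scale_def)
  show "0 \<in> scale x I" unfolding scale_def using idl_0[OF I] by (intro image_eqI[of _ _ 0]) auto
  show "a + b \<in> scale x I" if ab: "a \<in> scale x I" "b \<in> scale x I" for a b
  proof -
    obtain c d where "c \<in> I" "d \<in> I" "a = x * c" "b = x * d" using ab by (auto simp: scale_def)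
    thus ?thesis unfolding scale_def using idl_add[OF I]
      by (intro image_eqI[of _ _ "c + d"]) (auto simp: distrib_left)
  qed
  show "r * a \<in> scale x I" if ab: "a \<in> scale x I" "r \<in> ints" for a r
  proof -
    obtain c where "c \<in> I" "a = x * c" using ab by (auto simp: scale_def)
    thus ?thesis unfolding scale_def using idl_mult[OF I _ ab(2)]
      by (intro image_eqI[of _ _ "r * c"]) (auto simp: mult_ac)
  qed
qed

text \<open>The inverse of P as a fractional ideal, in terms of elements: P times the module
  generated by 1 and x is the unit ideal. The element x = b / a is not integral, so P + x P is
  strictly larger than P by \<open>multiplier_integral\<close> and hence everything.\<close>

lemma maxidl_inverse:
  assumes P: "maxidl P"
  obtains x p q where "x \<in> F" "\<And>a. a \<in> P \<Longrightarrow> x * a \<in> ints" "p \<in> P" "q \<in> P" "1 = p + x * q"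
proof -
  have PP: "idl P" and nP: "nzidl P" using P max_idl max_nzidl by blast+
  obtain a where a: "a \<in> P" "a \<noteq> 0" using nzidlE[OF nP] by blast
  have ai: "a \<in> ints" using idl_ints[OF PP a(1)] .
  obtain b where b: "b \<in> ints" "b \<notin> principal a" "\<forall>p\<in>P. b * p \<in> principal a"
    using maxidl_annihilator[OF principal_nzidl[OF ai a(2)] P principal_subset[OF PP a(1)]] by blast
  define x where "x = b / a"
  have xF: "x \<in> F" unfolding x_def using b(1) ai by (intro divide_mem ints_subset)
  have xi: "x \<notin> ints"
  proof
    assume "x \<in> ints"
    hence "a * x \<in> principal a" by (rule principalI)
    thus False using b(2) a(2) by (simp add: x_def)
  qed
  have xP: "x * p \<in> ints" if "p \<in> P" for p
  proof -
    have "b * p \<in> principal a" using b(3) that by blast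
    then obtain r where "r \<in> ints" "b * p = a * r" unfolding principal_def by blast
    thus ?thesis using a(2) by (simp add: x_def)
  qed
  have sI: "idl (scale x P)" by (rule scale_idl[OF PP xP])
  have "isum P (scale x P) \<noteq> P"
  proof
    assume "isum P (scale x P) = P"
    hence "scale x P \<subseteq> P" using isum_upper[OF PP sI] by blast
    hence "x \<in> ints" by (intro multiplier_integral[OF nP xF]) (auto simp: scale_def)
    thus False using xi by blast
  qed
  hence "isum P (scale x P) = ints"
    using maxidlD[OF P isum_idl[OF PP sI]] isum_upper[OF PP sI] by blast
  hence "1 \<in> isum P (scale x P)" using ints_1 by simp
  then obtain p q where "p \<in> P" "q \<in> P" "1 = p + x * q" by (auto simp: isum_def scale_def)
  thus ?thesis using that xF xP by blast
qed

text \<open>Each j equals p j + x (q j), and multiplication by x carries the product of P and J'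
  back into J'.\<close>

lemma maxidl_cancel_subset:
  assumes P: "maxidl P" and J: "idl J" "idl J'" and sub: "iprod P J \<subseteq> iprod P J'"
  shows "J \<subseteq> J'"
proof
  fix j assume j: "j \<in> J"
  obtain x p q where x: "x \<in> F" "\<And>a. a \<in> P \<Longrightarrow> x * a \<in> ints" "p \<in> P" "q \<in> P" "1 = p + x * q"
    using maxidl_inverse[OF P] by metis
  have xPJ: "x * z \<in> J'" if "z \<in> iprod P J'" for z
    using that
  proof induction
    case (prod a b)
    thus ?case using idl_mult[OF J(2) prod(2) x(2)[OF prod(1)]] by (simp add: mult.assoc)
  qed (simp add: distrib_left idl_add[OF J(2)])
  have "p * j \<in> J'"
    using sub iprod.prod[OF x(3) j] iprod_subset_right[OF max_idl[OF P] J(2)] by blast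
  moreover have "x * (q * j) \<in> J'" using sub iprod.prod[OF x(4) j] by (intro xPJ) blast
  moreover have "j = p * j + x * (q * j)"
  proof -
    have "j = (p + x * q) * j" using x(5) by simp
    thus ?thesis by (simp only: distrib_right mult.assoc)
  qed
  ultimately show "j \<in> J'" using idl_add[OF J(2)] by metis
qed

text \<open>J is the product of I with the inverse of P, that is I + x I. It is strictly larger than
  I, for otherwise x would be integral and 1 = p + x q would lie in P.\<close>

lemma maxidl_divides:
  assumes P: "maxidl P" and I: "nzidl I" "I \<subseteq> P"
  shows "\<exists>J. nzidl J \<and> I = iprod P J \<and> I \<subset> J"
proof -
  have II: "idl I" and PP: "idl P" using I P nz_idl max_idl by blast+
  obtain x p q where x: "x \<in> F" "\<And>a. a \<in> P \<Longrightarrow> x * a \<in> ints" "p \<in> P" "q \<in> P" "1 = p + x * q"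
    using maxidl_inverse[OF P] by metis
  have xi: "x * a \<in> ints" if "a \<in> I" for a using x(2) I(2) that by blast
  have sI: "idl (scale x I)" by (rule scale_idl[OF II xi])
  define J where "J = isum I (scale x I)"
  have J: "idl J" unfolding J_def by (rule isum_idl[OF II sI])
  have IJ: "I \<subseteq> J" and xIJ: "scale x I \<subseteq> J" unfolding J_def using isum_upper[OF II sI] by blast+
  have "I \<noteq> J"
  proof
    assume "I = J"
    hence "x \<in> ints" using xIJ by (intro multiplier_integral[OF I(1) x(1)]) (auto simp: scale_def)
    hence "p + x * q \<in> P" using x(3,4) by (intro idl_add[OF PP] idl_mult[OF PP])
    thus False using x(5) maxidl_one[OF P] by simp
  qed
  moreover have "iprod P J \<subseteq> I"
  proof (rule iprod_subsetI)
    fix a j assume a: "a \<in> P" and "j \<in> J"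
    then obtain c d where cd: "c \<in> I" "d \<in> I" "j = c + x * d" by (auto simp: J_def isum_def scale_def)
    have "a * j = a * c + (x * a) * d" unfolding cd(3) by (simp add: algebra_simps)
    thus "a * j \<in> I" using idl_add[OF II idl_mult[OF II cd(1) idl_ints[OF PP a]] idl_mult[OF II cd(2) x(2)[OF a]]] by simp
  qed (rule idl_add[OF II])
  moreover have "I \<subseteq> iprod P J"
  proof
    fix i assume i: "i \<in> I"
    have "p * i \<in> iprod P J" using IJ i by (intro iprod.prod x(3)) auto
    moreover have "q * (x * i) \<in> iprod P J" using xIJ i by (intro iprod.prod x(4)) (auto simp: scale_def)
    moreover have "i = p * i + q * (x * i)"
    proof -
      have "i = (p + x * q) * i" using x(5) by simp
      thus ?thesis by (simp only: distrib_right mult.assoc mult.left_commute)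
    qed
    ultimately show "i \<in> iprod P J" using iprod.sum by metis
  qed
  ultimately show ?thesis using nzidl_mono[OF I(1) J IJ] IJ by (intro exI[of _ J]) auto
qed

lemma nzidl_cases:
  assumes "nzidl I" "I \<noteq> ints"
  obtains P J where "maxidl P" "nzidl J" "I = iprod P J" "I \<subset> J" "N J < N I"
proof -
  obtain P where P: "maxidl P" "I \<subseteq> P" using maxidl_exists[OF assms] by blast
  obtain J where "nzidl J" "I = iprod P J" "I \<subset> J"
    using maxidl_divides[OF P(1) assms(1) P(2)] by blast
  thus ?thesis using that[OF \<open>maxidl P\<close>] N_less[OF assms(1)] nz_idl by blast
qed

lemma nzidl_induct [consumes 1, case_names ints prod]:
  assumes "nzidl I" "Q ints"
    "\<And>P J. maxidl P \<Longrightarrow> nzidl J \<Longrightarrow> iprod P J \<subset> J \<Longrightarrow> Q J \<Longrightarrow> Q (iprod P J)"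
  shows "Q I"
  using assms(1)
proof (induction "N I" arbitrary: I rule: less_induct)
  case less
  show ?case
  proof (cases "I = ints")
    case False
    then obtain P J where *: "maxidl P" "nzidl J" "I = iprod P J" "I \<subset> J" "N J < N I"
      using nzidl_cases[OF less.prems] by metis
    have "Q J" by (rule less.hyps[OF *(5,2)])
    thus ?thesis using assms(3)[OF *(1,2)] *(3,4) by simp
  qed (use assms(2) in simp)
qed

lemma iprod_cancel_subset:
  assumes "nzidl J" "idl A" "idl A'" "iprod J A \<subseteq> iprod J A'"
  shows "A \<subseteq> A'"
  using assms(1,4)
proof (induction J rule: nzidl_induct)
  case ints
  thus ?case using iprod_ints assms by simp
next
  case (prod P J)
  have "iprod J A \<subseteq> iprod J A'"
  proof (rule maxidl_cancel_subset[OF prod(1)])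
    show "iprod P (iprod J A) \<subseteq> iprod P (iprod J A')" using prod.prems unfolding iprod_assoc .
  qed (intro iprod_idl nz_idl prod(2) assms)+
  thus ?case by (rule prod.IH)
qed

lemma iprod_cancel:
  "nzidl J \<Longrightarrow> idl A \<Longrightarrow> idl A' \<Longrightarrow> iprod J A = iprod J A' \<Longrightarrow> A = A'"
  using iprod_cancel_subset[of J A A'] iprod_cancel_subset[of J A' A] by blast

lemma contains_imp_divides:
  assumes "nzidl J" "nzidl M" "M \<subseteq> J"
  shows "\<exists>A. nzidl A \<and> M = iprod J A"
  using assms
proof (induction J arbitrary: M rule: nzidl_induct)
  case ints
  thus ?case using iprod_ints nz_idl by blast
next
  case (prod P J)
  have "M \<subseteq> P" using prod(1,2,6) iprod_subset_left max_idl nz_idl by blast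
  then obtain M1 where M1: "nzidl M1" "M = iprod P M1" using maxidl_divides[OF prod(1,5)] by blast
  have "M1 \<subseteq> J" using maxidl_cancel_subset[OF prod(1)] M1 prod(2,6) nz_idl by blast
  then obtain A where "nzidl A" "M1 = iprod J A" using prod.IH M1(1) by blast
  thus ?case using M1(2) iprod_assoc by blast
qed

text \<open>An intermediate ideal is a multiple J A of J, and cancelling J leaves an ideal A that
  contains P.\<close>

lemma between_prime_multiple:
  assumes P: "maxidl P" and J: "nzidl J" and M: "idl M" "iprod P J \<subseteq> M" "M \<subseteq> J"
  shows "M = iprod P J \<or> M = J"
proof -
  have PJ: "nzidl (iprod J P)" by (rule iprod_nzidl[OF J max_nzidl[OF P]])
  have "nzidl M" using nzidl_mono[OF PJ M(1)] M(2) iprod_comm by metis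
  then obtain A where A: "nzidl A" "M = iprod J A" using contains_imp_divides[OF J] M(3) by blast
  have "iprod J P \<subseteq> iprod J A" using M(2) A(2) iprod_comm by metis
  hence "P \<subseteq> A" using iprod_cancel_subset[OF J max_idl[OF P] nz_idl[OF A(1)]] by blast
  hence "A = P \<or> A = ints" using P nz_idl[OF A(1)] unfolding maxidl_def by blast
  thus ?thesis using A(2) iprod_comm iprod_ints[OF nz_idl[OF J]] by metis
qed

section \<open>Multiplicativity of the norm\<close>

lemma N_reps:
  assumes "R \<subseteq> ints" "idl I"
    "\<And>r r'. r \<in> R \<Longrightarrow> r' \<in> R \<Longrightarrow> r - r' \<in> I \<Longrightarrow> r = r'"
    "\<And>z. z \<in> ints \<Longrightarrow> \<exists>r\<in>R. z - r \<in> I"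
  shows "N I = card R"
proof -
  have "residue I ` R = residue I ` ints"
    using assms(1,4) residue_eq_iff[OF assms(2)] by (auto simp: image_iff)
  moreover have "inj_on (residue I) R"
    using assms(3) residue_eq_iff[OF assms(2)] by (auto intro: inj_onI)
  ultimately show ?thesis unfolding N_def by (metis card_image)
qed

lemma reps_exist:
  assumes "idl I"
  obtains R where "R \<subseteq> ints" "\<And>r r'. r \<in> R \<Longrightarrow> r' \<in> R \<Longrightarrow> r - r' \<in> I \<Longrightarrow> r = r'"
    "\<And>z. z \<in> ints \<Longrightarrow> \<exists>r\<in>R. z - r \<in> I" "N I = card R"
proof -
  obtain R where R: "R \<subseteq> ints" "inj_on (residue I) R" "residue I ` R = residue I ` ints"
    using residue_reps by blast
  show ?thesis
  proof (rule that[OF R(1)])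
    show "r = r'" if "r \<in> R" "r' \<in> R" "r - r' \<in> I" for r r'
      using R(2) that residue_eq_iff[OF assms] by (meson inj_onD)
    show "\<exists>r\<in>R. z - r \<in> I" if "z \<in> ints" for z
    proof -
      have "residue I z \<in> residue I ` R" using R(3) that by blast
      thus ?thesis using residue_eq_iff[OF assms] by blast
    qed
    show "N I = card R" unfolding N_def R(3)[symmetric] by (rule card_image[OF R(2)])
  qed
qed

text \<open>For y in J outside P J, multiplication by y induces an isomorphism from the residue
  field of P to J / P J. Representatives modulo P J are therefore t + r y, with t running modulo J
  and r modulo P.\<close>

lemma N_prime_mult:
  assumes P: "maxidl P" and J: "nzidl J" and lt: "iprod P J \<subset> J"
  shows "N (iprod P J) = N P * N J"
proof -
  have PP: "idl P" and JJ: "idl J" using P J max_idl nz_idl by blast+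
  have PJ: "idl (iprod P J)" by (rule iprod_idl[OF PP JJ])
  obtain y where y: "y \<in> J" "y \<notin> iprod P J" using lt by blast
  have yi: "y \<in> ints" using idl_ints[OF JJ y(1)] .
  have Py: "p * y \<in> iprod P J" if "p \<in> P" for p using that y(1) by (rule iprod.prod)
  have colP: "r \<in> P" if "r \<in> ints" "r * y \<in> iprod P J" for r
  proof -
    have "P \<subseteq> colon (iprod P J) y" using Py idl_ints[OF PP] by (auto simp: colon_def)
    moreover have "1 \<notin> colon (iprod P J) y" using y(2) by (simp add: colon_def)
    ultimately have "colon (iprod P J) y = P"
      using maxidlD[OF P colon_idl[OF PJ yi]] ints_1 by blast
    thus ?thesis using that by (auto simp: colon_def)
  qed
  have "isum (principal y) (iprod P J) = J"
  proof -
    have I: "idl (principal y)" by (rule principal_idl[OF yi])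
    have "isum (principal y) (iprod P J) \<subseteq> J"
      using principal_subset[OF JJ y(1)] lt idl_add[OF JJ] by (auto simp: isum_def)
    moreover have "y \<in> isum (principal y) (iprod P J)" "iprod P J \<subseteq> isum (principal y) (iprod P J)"
      using isum_upper[OF I PJ] principal_self by blast+
    ultimately show ?thesis using between_prime_multiple[OF P J isum_idl[OF I PJ]] y(2) by blast
  qed
  hence dec: "\<exists>r\<in>ints. j - r * y \<in> iprod P J" if "j \<in> J" for j
  proof -
    assume "isum (principal y) (iprod P J) = J"
    hence "j \<in> isum (principal y) (iprod P J)" using that by simp
    then obtain r e where "r \<in> ints" "e \<in> iprod P J" "j = y * r + e"
      by (auto simp: isum_def principal_def)
    thus ?thesis by (intro bexI[of _ r]) (auto simp: mult.commute)
  qed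
  obtain R where R: "R \<subseteq> ints" "\<And>r r'. r \<in> R \<Longrightarrow> r' \<in> R \<Longrightarrow> r - r' \<in> P \<Longrightarrow> r = r'"
    "\<And>z. z \<in> ints \<Longrightarrow> \<exists>r\<in>R. z - r \<in> P" "N P = card R"
    using reps_exist[OF PP] by metis
  obtain T where T: "T \<subseteq> ints" "\<And>r r'. r \<in> T \<Longrightarrow> r' \<in> T \<Longrightarrow> r - r' \<in> J \<Longrightarrow> r = r'"
    "\<And>z. z \<in> ints \<Longrightarrow> \<exists>r\<in>T. z - r \<in> J" "N J = card T"
    using reps_exist[OF JJ] by metis
  define f where "f = (\<lambda>(r, t). t + r * y)"
  have key: "r = r' \<and> t = t'"
    if "r \<in> R" "r' \<in> R" "t \<in> T" "t' \<in> T" "(t + r * y) - (t' + r' * y) \<in> iprod P J" for r r' t t'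
  proof -
    have ri: "r - r' \<in> ints" using that R(1) by (intro ints_diff) auto
    have "(t + r * y) - (t' + r' * y) - (r - r') * y \<in> J"
      by (intro idl_diff[OF JJ] idl_mult[OF JJ y(1) ri] subsetD[OF psubset_imp_subset[OF lt] that(5)])
    hence "t - t' \<in> J" by (simp add: algebra_simps)
    hence "t = t'" using T(2) that by blast
    hence "(r - r') * y \<in> iprod P J" using that(5) by (simp add: algebra_simps)
    hence "r - r' \<in> P" using colP[OF ri] by blast
    thus ?thesis using R(2) that \<open>t = t'\<close> by blast
  qed
  have "N (iprod P J) = card (f ` (R \<times> T))"
  proof (rule N_reps[OF _ PJ])
    show "f ` (R \<times> T) \<subseteq> ints" using R(1) T(1) yi by (auto simp: f_def intro!: ints_add ints_mult)
    show "u = v" if "u \<in> f ` (R \<times> T)" "v \<in> f ` (R \<times> T)" "u - v \<in> iprod P J" for u v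
    proof -
      from that(1,2) obtain r t r' t' where *: "r \<in> R" "t \<in> T" "r' \<in> R" "t' \<in> T"
        "u = t + r * y" "v = t' + r' * y" unfolding f_def by auto
      show ?thesis using key[OF *(1,3,2,4)] that(3) unfolding *(5,6) by blast
    qed
    show "\<exists>u\<in>f ` (R \<times> T). z - u \<in> iprod P J" if z: "z \<in> ints" for z
    proof -
      obtain t where t: "t \<in> T" "z - t \<in> J" using T(3)[OF z] by blast
      obtain r0 where r0: "r0 \<in> ints" "(z - t) - r0 * y \<in> iprod P J" using dec[OF t(2)] by blast
      obtain r where r: "r \<in> R" "r0 - r \<in> P" using R(3)[OF r0(1)] by blast
      have "((z - t) - r0 * y) + (r0 - r) * y \<in> iprod P J" by (rule idl_add[OF PJ r0(2) Py[OF r(2)]])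
      moreover have "((z - t) - r0 * y) + (r0 - r) * y = z - (t + r * y)" by (simp add: algebra_simps)
      moreover have "t + r * y \<in> f ` (R \<times> T)" using r t by (auto simp: f_def)
      ultimately show ?thesis by metis
    qed
  qed
  also have "inj_on f (R \<times> T)"
  proof (rule inj_onI)
    fix u v assume uv: "u \<in> R \<times> T" "v \<in> R \<times> T" "f u = f v"
    obtain r t r' t' where *: "u = (r, t)" "v = (r', t')" by (cases u, cases v) blast
    have "(t + r * y) - (t' + r' * y) = 0" using uv(3) by (simp add: * f_def)
    thus "u = v" using key[of r r' t t'] uv(1,2) idl_0[OF PJ] unfolding * by simp
  qed
  hence "card (f ` (R \<times> T)) = N P * N J"
    by (simp add: card_image card_cartesian_product R(4) T(4))
  finally show ?thesis .
qed

lemma prime_mult_strict: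
  assumes "maxidl P" "nzidl J"
  shows "iprod P J \<subset> J"
proof -
  have "iprod P J \<subseteq> J" using assms iprod_subset_right max_idl nz_idl by blast
  moreover have "iprod P J \<noteq> J"
  proof
    assume "iprod P J = J"
    hence "iprod J P = iprod J ints" using iprod_comm iprod_ints nz_idl[OF assms(2)] by metis
    thus False using iprod_cancel[OF assms(2) max_idl[OF assms(1)] ints_idl] assms(1)
      unfolding maxidl_def by blast
  qed
  ultimately show ?thesis by blast
qed

lemma N_mult:
  assumes "nzidl I" "nzidl J"
  shows "N (iprod I J) = N I * N J"
  using assms(1)
proof (induction I rule: nzidl_induct)
  case ints
  thus ?case using iprod_ints nz_idl assms(2) N_ints by simp
next
  case (prod P I)
  have "N (iprod (iprod P I) J) = N P * N (iprod I J)"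
    unfolding iprod_assoc using iprod_nzidl[OF prod(2) assms(2)]
    by (intro N_prime_mult prime_mult_strict prod(1))
  thus ?case using prod.IH N_prime_mult[OF prod(1-3)] by simp
qed

lemma N_gt_1: "nzidl I \<Longrightarrow> I \<noteq> ints \<Longrightarrow> N I > 1"
  using N_less[of I ints] N_ints idl_ints[of I] nz_idl ints_idl by fastforce

lemma maxidl_N_ge_2: "maxidl P \<Longrightarrow> N P \<ge> 2"
  using N_gt_1[of P] max_nzidl unfolding maxidl_def by fastforce

section \<open>Finiteness of the set of ideals of bounded norm\<close>

lemma finite_ideals_containing:
  assumes "m \<in> ints" "m \<noteq> 0"
  shows "finite {J. idl J \<and> m \<in> J}"
proof -
  let ?A = "residue (principal m) ` ints"
  define g where "g J = residue (principal m) ` J" for J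
  have I: "idl (principal m)" by (rule principal_idl[OF assms(1)])
  have sub: "J \<subseteq> J'" if "idl J" "idl J'" "m \<in> J'" "g J = g J'" for J J'
  proof
    fix z assume z: "z \<in> J"
    hence "residue (principal m) z \<in> g J'" using that(4) by (auto simp: g_def)
    then obtain w where w: "w \<in> J'" "z - w \<in> principal m"
      using residue_eq_iff[OF I] by (auto simp: g_def)
    hence "(z - w) + w \<in> J'" using principal_subset[OF that(2,3)] by (intro idl_add[OF that(2)]) auto
    thus "z \<in> J'" by simp
  qed
  \<comment> \<open>An ideal containing m is a union of cosets of (m), so it is recovered from the
    subset of the finite quotient that it occupies.\<close>
  have "inj_on g {J. idl J \<and> m \<in> J}"
    by (intro inj_onI equalityI sub) auto
  moreover have "g ` {J. idl J \<and> m \<in> J} \<subseteq> Pow ?A" using idl_ints by (auto simp: g_def)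
  moreover have "finite (Pow ?A)" using finite_quotient_principal[OF assms] by simp
  ultimately show ?thesis by (meson finite_imageD finite_subset)
qed

text \<open>Two of the numbers 0, ..., N J agree modulo J, and their difference divides the
  factorial. A single rational integer thus lies in all ideals of norm at most n.\<close>

lemma fact_norm_mem:
  assumes "nzidl J"
  shows "of_nat (fact (N J)) \<in> J"
proof -
  have JJ: "idl J" using nz_idl assms by blast
  have "\<exists>i\<le>N J. \<exists>j\<le>N J. i \<noteq> j \<and> residue J (of_nat i) = residue J (of_nat j)"
  proof (rule ccontr)
    assume "\<not> ?thesis"
    hence inj: "inj_on (\<lambda>i. residue J (of_nat i)) {..N J}" by (auto intro!: inj_onI)
    have "card ((\<lambda>i. residue J (of_nat i)) ` {..N J}) \<le> card (residue J ` ints)"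
      by (rule card_mono[OF finite_quotient[OF assms]]) (auto intro: ints_of_nat)
    hence "card ((\<lambda>i. residue J (of_nat i)) ` {..N J}) \<le> N J" by (simp only: N_def)
    thus False using card_image[OF inj] by simp
  qed
  then obtain i j where ij: "i < j" "j \<le> N J" "residue J (of_nat j) = residue J (of_nat i)"
    by (metis linorder_neqE_nat)
  hence "of_nat (j - i) \<in> J" using residue_eq_iff[OF JJ] by (simp add: of_nat_diff)
  moreover have "(j - i) dvd fact (N J)" using ij by (intro dvd_fact) auto
  then obtain c where c: "fact (N J) = (j - i) * c" by (elim dvdE)
  ultimately have "of_nat ((j - i) * c) \<in> J"
    using idl_mult_right[OF JJ _ ints_of_nat] by simp
  thus ?thesis unfolding c .
qed

lemma finite_bounded_norm: "finite {J. nzidl J \<and> N J \<le> n}"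
proof -
  have "{J. nzidl J \<and> N J \<le> n} \<subseteq> {J. idl J \<and> of_nat (fact n) \<in> J}"
  proof clarify
    fix J assume J: "nzidl J" "N J \<le> n"
    have JJ: "idl J" using nz_idl J by blast
    obtain c where c: "(fact n :: nat) = fact (N J) * c" using fact_dvd[OF J(2)] by (elim dvdE)
    have "of_nat (fact (N J) * c) \<in> J"
      unfolding of_nat_mult by (rule idl_mult_right[OF JJ fact_norm_mem[OF J(1)] ints_of_nat])
    thus "idl J \<and> of_nat (fact n) \<in> J" unfolding c using JJ by blast
  qed
  moreover have "(of_nat (fact n) :: 'a) \<noteq> 0" by simp
  ultimately show ?thesis using finite_ideals_containing[OF ints_of_nat] finite_subset by blast
qed

text \<open>Modulo P the element (2 c) c is congruent to 2 D. So X^2 - D has two distinct roots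
  modulo P, which is used for splitting as well as for lifting roots.\<close>

lemma double_root_notin:
  assumes P: "maxidl P" "2 * D \<notin> P" and c: "c \<in> ints" "c ^ 2 - D \<in> P"
  shows "2 * c \<notin> P"
proof
  have PP: "idl P" by (rule max_idl[OF P(1)])
  have two: "2 \<in> ints" using ints_of_nat[of 2] by simp
  assume "2 * c \<in> P"
  hence "(2 * c) * c - 2 * (c ^ 2 - D) \<in> P"
    by (rule idl_diff[OF PP idl_mult_right[OF PP _ c(1)] idl_mult[OF PP c(2) two]])
  moreover have "(2 * c) * c - 2 * (c ^ 2 - D) = 2 * D" by (simp add: algebra_simps power2_eq_square)
  ultimately show False using P(2) by metis
qed

end

section \<open>Counting ideals\<close>

lemma nat_root_floor:
  assumes "n \<ge> 1" "r \<ge> (1::nat)"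
  obtains k :: nat where "k \<ge> 1" "k ^ r \<le> n" "n < (k + 1) ^ r"
proof -
  define m where "m = (LEAST m. n < m ^ r)"
  have "n < (n + 1) ^ r"
    using self_le_power[of "n + 1" r] assms by linarith
  hence m: "n < m ^ r" unfolding m_def by (rule LeastI)
  have "m \<noteq> 0" using m assms by (intro notI) (simp add: power_0_left)
  moreover have "m \<noteq> 1" using m assms by (intro notI) simp
  ultimately obtain k where k: "m = k + 1" "k \<ge> 1" by (metis Suc_eq_plus1 One_nat_def not0_implies_Suc not_less_eq_eq le_zero_eq)
  have "\<not> n < k ^ r" using not_less_Least[of k "\<lambda>m. n < m ^ r"] unfolding m_def[symmetric] k by simp
  thus ?thesis using that[of k] k m by simp
qed

context integral_basis
begin

lemma ideal_contains_small:
  assumes I: "nzidl I"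
  obtains \<alpha> k where "\<alpha> \<in> I" "\<alpha> \<noteq> 0" "\<alpha> \<in> box (of_nat k)" "k \<ge> 1" "k ^ rk \<le> N I"
proof -
  have II: "idl I" using nz_idl I by blast
  have "N I \<ge> 1" "rk \<ge> 1" using N_pos[OF I] card_B_pos by simp_all
  \<comment> \<open>With k the integer part of the rk-th root of N I, there are more combinations
    with coefficients in 0, ..., k than residues modulo I.\<close>
  then obtain k where k: "k \<ge> 1" "k ^ rk \<le> N I" "N I < (k + 1) ^ rk"
    using nat_root_floor by metis
  define D where "D = (B \<rightarrow>\<^sub>E {..k})"
  have fD: "card D = (k + 1) ^ rk"
    unfolding D_def card_PiE_const[OF finite_B] by simp
  have "\<not> inj_on (\<lambda>a. residue I (comb a)) D"
  proof
    assume inj: "inj_on (\<lambda>a. residue I (comb a)) D"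
    have "card ((\<lambda>a. residue I (comb a)) ` D) \<le> card (residue I ` ints)"
      by (rule card_mono[OF finite_quotient[OF I]]) (auto intro: comb_ints)
    hence "card ((\<lambda>a. residue I (comb a)) ` D) \<le> N I" by (simp only: N_def)
    thus False using card_image[OF inj] fD k(3) by simp
  qed
  then obtain a a' where a: "a \<in> D" "a' \<in> D" "a \<noteq> a'" "residue I (comb a) = residue I (comb a')"
    unfolding inj_on_def by blast
  show ?thesis
  proof (rule that[OF _ _ _ k(1,2)])
    show "comb a - comb a' \<in> I" using a(4) residue_eq_iff[OF II] by blast
    show "comb a - comb a' \<noteq> 0" using comb_inj[of a _ a'] a(1-3) unfolding D_def by auto
    show "comb a - comb a' \<in> box (of_nat k)"
    proof (rule boxI)
      show "comb a - comb a' \<in> F" by (intro diff_mem ints_subset comb_ints)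
      fix b assume b: "b \<in> B"
      have "cd (comb a - comb a') b = of_nat (a b) - of_nat (a' b)"
        using b by (simp add: cd_diff cd_comb ints_subset[OF comb_ints])
      moreover have "a b \<le> k" "a' b \<le> k" using a(1,2) b by (auto simp: D_def)
      hence "(of_nat (a b) :: rat) \<le> of_nat k" "(of_nat (a' b) :: rat) \<le> of_nat k"
        by (simp_all only: of_nat_le_iff)
      moreover have "(of_nat (a b) :: rat) \<ge> 0" "(of_nat (a' b) :: rat) \<ge> 0" by simp_all
      ultimately show "\<bar>cd (comb a - comb a') b\<bar> \<le> of_nat k" by linarith
    qed
  qed
qed

text \<open>
  If \<open>\<alpha>\<close> is a small element of \<open>I\<close> and \<open>(\<alpha>) = I J\<close>, then the norm of \<open>J\<close> is bounded,
  and \<open>I\<close> is determined by \<open>\<alpha>\<close> and \<open>J\<close>.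
\<close>
lemma ideal_count_upper:
  "\<exists>C::nat. \<forall>x\<ge>1. card {I. nzidl I \<and> N I \<le> x} \<le> C * x"
proof -
  define E where "E = 2 * grid * grid + 1"
  define \<J> where "\<J> = {J. nzidl J \<and> N J \<le> E ^ rk}"
  have fJ: "finite \<J>" unfolding \<J>_def by (rule finite_bounded_norm)
  have "card {I. nzidl I \<and> N I \<le> x} \<le> ((3 * grid) ^ rk * card \<J>) * x" if x: "x \<ge> 1" for x
  proof -
    have "rk \<ge> 1" using card_B_pos by simp
    then obtain K where K: "K \<ge> 1" "K ^ rk \<le> x" "x < (K + 1) ^ rk"
      using nat_root_floor[OF x] by metis
    define A where "A = {\<alpha> \<in> ints. \<alpha> \<in> box (of_nat K)}"
    have fA: "finite A" by (rule finite_ints_box[of A K]) (auto simp: A_def)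
    have "\<exists>p. p \<in> A \<times> \<J> \<and> fst p \<noteq> 0 \<and> principal (fst p) = iprod I (snd p)"
      if I: "nzidl I" "N I \<le> x" for I
    proof -
      obtain \<alpha> k where \<alpha>: "\<alpha> \<in> I" "\<alpha> \<noteq> 0" "\<alpha> \<in> box (of_nat k)" "k \<ge> 1" "k ^ rk \<le> N I"
        using ideal_contains_small[OF I(1)] by metis
      have II: "idl I" and \<alpha>i: "\<alpha> \<in> ints" using nz_idl[OF I(1)] \<alpha>(1) idl_ints by blast+
      have "k ^ rk < (K + 1) ^ rk" using \<alpha>(5) I(2) K(3) by simp
      hence "k \<le> K" using power_less_imp_less_base by fastforce
      hence "\<alpha> \<in> A" unfolding A_def using \<alpha>i box_mono[of "of_nat k" "of_nat K"] \<alpha>(3) by simp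
      obtain J where J: "nzidl J" "principal \<alpha> = iprod I J"
        using contains_imp_divides[OF I(1) principal_nzidl[OF \<alpha>i \<alpha>(2)] principal_subset[OF II \<alpha>(1)]]
        by blast
      have "N I * N J = N (principal \<alpha>)" using N_mult[OF I(1) J(1)] J(2) by simp
      also have "\<dots> \<le> (E * k) ^ rk" unfolding E_def by (rule N_principal_le[OF \<alpha>i \<alpha>(2,3,4)])
      also have "\<dots> \<le> N I * E ^ rk" using \<alpha>(5) by (simp add: power_mult_distrib)
      finally have "N J \<le> E ^ rk" using N_pos[OF I(1)] by simp
      hence "J \<in> \<J>" using J(1) by (simp add: \<J>_def)
      thus ?thesis using \<open>\<alpha> \<in> A\<close> \<alpha>(2) J(2) by (intro exI[of _ "(\<alpha>, J)"]) simp
    qed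
    then obtain g where g: "\<And>I. nzidl I \<Longrightarrow> N I \<le> x \<Longrightarrow>
        g I \<in> A \<times> \<J> \<and> fst (g I) \<noteq> 0 \<and> principal (fst (g I)) = iprod I (snd (g I))"
      by metis
    let ?S = "{I. nzidl I \<and> N I \<le> x}"
    have "inj_on g ?S"
    proof (rule inj_onI, clarify)
      fix I I' assume I: "nzidl I" "N I \<le> x" "nzidl I'" "N I' \<le> x" "g I = g I'"
      define J where "J = snd (g I)"
      have "nzidl J" using g[OF I(1,2)] by (auto simp: J_def \<J>_def)
      moreover have "iprod J I = iprod J I'"
        using g[OF I(1,2)] g[OF I(3,4)] I(5) iprod_comm unfolding J_def by metis
      ultimately show "I = I'" using iprod_cancel nz_idl I by blast
    qed
    moreover have "g ` ?S \<subseteq> A \<times> \<J>" using g by blast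
    moreover have "finite (A \<times> \<J>)" using fA fJ by simp
    ultimately have "card ?S \<le> card (A \<times> \<J>)" by (rule card_inj_on_le)
    also have "\<dots> = card A * card \<J>" by (rule card_cartesian_product)
    also have "card A \<le> (2 * K * grid + 1) ^ rk" by (rule card_ints_box_le) (auto simp: A_def)
    also have "(2 * K * grid + 1) ^ rk \<le> (3 * grid * K) ^ rk"
    proof (rule power_mono)
      have "1 \<le> grid * K" using K(1) by (simp add: grid_def)
      thus "2 * K * grid + 1 \<le> 3 * grid * K" by (simp add: algebra_simps)
    qed simp
    also have "(3 * grid * K) ^ rk = (3 * grid) ^ rk * K ^ rk" by (rule power_mult_distrib)
    also have "\<dots> \<le> (3 * grid) ^ rk * x" using K(2) by simp
    finally show ?thesis by (simp add: mult_ac)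
  qed
  thus ?thesis by blast
qed

text \<open>Of the (m + 1)^rk central elements, each generating an ideal of the allowed norm, only a
  bounded number generate the same ideal.\<close>

lemma ideal_count_lower:
  assumes m: "m \<ge> 1"
  shows "m ^ rk \<le> (2 * central_bound * grid + 1) ^ rk *
    card {I. nzidl I \<and> N I \<le> ((2 * grid * grid + 1) * central_bound) ^ rk * m ^ rk}"
proof -
  let ?W = "(2 * central_bound * grid + 1) ^ rk"
  let ?S = "{I. nzidl I \<and> N I \<le> ((2 * grid * grid + 1) * central_bound) ^ rk * m ^ rk}"
  define D where "D = (B \<rightarrow>\<^sub>E {..m})"
  have fD: "finite D" unfolding D_def using finite_B by (intro finite_PiE) auto
  have Dle: "a b \<le> m" if "a \<in> D" "b \<in> B" for a b using that by (auto simp: D_def)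
  define g where "g a = principal (central m a)" for a
  have gS: "g a \<in> ?S" if a: "a \<in> D" for a
  proof -
    have nz: "central m a \<noteq> 0" using Dle[OF a] m by (rule central_nonzero)
    have "central m a \<in> box (of_nat (m * central_bound))" using Dle[OF a] by (rule central_box)
    moreover have "m * central_bound \<ge> 1" using m by (simp add: central_bound_def)
    ultimately have "N (principal (central m a)) \<le> ((2 * grid * grid + 1) * (m * central_bound)) ^ rk"
      by (rule N_principal_le[OF central_ints nz])
    also have "\<dots> = (((2 * grid * grid + 1) * central_bound) * m) ^ rk"
      by (simp only: mult_ac)
    also have "\<dots> = ((2 * grid * grid + 1) * central_bound) ^ rk * m ^ rk"
      by (rule power_mult_distrib)
    finally show ?thesis using principal_nzidl[OF central_ints nz] by (simp add: g_def)
  qed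
  have fibre: "card {a \<in> D. g a = I} \<le> ?W" if I: "I \<in> g ` D" for I
  proof -
    obtain a0 where a0: "a0 \<in> D" "I = g a0" using I by blast
    show ?thesis
    proof (rule card_central_multiples[OF _ m])
      show "{a \<in> D. g a = I} \<subseteq> B \<rightarrow>\<^sub>E {..m}" by (auto simp: D_def)
      show "a0 \<in> {a \<in> D. g a = I}" using a0 by simp
      fix a assume "a \<in> {a \<in> D. g a = I}"
      hence "central m a \<in> principal (central m a0)" using principal_self a0(2) by (auto simp: g_def)
      thus "\<exists>u\<in>ints. central m a = central m a0 * u" by (auto simp: principal_def)
    qed
  qed
  have "m ^ rk \<le> (m + 1) ^ rk" by (intro power_mono) auto
  also have "\<dots> = card D" unfolding D_def card_PiE_const[OF finite_B] by simp
  also have "\<dots> = (\<Sum>I\<in>g ` D. card {a \<in> D. g a = I})"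
    using sum.image_gen[OF fD, of "\<lambda>_. 1::nat" g] by simp
  also have "\<dots> \<le> (\<Sum>I\<in>g ` D. ?W)" by (rule sum_mono) (rule fibre)
  also have "\<dots> = ?W * card (g ` D)" by simp
  also have "\<dots> \<le> ?W * card ?S"
    using gS by (intro mult_left_mono card_mono finite_bounded_norm) auto
  finally show ?thesis .
qed

end

context number_subfield
begin

text \<open>Hides the choice of basis. The lower estimate is stated only at multiples of r-th
  powers, which suffices because it is used along a geometric progression.\<close>

lemma ideal_counts:
  "\<exists>r W \<kappa> C :: nat. r \<ge> 1 \<and> W \<ge> 1 \<and> \<kappa> \<ge> 1 \<and>
    (\<forall>x\<ge>1. card {I. nzidl I \<and> N I \<le> x} \<le> C * x) \<and>
    (\<forall>m\<ge>1. m ^ r \<le> W * card {I. nzidl I \<and> N I \<le> \<kappa> * m ^ r})"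
proof -
  obtain B where "integral_basis F B" using integral_basis_exists by blast
  then interpret integral_basis F B .
  obtain C where C: "\<forall>x\<ge>1. card {I. nzidl I \<and> N I \<le> x} \<le> C * x"
    using ideal_count_upper by blast
  show ?thesis
  proof (intro exI conjI)
    show "card B \<ge> 1" using card_B_pos by simp
    show "(2 * central_bound * grid + 1) ^ card B \<ge> 1" by (rule one_le_power) simp
    show "((2 * grid * grid + 1) * central_bound) ^ card B \<ge> 1"
      by (rule one_le_power) (simp add: central_bound_def)
  qed (use C ideal_count_lower in blast)+
qed

section \<open>Bounds for the zeta sum near 1\<close>

definition wt :: "real \<Rightarrow> 'a set \<Rightarrow> real" where "wt s I = real (N I) powr (- s)"

lemma wt_nonneg: "wt s I \<ge> 0" by (simp add: wt_def)

text \<open>A dyadic decomposition by norm: level j has at most C * 2^(j + 1) ideals of weight at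
  most 2^(- s j), which gives a geometric series of ratio 2^(1 - s).\<close>

lemma zeta_upper:
  "\<exists>C>0. \<forall>s. 1 < s \<longrightarrow> s \<le> 2 \<longrightarrow> (\<forall>A. finite A \<longrightarrow> (\<forall>I\<in>A. nzidl I) \<longrightarrow> (\<Sum>I\<in>A. wt s I) \<le> C / (s - 1))"
proof -
  from ideal_counts obtain r W \<kappa> C :: nat
    where "\<forall>x\<ge>1. card {I. nzidl I \<and> N I \<le> x} \<le> C * x"
    by (elim exE conjE)
  hence C: "card {I. nzidl I \<and> N I \<le> x} \<le> C * x" if "x \<ge> 1" for x using that by blast
  \<comment> \<open>The constant is 2 C from the levels times 4 from the geometric series; the
    summand 1 keeps it positive even if C = 0.\<close>
  have "(\<Sum>I\<in>A. wt s I) \<le> (8 * real C + 1) / (s - 1)"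
    if s: "1 < s" "s \<le> 2" and A: "finite A" "\<forall>I\<in>A. nzidl I" for s A
  proof -
    define x where "x = 2 powr (1 - s)"
    have x: "0 < x" "x < 1" unfolding x_def using s by (auto intro: powr_less_one)
    define lev where "lev I = (LEAST j. N I < 2 ^ Suc j)" for I
    have lev: "2 ^ lev I \<le> N I" "N I < 2 ^ Suc (lev I)" if "nzidl I" for I
    proof -
      have "N I < 2 ^ Suc (N I)" by (rule order.strict_trans2[OF less_exp]) simp
      thus *: "N I < 2 ^ Suc (lev I)" unfolding lev_def by (rule LeastI)
      show "2 ^ lev I \<le> N I"
      proof (cases "lev I")
        case (Suc j)
        thus ?thesis using not_less_Least[of j "\<lambda>j. N I < 2 ^ Suc j"] unfolding lev_def by simp
      qed (use N_pos[OF that] in simp)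
    qed
    have level: "(\<Sum>I\<in>{I \<in> A. lev I = j}. wt s I) \<le> 2 * real C * x ^ j" for j
    proof -
      have "wt s I \<le> 2 powr (- s * real j)" if "I \<in> {I \<in> A. lev I = j}" for I
      proof -
        have "2 ^ j \<le> N I" using lev(1)[of I] A(2) that by auto
        hence "real (2 ^ j) \<le> real (N I)" by (simp only: of_nat_le_iff)
        hence "real (N I) powr (- s) \<le> (2 ^ j) powr (- s)"
          using s by (intro powr_mono2') auto
        also have "(2 ^ j :: real) = 2 powr real j" by (simp add: powr_realpow)
        finally show ?thesis by (simp add: wt_def powr_powr mult.commute)
      qed
      hence "(\<Sum>I\<in>{I \<in> A. lev I = j}. wt s I) \<le> (\<Sum>I\<in>{I \<in> A. lev I = j}. 2 powr (- s * real j))"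
        by (rule sum_mono)
      also have "\<dots> = real (card {I \<in> A. lev I = j}) * 2 powr (- s * real j)" by simp
      also have "\<dots> \<le> real (C * 2 ^ Suc j) * 2 powr (- s * real j)"
      proof (intro mult_right_mono)
        have "{I \<in> A. lev I = j} \<subseteq> {I. nzidl I \<and> N I \<le> 2 ^ Suc j}"
          using lev(2) A(2) by fastforce
        hence "card {I \<in> A. lev I = j} \<le> card {I. nzidl I \<and> N I \<le> 2 ^ Suc j}"
          by (intro card_mono finite_bounded_norm)
        also have "\<dots> \<le> C * 2 ^ Suc j" by (rule C) simp
        finally show "real (card {I \<in> A. lev I = j}) \<le> real (C * 2 ^ Suc j)" by (simp only: of_nat_le_iff)
      qed simp
      also have "\<dots> = 2 * real C * (2 powr real j * 2 powr (- s * real j))"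
        by (simp add: powr_realpow)
      also have "2 powr real j * 2 powr (- s * real j) = 2 powr ((1 - s) * real j)"
        by (simp add: powr_add[symmetric] algebra_simps)
      also have "\<dots> = x ^ j" unfolding x_def by (simp add: powr_powr[symmetric] powr_realpow)
      finally show ?thesis .
    qed
    have "(\<Sum>I\<in>A. wt s I) = (\<Sum>j\<in>lev ` A. \<Sum>I\<in>{I \<in> A. lev I = j}. wt s I)"
      by (rule sum.image_gen[OF A(1)])
    also have "\<dots> \<le> (\<Sum>j\<in>lev ` A. 2 * real C * x ^ j)" by (intro sum_mono level)
    also have "\<dots> = 2 * real C * (\<Sum>j\<in>lev ` A. x ^ j)" by (simp add: sum_distrib_left)
    also have "(\<Sum>j\<in>lev ` A. x ^ j) \<le> (\<Sum>j. x ^ j)"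
      using x A(1) by (intro sum_le_suminf summable_geometric) auto
    also have "(\<Sum>j. x ^ j) = 1 / (1 - x)" using x by (intro suminf_geometric) auto
    \<comment> \<open>With u = (s - 1) ln 2 the ratio is exp (- u) \<le> 1 / (1 + u). The bound
      follows from u \<le> 1 and ln 2 \<ge> 1/2.\<close>
    also have "1 / (1 - x) \<le> 4 / (s - 1)"
    proof -
      define u where "u = (s - 1) * ln 2"
      have l2: "1 / 2 \<le> ln (2::real)" "ln (2::real) \<le> 1"
        using ln_le_minus_one[of "1 / 2 :: real"] ln_le_minus_one[of "2::real"] by (simp_all add: ln_div)
      have u: "u > 0" unfolding u_def using s by simp
      have "x = exp (- u)" unfolding x_def u_def powr_def by (simp add: algebra_simps)
      hence "x \<le> 1 / (1 + u)"
        using exp_ge_add_one_self[of u] u by (simp add: exp_minus inverse_eq_divide frac_le)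
      hence "1 - x \<ge> 1 - 1 / (1 + u)" by simp
      also have "1 - 1 / (1 + u) = u / (1 + u)" using u by (simp add: field_simps)
      finally have "1 - x \<ge> u / (1 + u)" .
      moreover have "u / (1 + u) \<ge> (s - 1) / 4"
      proof -
        have "u \<le> 1 * 1" unfolding u_def using s l2 by (intro mult_mono) auto
        hence "(s - 1) * (1 + u) \<le> (s - 1) * 2" using s by (intro mult_left_mono) auto
        also have "\<dots> \<le> 4 * u" unfolding u_def using s mult_left_mono[OF l2(1), of "s - 1"] by linarith
        finally show ?thesis using u by (simp add: field_simps)
      qed
      ultimately have "(s - 1) / 4 \<le> 1 - x" by linarith
      hence "1 / (1 - x) \<le> 1 / ((s - 1) / 4)" using s by (intro divide_left_mono mult_pos_pos) (auto simp: x(2))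
      thus ?thesis by simp
    qed
    finally have "(\<Sum>I\<in>A. wt s I) \<le> 2 * real C * (4 / (s - 1))" by (simp add: mult_left_mono)
    also have "\<dots> \<le> (8 * real C + 1) / (s - 1)" using s by (simp add: field_simps)
    finally show ?thesis .
  qed
  thus ?thesis by (intro exI[of _ "8 * real C + 1"]) auto
qed

text \<open>Counts from below do not yet control the weights: ideals of small norm must be
  subtracted. The upper count does this, so each shell \<open>S i\<close> of norms between two
  powers of q keeps at least q^i ideals.\<close>

lemma zeta_lower:
  "\<exists>c>0. \<forall>s. 1 < s \<longrightarrow> s \<le> 2 \<longrightarrow> (\<exists>A. finite A \<and> (\<forall>I\<in>A. nzidl I) \<and> c / (s - 1) \<le> (\<Sum>I\<in>A. wt s I))"
proof -
  from ideal_counts obtain r W \<kappa> C :: nat where r: "r \<ge> 1" "W \<ge> 1" "\<kappa> \<ge> 1"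
    and "\<forall>x\<ge>1. card {I. nzidl I \<and> N I \<le> x} \<le> C * x"
    and "\<forall>m\<ge>1. m ^ r \<le> W * card {I. nzidl I \<and> N I \<le> \<kappa> * m ^ r}"
    by (elim exE conjE)
  hence C: "card {I. nzidl I \<and> N I \<le> x} \<le> C * x" if "x \<ge> 1" for x using that by blast
  have L: "m ^ r \<le> W * card {I. nzidl I \<and> N I \<le> \<kappa> * m ^ r}" if "m \<ge> 1" for m
    using \<open>\<forall>m\<ge>1. m ^ r \<le> _\<close> that by blast
  \<comment> \<open>Large enough that at least (C \<kappa> + 1) q^i ideals have norm up to \<kappa>
    q^(i + 1), while at most C \<kappa> q^i of them have norm up to \<kappa> q^i. The final 1 gives
    Q \<ge> 2.\<close>
  define Q where "Q = W * (C * \<kappa> + 1) + 1"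
  \<comment> \<open>An r-th power, because the lower count is available only there.\<close>
  define q where "q = Q ^ r"
  have Q2: "Q \<ge> 2" unfolding Q_def using r(2) by (cases W) auto
  have qQ: "q \<ge> Q" unfolding q_def using r(1) Q2 by (intro self_le_power) auto
  have q2: "q \<ge> 2" using qQ Q2 by simp
  define S where "S i = {I. nzidl I \<and> \<kappa> * q ^ i < N I \<and> N I \<le> \<kappa> * q ^ Suc i}" for i
  have fS: "finite (S i)" for i
    unfolding S_def by (rule finite_subset[OF _ finite_bounded_norm[of "\<kappa> * q ^ Suc i"]]) auto
  have cS: "q ^ i \<le> card (S i)" for i
  proof -
    let ?A = "\<lambda>x. {I. nzidl I \<and> N I \<le> x}"
    have qi: "q ^ i \<ge> 1" using q2 by simp
    have "W * ((C * \<kappa> + 1) * q ^ i) \<le> q * q ^ i"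
      unfolding mult.assoc[symmetric] using qQ by (intro mult_right_mono) (auto simp: Q_def)
    also have "\<dots> = (Q ^ Suc i) ^ r" by (simp add: q_def power_mult[symmetric] power_add[symmetric] algebra_simps)
    also have "\<dots> \<le> W * card (?A (\<kappa> * (Q ^ Suc i) ^ r))" using Q2 by (intro L) simp
    also have "(Q ^ Suc i) ^ r = q ^ Suc i" by (simp add: q_def power_mult[symmetric] power_add[symmetric] algebra_simps)
    finally have 1: "(C * \<kappa> + 1) * q ^ i \<le> card (?A (\<kappa> * q ^ Suc i))" using r(2) by simp
    have "\<kappa> * q ^ i \<ge> 1" using r(3) qi by simp
    hence 2: "card (?A (\<kappa> * q ^ i)) \<le> C * (\<kappa> * q ^ i)" by (rule C)
    have "?A (\<kappa> * q ^ Suc i) \<subseteq> ?A (\<kappa> * q ^ i) \<union> S i" unfolding S_def by auto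
    hence "card (?A (\<kappa> * q ^ Suc i)) \<le> card (?A (\<kappa> * q ^ i) \<union> S i)"
      by (intro card_mono finite_UnI fS finite_bounded_norm)
    also have "\<dots> \<le> card (?A (\<kappa> * q ^ i)) + card (S i)" by (rule card_Un_le)
    finally show ?thesis using 1 2 by (simp add: algebra_simps)
  qed
  have disj: "S i \<inter> S j = {}" if "i < j" for i j
  proof -
    have "q ^ Suc i \<le> q ^ j" using that q2 by (intro power_increasing) auto
    hence "\<kappa> * q ^ Suc i \<le> \<kappa> * q ^ j" by (rule mult_left_mono) simp
    hence False if "z \<in> S i" "z \<in> S j" for z
      using that unfolding S_def mem_Collect_eq by linarith
    thus ?thesis by blast
  qed
  \<comment> \<open>A lower bound for (\<kappa> q)^(- s) that is uniform in s \<le> 2.\<close>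
  define d where "d = real (\<kappa> * q) powr (- 2)"
  have d: "d > 0" unfolding d_def using r(3) q2 by simp
  have lnq: "ln (real q) > 0" using q2 by simp
  have "\<exists>A. finite A \<and> (\<forall>I\<in>A. nzidl I) \<and> (d / (2 * ln (real q))) / (s - 1) \<le> (\<Sum>I\<in>A. wt s I)"
    if s: "1 < s" "s \<le> 2" for s
  proof -
    define x where "x = real q powr (1 - s)"
    have x: "0 < x" "x < 1" unfolding x_def using s q2 by (auto intro: powr_less_one)
    have level: "d * x ^ i \<le> (\<Sum>I\<in>S i. wt s I)" for i
    proof -
      have "d * real q powr (- s * real i) \<le> wt s I" if I: "I \<in> S i" for I
      proof -
        have "real (N I) \<le> real (\<kappa> * q ^ Suc i)" using I unfolding S_def by (simp only: mem_Collect_eq of_nat_le_iff)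
        also have "\<dots> = real (\<kappa> * q) * real q powr real i" using q2 by (simp add: powr_realpow)
        finally have le: "real (N I) \<le> real (\<kappa> * q) * real q powr real i" .
        have "d \<le> real (\<kappa> * q) powr (- s)"
        proof -
          have "\<kappa> * q \<ge> 1" using r(3) q2 by simp
          hence "real (\<kappa> * q) \<ge> 1" by (metis of_nat_1 of_nat_le_iff)
          thus ?thesis unfolding d_def using s by (intro powr_mono) auto
        qed
        hence "d * real q powr (- s * real i) \<le> real (\<kappa> * q) powr (- s) * real q powr (- s * real i)"
          by (rule mult_right_mono) simp
        also have "\<dots> = (real (\<kappa> * q) * real q powr real i) powr (- s)"
          by (simp add: powr_mult powr_powr mult.commute)
        also have "\<dots> \<le> real (N I) powr (- s)"
        proof (rule powr_mono2'[OF _ _ le])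
          show "0 < real (N I)" using I N_pos by (simp add: S_def)
        qed (use s in auto)
        finally show ?thesis by (simp add: wt_def)
      qed
      hence "(\<Sum>I\<in>S i. d * real q powr (- s * real i)) \<le> (\<Sum>I\<in>S i. wt s I)" by (rule sum_mono)
      moreover have "d * x ^ i \<le> (\<Sum>I\<in>S i. d * real q powr (- s * real i))"
      proof -
        have "x ^ i = real q powr ((1 - s) * real i)" unfolding x_def using q2 by (simp add: powr_powr[symmetric] powr_realpow)
        also have "\<dots> = real q powr real i * real q powr (- s * real i)"
          by (simp add: powr_add[symmetric] algebra_simps)
        also have "real q powr real i = real (q ^ i)" using q2 by (simp add: powr_realpow)
        finally have "d * x ^ i = real (q ^ i) * (d * real q powr (- s * real i))" by simp
        also have "\<dots> \<le> real (card (S i)) * (d * real q powr (- s * real i))"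
          using cS[of i] d by (intro mult_right_mono) (simp_all only: of_nat_le_iff, simp)
        finally show ?thesis by simp
      qed
      ultimately show ?thesis by linarith
    qed
    \<comment> \<open>So many shells carry at least half of the geometric series; their number may
      depend on s.\<close>
    obtain K where K: "x ^ K < 1 / 2" using real_arch_pow_inv[of "1/2" x] x by auto
    define A where "A = (\<Union>i<K. S i)"
    have "(\<Sum>I\<in>A. wt s I) = (\<Sum>i<K. \<Sum>I\<in>S i. wt s I)"
      unfolding A_def using disj by (intro sum.UNION_disjoint ballI fS impI) (auto, metis disjoint_iff linorder_neqE_nat)
    also have "\<dots> \<ge> (\<Sum>i<K. d * x ^ i)" by (rule sum_mono) (rule level)
    finally have "(\<Sum>i<K. d * x ^ i) \<le> (\<Sum>I\<in>A. wt s I)" .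
    moreover have "(\<Sum>i<K. d * x ^ i) = d * ((1 - x ^ K) / (1 - x))"
      using x by (simp add: sum_distrib_left[symmetric] sum_gp_strict)
    moreover have "d * ((1 - x ^ K) / (1 - x)) \<ge> d * ((1 / 2) / ((s - 1) * ln (real q)))"
    proof (intro mult_left_mono frac_le)
      have "x = exp (- ((s - 1) * ln (real q)))" unfolding x_def powr_def using q2 by (simp add: algebra_simps)
      thus "1 - x \<le> (s - 1) * ln (real q)" using exp_ge_add_one_self[of "- ((s - 1) * ln (real q))"] by simp
    qed (use K x d in auto)
    moreover have "d * ((1 / 2) / ((s - 1) * ln (real q))) = (d / (2 * ln (real q))) / (s - 1)"
      using s lnq by (simp add: field_simps)
    ultimately have "(d / (2 * ln (real q))) / (s - 1) \<le> (\<Sum>I\<in>A. wt s I)" by linarith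
    moreover have "finite A" "\<forall>I\<in>A. nzidl I" unfolding A_def using fS by (auto simp: S_def)
    ultimately show ?thesis by (intro exI[of _ A]) auto
  qed
  moreover have "d / (2 * ln (real q)) > 0" using d lnq by simp
  ultimately show ?thesis by blast
qed

end

section \<open>Euler products and sums over primes\<close>

context number_subfield
begin

lemma wt_mult: "nzidl I \<Longrightarrow> nzidl J \<Longrightarrow> wt s (iprod I J) = wt s I * wt s J"
  by (simp add: wt_def N_mult powr_mult)

lemma wt_ints: "wt s ints = 1"
  by (simp add: wt_def N_ints)

lemma wt_prime_le_half: "maxidl P \<Longrightarrow> s \<ge> 1 \<Longrightarrow> wt s P \<le> 1 / 2"
proof -
  assume P: "maxidl P" and s: "s \<ge> 1"
  have N2: "real (N P) \<ge> 2" using maxidl_N_ge_2[OF P] by simp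
  have "wt s P \<le> 2 powr (- s)" unfolding wt_def using N2 s by (intro powr_mono2') auto
  also have "\<dots> \<le> 2 powr (- 1)" using s by (intro powr_mono) auto
  finally show ?thesis by (simp add: powr_minus_divide)
qed

lemma maxidl_contains_prod:
  assumes Q: "maxidl Q" and I: "idl I" and J: "idl J" and sub: "iprod I J \<subseteq> Q"
  shows "I \<subseteq> Q \<or> J \<subseteq> Q"
proof (rule ccontr)
  assume "\<not> (I \<subseteq> Q \<or> J \<subseteq> Q)"
  then obtain i j where "i \<in> I" "i \<notin> Q" "j \<in> J" "j \<notin> Q" by blast
  moreover have "i * j \<in> Q" using sub iprod.prod calculation by blast
  ultimately show False using maxidl_prime[OF Q] idl_ints I J by blast
qed

lemma maxidl_antisym: "maxidl P \<Longrightarrow> maxidl Q \<Longrightarrow> P \<subseteq> Q \<Longrightarrow> P = Q"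
  using maxidlD[of P Q] max_idl unfolding maxidl_def by blast

text \<open>Multiplying out: A consists of the products over the subsets of T. The clause on prime
  divisors ensures that a new prime P divides no member of A, so the old terms and their multiples
  by P stay apart.\<close>

lemma squarefree_product:
  assumes "finite T" "\<forall>P\<in>T. maxidl P"
  shows "\<exists>A. finite A \<and> (\<forall>I\<in>A. nzidl I \<and> (\<forall>Q. maxidl Q \<longrightarrow> I \<subseteq> Q \<longrightarrow> Q \<in> T)) \<and>
    (\<Prod>P\<in>T. 1 + wt s P) = (\<Sum>I\<in>A. wt s I)"
  using assms
proof (induction T)
  case empty
  have "\<not> ints \<subseteq> Q" if "maxidl Q" for Q
    using maxidl_one[OF that] ints_1 by blast
  thus ?case using ints_nzidl wt_ints by (intro exI[of _ "{ints}"]) auto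
next
  case (insert P T)
  have "\<forall>P\<in>T. maxidl P" using insert.prems by blast
  from insert.IH[OF this] obtain A where A0: "finite A"
    "\<forall>I\<in>A. nzidl I \<and> (\<forall>Q. maxidl Q \<longrightarrow> I \<subseteq> Q \<longrightarrow> Q \<in> T)"
    "(\<Prod>P\<in>T. 1 + wt s P) = (\<Sum>I\<in>A. wt s I)" by (elim exE conjE)
  have A1: "nzidl I" if "I \<in> A" for I using A0(2) that by blast
  have A2: "Q \<in> T" if "I \<in> A" "maxidl Q" "I \<subseteq> Q" for I Q using A0(2) that by blast
  note A = A0(1) A1 A2 A0(3)
  have P: "maxidl P" "idl P" "nzidl P" using insert.prems max_idl max_nzidl by auto
  define A' where "A' = A \<union> iprod P ` A"
  have sub: "iprod P I \<subseteq> P" if "I \<in> A" for I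
    using iprod_subset_left[OF P(2) nz_idl[OF A(2)[OF that]]] .
  have disj: "A \<inter> iprod P ` A = {}"
    using sub A(3)[OF _ P(1)] insert.hyps(2) by blast
  have inj: "inj_on (iprod P) A"
    by (rule inj_onI) (rule iprod_cancel[OF P(3)], auto intro: nz_idl A(2))
  have "(\<Sum>I\<in>A'. wt s I) = (\<Sum>I\<in>A. wt s I) + (\<Sum>I\<in>A. wt s (iprod P I))"
    unfolding A'_def using A(1) disj by (simp add: sum.union_disjoint sum.reindex[OF inj])
  also have "(\<Sum>I\<in>A. wt s (iprod P I)) = wt s P * (\<Sum>I\<in>A. wt s I)"
    unfolding sum_distrib_left by (intro sum.cong refl wt_mult P A(2))
  finally have "(\<Prod>P\<in>insert P T. 1 + wt s P) = (\<Sum>I\<in>A'. wt s I)"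
    using insert.hyps A(4) by (simp add: distrib_right)
  moreover have "Q \<in> insert P T" if h: "I \<in> A'" "maxidl Q" "I \<subseteq> Q" for I Q
  proof (cases "I \<in> A")
    case False
    then obtain J where J: "J \<in> A" "I = iprod P J" using h(1) by (auto simp: A'_def)
    hence "P \<subseteq> Q \<or> J \<subseteq> Q"
      using maxidl_contains_prod[OF h(2) P(2) nz_idl[OF A(2)[OF J(1)]]] h(3) by blast
    thus ?thesis using maxidl_antisym[OF P(1) h(2)] A(3)[OF J(1) h(2)] by blast
  next
    case True
    thus ?thesis using A(3)[OF True h(2,3)] by blast
  qed
  moreover have "nzidl I" if "I \<in> A'" for I
    using that A(2) iprod_nzidl[OF P(3)] by (auto simp: A'_def)
  moreover have "finite A'" using A(1) by (simp add: A'_def)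
  ultimately show ?case by (intro exI[of _ A']) blast
qed

text \<open>Splitting off one factor \<open>P\<close>: the sum over the ideals divisible by \<open>P\<close> is \<open>wt s P\<close> times
  a sum of the same kind over smaller ideals.\<close>
lemma euler_product_bound:
  assumes s: "s \<ge> 1" and "finite T" "\<forall>P\<in>T. maxidl P"
    and "finite A" "\<forall>I\<in>A. nzidl I \<and> (\<forall>Q. maxidl Q \<longrightarrow> I \<subseteq> Q \<longrightarrow> Q \<in> T)"
  shows "(\<Sum>I\<in>A. wt s I) \<le> (\<Prod>P\<in>T. 1 / (1 - wt s P))"
  using assms(2-)
proof (induction T arbitrary: A)
  case empty
  have "I = ints" if "I \<in> A" for I
    using maxidl_exists[of I] empty(3) that by blast
  hence "A \<subseteq> {ints}" by blast
  hence "(\<Sum>I\<in>A. wt s I) \<le> (\<Sum>I\<in>{ints}. wt s I)" by (intro sum_mono2) (auto simp: wt_nonneg)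
  thus ?case by (simp add: wt_ints)
next
  case (insert P T)
  have P: "maxidl P" "idl P" "nzidl P" using insert.prems(1) max_idl max_nzidl by auto
  define E where "E = (\<Prod>P\<in>T. 1 / (1 - wt s P))"
  define x where "x = wt s P"
  have x: "0 \<le> x" "x \<le> 1 / 2" unfolding x_def using wt_nonneg wt_prime_le_half[OF P(1) s] by auto
  have E0: "E \<ge> 0"
    unfolding E_def using wt_prime_le_half s insert.prems(1)
    by (intro prod_nonneg) (fastforce intro: divide_nonneg_pos)
  \<comment> \<open>The inner induction is on a bound for the norms, which drops when P is divided
    out. The value t = E / (1 - x) is the fixed point of t = E + x t.\<close>
  have bound: "(\<Sum>I\<in>A. wt s I) \<le> E / (1 - x)"
    if "finite A" "\<forall>I\<in>A. nzidl I \<and> (\<forall>Q. maxidl Q \<longrightarrow> I \<subseteq> Q \<longrightarrow> Q \<in> insert P T)" "\<forall>I\<in>A. N I < n" for n A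
    using that
  proof (induction n arbitrary: A)
    case 0
    hence "A = {}" by auto
    thus ?case using E0 x by simp
  next
    case (Suc n)
    define A0 where "A0 = {I \<in> A. \<not> I \<subseteq> P}"
    define A1 where "A1 = {I \<in> A. I \<subseteq> P}"
    have "\<exists>J. nzidl J \<and> I = iprod P J \<and> I \<subset> J" if "I \<in> A1" for I
      using maxidl_divides[OF P(1)] Suc.prems(2) that by (auto simp: A1_def)
    then obtain g where g: "\<And>I. I \<in> A1 \<Longrightarrow> nzidl (g I)" "\<And>I. I \<in> A1 \<Longrightarrow> iprod P (g I) = I"
      "\<And>I. I \<in> A1 \<Longrightarrow> I \<subset> g I" by metis
    have inj: "inj_on g A1" by (rule inj_on_inverseI[of _ "iprod P"]) (rule g(2))
    have "(\<Sum>I\<in>A0. wt s I) \<le> E"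
      unfolding E_def
    proof (rule insert.IH)
      show "\<forall>I\<in>A0. nzidl I \<and> (\<forall>Q. maxidl Q \<longrightarrow> I \<subseteq> Q \<longrightarrow> Q \<in> T)"
        using Suc.prems(2) unfolding A0_def by blast
    qed (use insert.prems Suc.prems in \<open>auto simp: A0_def\<close>)
    moreover have "(\<Sum>I\<in>A1. wt s I) \<le> x * (E / (1 - x))"
    proof -
      have "(\<Sum>I\<in>A1. wt s I) = (\<Sum>I\<in>A1. x * wt s (g I))"
        unfolding x_def using wt_mult[OF P(3) g(1)] g(2) by (intro sum.cong) auto
      also have "\<dots> = x * (\<Sum>J\<in>g ` A1. wt s J)" by (simp add: sum_distrib_left sum.reindex[OF inj])
      also have "(\<Sum>J\<in>g ` A1. wt s J) \<le> E / (1 - x)"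
      proof (rule Suc.IH)
        show "finite (g ` A1)" using Suc.prems(1) by (simp add: A1_def)
        show "\<forall>J\<in>g ` A1. nzidl J \<and> (\<forall>Q. maxidl Q \<longrightarrow> J \<subseteq> Q \<longrightarrow> Q \<in> insert P T)"
        proof
          fix J assume "J \<in> g ` A1"
          then obtain I where I: "I \<in> A1" "J = g I" by blast
          have "Q \<in> insert P T" if "maxidl Q" "J \<subseteq> Q" for Q
          proof -
            have "I \<subseteq> Q" using g(3)[OF I(1)] that(2) I(2) by blast
            thus ?thesis using Suc.prems(2)[THEN bspec, of I] I(1) that(1) unfolding A1_def by blast
          qed
          thus "nzidl J \<and> (\<forall>Q. maxidl Q \<longrightarrow> J \<subseteq> Q \<longrightarrow> Q \<in> insert P T)"
            using g(1)[OF I(1)] I(2) by blast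
        qed
        show "\<forall>J\<in>g ` A1. N J < n"
        proof
          fix J assume "J \<in> g ` A1"
          then obtain I where I: "I \<in> A1" "J = g I" by blast
          have "nzidl I" "N I < Suc n" using I(1) Suc.prems(2,3) by (auto simp: A1_def)
          moreover have "N J < N I" unfolding I(2)
            by (rule N_less[OF calculation(1) nz_idl[OF g(1)[OF I(1)]] g(3)[OF I(1)]])
          ultimately show "N J < n" by simp
        qed
      qed
      finally show ?thesis using x by (simp add: mult_left_mono)
    qed
    moreover have "(\<Sum>I\<in>A. wt s I) = (\<Sum>I\<in>A0. wt s I) + (\<Sum>I\<in>A1. wt s I)"
    proof -
      have "A = A0 \<union> A1" "A0 \<inter> A1 = {}" by (auto simp: A0_def A1_def)
      thus ?thesis using Suc.prems(1) by (simp add: sum.union_disjoint)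
    qed
    moreover have "E + x * (E / (1 - x)) = E / (1 - x)" using x by (simp add: field_simps)
    ultimately show ?case by linarith
  qed
  obtain n where n: "\<forall>I\<in>A. N I < n"
    using finite_nat_set_iff_bounded[of "N ` A"] insert.prems(2) by auto
  have "(\<Sum>I\<in>A. wt s I) \<le> E / (1 - x)" by (rule bound[OF insert.prems(2,3) n])
  also have "E / (1 - x) = (\<Prod>P\<in>insert P T. 1 / (1 - wt s P))"
    using insert.hyps by (simp add: E_def x_def)
  finally show ?case .
qed

text \<open>From ln (1 + x) \<ge> x - x^2, applied to the product over 1 + wt, whose expansion is
  part of the zeta sum. The squares are dominated by the zeta sum at 2.\<close>

lemma prime_sum_upper:
  "\<exists>C. \<forall>s. 1 < s \<longrightarrow> s \<le> 2 \<longrightarrow> (\<forall>T. finite T \<longrightarrow> (\<forall>P\<in>T. maxidl P) \<longrightarrow>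
     (\<Sum>P\<in>T. wt s P) \<le> - ln (s - 1) + C \<and> (\<Sum>P\<in>T. (wt s P)\<^sup>2) \<le> C)"
proof -
  obtain C where C: "C > 0" "\<And>s A. 1 < s \<Longrightarrow> s \<le> 2 \<Longrightarrow> finite A \<Longrightarrow> \<forall>I\<in>A. nzidl I \<Longrightarrow>
      (\<Sum>I\<in>A. wt s I) \<le> C / (s - 1)"
    using zeta_upper by blast
  have main: "(\<Sum>P\<in>T. wt s P) \<le> - ln (s - 1) + (ln C + C + C) \<and> (\<Sum>P\<in>T. (wt s P)\<^sup>2) \<le> C"
    if s: "1 < s" "s \<le> 2" and T: "finite T" "\<forall>P\<in>T. maxidl P" for s T
  proof
    have w: "0 \<le> wt s P" "wt s P \<le> 1 / 2" if "P \<in> T" for P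
      using wt_nonneg wt_prime_le_half[of P s] T(2) s that by auto
    have "(\<Sum>P\<in>T. (wt s P)\<^sup>2) \<le> (\<Sum>P\<in>T. wt 2 P)"
    proof (rule sum_mono)
      fix P assume "P \<in> T"
      hence "real (N P) \<ge> 1" using maxidl_N_ge_2 T(2) by fastforce
      hence "real (N P) powr (- s + - s) \<le> real (N P) powr (- 2)" using s by (intro powr_mono) auto
      thus "(wt s P)\<^sup>2 \<le> wt 2 P" unfolding wt_def power2_eq_square by (simp add: powr_add[symmetric])
    qed
    also have "\<dots> \<le> C / (2 - 1)" using T max_nzidl by (intro C) auto
    finally show sq: "(\<Sum>P\<in>T. (wt s P)\<^sup>2) \<le> C" by simp
    obtain A where A: "finite A" "\<forall>I\<in>A. nzidl I" "(\<Prod>P\<in>T. 1 + wt s P) = (\<Sum>I\<in>A. wt s I)"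
      using squarefree_product[OF T, of s] by (elim exE conjE) (rule that, auto)
    have pos: "(\<Prod>P\<in>T. 1 + wt s P) > 0" by (rule prod_pos) (use w in fastforce)
    have "(\<Sum>P\<in>T. wt s P - (wt s P)\<^sup>2) \<le> (\<Sum>P\<in>T. ln (1 + wt s P))"
      using w by (intro sum_mono ln_one_plus_pos_lower_bound) fastforce+
    also have "\<dots> = ln (\<Prod>P\<in>T. 1 + wt s P)"
      by (rule ln_prod[symmetric]) (use T(1) w in fastforce)+
    also have "\<dots> \<le> ln (C / (s - 1))"
      using C(2)[OF s A(1,2)] A(3) pos s C(1) by (simp add: ln_mono)
    also have "\<dots> = ln C - ln (s - 1)" using C(1) s by (simp add: ln_div)
    finally show "(\<Sum>P\<in>T. wt s P) \<le> - ln (s - 1) + (ln C + C + C)"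
      using sq C(1) by (simp add: sum_subtractf)
  qed
  hence "(\<Sum>P\<in>T. wt s P) \<le> - ln (s - 1) + max (ln C + C + C) C \<and> (\<Sum>P\<in>T. (wt s P)\<^sup>2) \<le> max (ln C + C + C) C"
    if "1 < s" "s \<le> 2" "finite T" "\<forall>P\<in>T. maxidl P" for s T
    using main[OF that] by (auto simp: max_def)
  thus ?thesis by blast
qed

text \<open>T collects the primes dividing some ideal of a large finite part of the zeta sum, so the
  Euler product over T is at least as large. Then - ln (1 - x) \<le> x + 2 x^2 turns the product
  into a sum.\<close>

lemma prime_sum_lower:
  "\<exists>C. \<forall>s. 1 < s \<longrightarrow> s \<le> 2 \<longrightarrow> (\<exists>T. finite T \<and> (\<forall>P\<in>T. maxidl P) \<and> - ln (s - 1) - C \<le> (\<Sum>P\<in>T. wt s P))"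
proof -
  obtain c where c: "c > 0" "\<And>s. 1 < s \<Longrightarrow> s \<le> 2 \<Longrightarrow>
      \<exists>A. finite A \<and> (\<forall>I\<in>A. nzidl I) \<and> c / (s - 1) \<le> (\<Sum>I\<in>A. wt s I)"
    using zeta_lower by blast
  obtain C where C: "\<And>s T. 1 < s \<Longrightarrow> s \<le> 2 \<Longrightarrow> finite T \<Longrightarrow> \<forall>P\<in>T. maxidl P \<Longrightarrow> (\<Sum>P\<in>T. (wt s P)\<^sup>2) \<le> C"
    using prime_sum_upper by blast
  have "\<exists>T. finite T \<and> (\<forall>P\<in>T. maxidl P) \<and> - ln (s - 1) - (2 * C - ln c) \<le> (\<Sum>P\<in>T. wt s P)"
    if s: "1 < s" "s \<le> 2" for s
  proof -
    obtain A where A: "finite A" "\<forall>I\<in>A. nzidl I" "c / (s - 1) \<le> (\<Sum>I\<in>A. wt s I)"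
      using c(2)[OF s] by blast
    define T where "T = (\<Union>I\<in>A. {P. maxidl P \<and> I \<subseteq> P})"
    have "finite {P. maxidl P \<and> I \<subseteq> P}" if I: "I \<in> A" for I
    proof -
      obtain a where "a \<in> I" "a \<noteq> 0" using nzidlE A(2) I by blast
      moreover have "a \<in> ints" using calculation idl_ints nz_idl A(2) I by blast
      ultimately show ?thesis
        by (intro finite_subset[OF _ finite_ideals_containing[of a]]) (auto dest: max_idl)
    qed
    hence T: "finite T" "\<forall>P\<in>T. maxidl P" unfolding T_def using A(1) by auto
    have w: "0 \<le> wt s P" "wt s P \<le> 1 / 2" if "P \<in> T" for P
      using wt_nonneg wt_prime_le_half[of P s] T(2) s that by auto
    have "\<forall>I\<in>A. nzidl I \<and> (\<forall>Q. maxidl Q \<longrightarrow> I \<subseteq> Q \<longrightarrow> Q \<in> T)"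
      using A(2) unfolding T_def by blast
    hence "c / (s - 1) \<le> (\<Prod>P\<in>T. 1 / (1 - wt s P))"
      using euler_product_bound[OF _ T A(1), of s] A(3) s by linarith
    hence "ln (c / (s - 1)) \<le> ln (\<Prod>P\<in>T. 1 / (1 - wt s P))"
      using c(1) s by (intro ln_mono) auto
    also have "\<dots> = (\<Sum>P\<in>T. ln (1 / (1 - wt s P)))"
      by (rule ln_prod) (use T(1) w in fastforce)+
    also have "\<dots> \<le> (\<Sum>P\<in>T. wt s P + 2 * (wt s P)\<^sup>2)"
    proof (rule sum_mono)
      fix P assume P: "P \<in> T"
      have "- wt s P - 2 * (wt s P)\<^sup>2 \<le> ln (1 - wt s P)"
        by (rule ln_one_minus_pos_lower_bound) (use w[OF P] in auto)
      thus "ln (1 / (1 - wt s P)) \<le> wt s P + 2 * (wt s P)\<^sup>2"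
        using w[OF P] by (simp add: ln_div)
    qed
    also have "\<dots> \<le> (\<Sum>P\<in>T. wt s P) + 2 * C"
      using C[OF s T] by (simp add: sum.distrib sum_distrib_left[symmetric])
    finally have "- ln (s - 1) - (2 * C - ln c) \<le> (\<Sum>P\<in>T. wt s P)"
      using c(1) s by (simp add: ln_div)
    thus ?thesis using T by blast
  qed
  thus ?thesis by blast
qed

lemma prime_sum_summable:
  assumes s: "1 < s" "s \<le> 2" and S: "S \<subseteq> {P. maxidl P}"
  shows "wt s summable_on S"
proof -
  obtain C where C: "\<And>T. finite T \<Longrightarrow> \<forall>P\<in>T. maxidl P \<Longrightarrow> (\<Sum>P\<in>T. wt s P) \<le> - ln (s - 1) + C"
    using prime_sum_upper s by blast
  show ?thesis
  proof (rule nonneg_bdd_above_summable_on)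
    show "bdd_above (sum (wt s) ` {F. F \<subseteq> S \<and> finite F})"
      using C S by (intro bdd_aboveI[of _ "- ln (s - 1) + C"]) auto
  qed (rule wt_nonneg)
qed

lemma prime_sum_asymptotic:
  "\<exists>C. \<forall>s. 1 < s \<longrightarrow> s \<le> 2 \<longrightarrow> \<bar>(\<Sum>\<^sub>\<infinity>P\<in>{P. maxidl P}. wt s P) + ln (s - 1)\<bar> \<le> C"
proof -
  obtain C where C: "\<And>s T. 1 < s \<Longrightarrow> s \<le> 2 \<Longrightarrow> finite T \<Longrightarrow> \<forall>P\<in>T. maxidl P \<Longrightarrow> (\<Sum>P\<in>T. wt s P) \<le> - ln (s - 1) + C"
    using prime_sum_upper by blast
  obtain c where c: "\<And>s. 1 < s \<Longrightarrow> s \<le> 2 \<Longrightarrow>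
      \<exists>T. finite T \<and> (\<forall>P\<in>T. maxidl P) \<and> - ln (s - 1) - c \<le> (\<Sum>P\<in>T. wt s P)"
    using prime_sum_lower by blast
  have "\<bar>(\<Sum>\<^sub>\<infinity>P\<in>{P. maxidl P}. wt s P) + ln (s - 1)\<bar> \<le> max C c" if s: "1 < s" "s \<le> 2" for s
  proof -
    have summ: "wt s summable_on {P. maxidl P}" by (rule prime_sum_summable[OF s order_refl])
    have "(\<Sum>\<^sub>\<infinity>P\<in>{P. maxidl P}. wt s P) \<le> - ln (s - 1) + C"
      by (rule infsum_le_finite_sums[OF summ]) (use C[OF s] in auto)
    moreover obtain T where T: "finite T" "\<forall>P\<in>T. maxidl P" "- ln (s - 1) - c \<le> (\<Sum>P\<in>T. wt s P)"
      using c[OF s] by blast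
    have "(\<Sum>P\<in>T. wt s P) \<le> (\<Sum>\<^sub>\<infinity>P\<in>{P. maxidl P}. wt s P)"
      using T by (intro finite_sum_le_infsum summ) (auto simp: wt_nonneg)
    ultimately show ?thesis using T(3) by linarith
  qed
  thus ?thesis by blast
qed

lemma prime_square_sum_bounded:
  "\<exists>C. \<forall>s. 1 < s \<longrightarrow> s \<le> 2 \<longrightarrow> (\<forall>T. finite T \<longrightarrow> (\<forall>P\<in>T. maxidl P) \<longrightarrow> (\<Sum>P\<in>T. (wt s P)\<^sup>2) \<le> C)"
  using prime_sum_upper by blast

end

section \<open>Quadratic extensions\<close>

lemma to_ac_of_rat: "to_ac (of_rat q :: 'k::field_char_0) = of_rat q"
proof (cases q)
  case (Fract a b)
  thus ?thesis by (simp add: of_rat_rat)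
qed

lemma to_ac_poly_of_int:
  "poly (map_poly of_int p) (to_ac x :: 'k::field_char_0 alg_closure) = to_ac (poly (map_poly of_int p) x)"
  by (simp add: poly_altdef degree_map_poly coeff_map_poly to_ac_sum)

lemma algebraic_int_to_ac: "algebraic_int (to_ac x) \<longleftrightarrow> algebraic_int (x :: 'k::field_char_0)"
  unfolding algebraic_int_altdef_ipoly to_ac_poly_of_int by simp

lemma UNIV_number_subfield: "number_subfield (UNIV :: 'k::number_field set)"
proof
  obtain B :: "'k set" where B: "finite B" "\<forall>x. \<exists>c. x = (\<Sum>b\<in>B. of_rat (c b) * b)"
    using finite_dim_over_rat by metis
  show "\<exists>S. finite S \<and> S \<subseteq> UNIV \<and> (\<forall>x\<in>(UNIV::'k set). \<exists>c. x = (\<Sum>b\<in>S. of_rat (c b) * b))"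
    using B by (intro exI[of _ B]) auto
qed auto

interpretation K: number_subfield "UNIV :: 'k::number_field set"
  by (rule UNIV_number_subfield)

lemma K_ints: "x \<in> K.ints \<longleftrightarrow> algebraic_int x"
  by (simp add: K.ints_def)

locale quadratic_extension =
  fixes D :: "'k::number_field" and w :: "'k alg_closure"
  assumes w2: "w ^ 2 = to_ac D"
    and nonsquare: "\<And>x. x ^ 2 \<noteq> D"
    and D_int: "algebraic_int D"
begin

definition L :: "'k alg_closure set" where "L = range (\<lambda>(a, b). to_ac a + to_ac b * w)"

lemma LI: "to_ac a + to_ac b * w \<in> L"
  unfolding L_def by (rule range_eqI[of _ _ "(a, b)"]) simp

lemma LE:
  assumes "x \<in> L"
  obtains a b where "x = to_ac a + to_ac b * w"
  using assms unfolding L_def by auto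

lemma ww: "w * w = to_ac D"
  using w2 by (simp add: power2_eq_square)

lemma w_notin: "to_ac a \<noteq> w"
proof
  assume "to_ac a = w"
  hence "to_ac (a ^ 2) = to_ac D" using w2 by simp
  thus False using nonsquare[of a] by (simp only: to_ac_eq_iff)
qed

lemma rep_zero:
  assumes "to_ac a + to_ac b * w = 0"
  shows "a = 0 \<and> b = 0"
proof -
  have "b = 0"
  proof (rule ccontr)
    assume b: "b \<noteq> 0"
    have "to_ac b * w = to_ac (- a)" using assms by (simp add: add_eq_0_iff)
    hence "w = to_ac (- a) / to_ac b" using b by (simp add: field_simps)
    hence "to_ac (- a / b) = w" by (simp only: to_ac_divide)
    thus False using w_notin by blast
  qed
  thus ?thesis using assms by simp
qed

lemma rep_unique:
  assumes "to_ac a + to_ac b * w = to_ac a' + to_ac b' * w"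
  shows "a = a' \<and> b = b'"
proof -
  have "to_ac (a - a') + to_ac (b - b') * w = 0" using assms by (simp add: algebra_simps)
  from rep_zero[OF this] show ?thesis by simp
qed

lemma rep_mult:
  "(to_ac a + to_ac b * w) * (to_ac c + to_ac d * w) = to_ac (a * c + b * d * D) + to_ac (a * d + b * c) * w"
proof -
  have "(to_ac a + to_ac b * w) * (to_ac c + to_ac d * w)
      = to_ac a * to_ac c + to_ac b * to_ac d * (w * w) + (to_ac a * to_ac d + to_ac b * to_ac c) * w"
    by (simp only: algebra_simps)
  thus ?thesis by (simp add: ww)
qed

lemma L_subfield: "number_subfield L"
proof
  show "1 \<in> L" using LI[of 1 0] by simp
  show "x - y \<in> L" if xy: "x \<in> L" "y \<in> L" for x y
  proof -
    obtain a b where "x = to_ac a + to_ac b * w" using LE[OF xy(1)] .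
    moreover obtain c d where "y = to_ac c + to_ac d * w" using LE[OF xy(2)] .
    ultimately have "x - y = to_ac (a - c) + to_ac (b - d) * w" by (simp add: algebra_simps)
    thus ?thesis using LI by metis
  qed
  show "x * y \<in> L" if xy: "x \<in> L" "y \<in> L" for x y
  proof -
    obtain a b where "x = to_ac a + to_ac b * w" using LE[OF xy(1)] .
    moreover obtain c d where "y = to_ac c + to_ac d * w" using LE[OF xy(2)] .
    ultimately show ?thesis using LI by (simp only: rep_mult)
  qed
  show "inverse x \<in> L" if xL: "x \<in> L" for x
  proof (cases "x = 0")
    case True
    thus ?thesis using LI[of 0 0] by simp
  next
    case False
    obtain a b where x: "x = to_ac a + to_ac b * w" using LE[OF xL] .
    define n where "n = a * a - b * b * D"
    have "n \<noteq> 0"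
    proof
      assume n: "n = 0"
      show False
      proof (cases "b = 0")
        case True
        thus ?thesis using n False x by (simp add: n_def)
      next
        case b: False
        have "(a / b) ^ 2 = D" using n b by (simp add: n_def field_simps power2_eq_square)
        thus ?thesis using nonsquare by blast
      qed
    qed
    have "x * (to_ac (a / n) + to_ac (- b / n) * w) = to_ac (a * (a / n) + b * (- b / n) * D) + to_ac (a * (- b / n) + b * (a / n)) * w"
      unfolding x by (rule rep_mult)
    also have "a * (a / n) + b * (- b / n) * D = n / n"
      by (simp only: n_def times_divide_eq_right times_divide_eq_left add_divide_distrib[symmetric])
         (simp add: algebra_simps)
    also have "a * (- b / n) + b * (a / n) = 0" by (simp add: algebra_simps)
    finally have "x * (to_ac (a / n) + to_ac (- b / n) * w) = 1" using \<open>n \<noteq> 0\<close> by simp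
    hence "inverse x = to_ac (a / n) + to_ac (- b / n) * w" by (rule inverse_unique)
    thus ?thesis using LI by metis
  qed
  show "\<exists>S. finite S \<and> S \<subseteq> L \<and> (\<forall>x\<in>L. \<exists>c. x = (\<Sum>b\<in>S. of_rat (c b) * b))"
  proof -
    obtain B :: "'k set" where B: "finite B" "\<forall>x. \<exists>c. x = (\<Sum>b\<in>B. of_rat (c b) * b)"
      using finite_dim_over_rat by metis
    define S where "S = to_ac ` B \<union> (\<lambda>b. to_ac b * w) ` B"
    have fS: "finite S" using B(1) by (simp add: S_def)
    have SL: "S \<subseteq> L" unfolding S_def using LI[of _ 0] LI[of 0] by auto
    have "x \<in> rat_vs.span S" if xL: "x \<in> L" for x
    proof -
      obtain a b where x: "x = to_ac a + to_ac b * w" using LE[OF xL] .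
      obtain c where c: "a = (\<Sum>b\<in>B. of_rat (c b) * b)" using B(2) by metis
      obtain d where d: "b = (\<Sum>b\<in>B. of_rat (d b) * b)" using B(2) by metis
      have "x = (\<Sum>b\<in>B. of_rat (c b) * to_ac b) + (\<Sum>b\<in>B. of_rat (d b) * (to_ac b * w))"
        unfolding x c d by (simp add: to_ac_sum to_ac_of_rat sum_distrib_right mult.assoc)
      also have "\<dots> \<in> rat_vs.span S"
        by (intro rat_vs.span_add rat_vs.span_sum rat_vs.span_scale rat_vs.span_base) (auto simp: S_def)
      finally show ?thesis .
    qed
    hence "\<exists>c. x = (\<Sum>b\<in>S. of_rat (c b) * b)" if "x \<in> L" for x
      using that unfolding rat_vs.span_finite[OF fS] by auto
    thus ?thesis using fS SL by (intro exI[of _ S]) blast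
  qed
qed

sublocale L: number_subfield L by (rule L_subfield)

lemma to_ac_L_ints: "to_ac a \<in> L.ints \<longleftrightarrow> a \<in> K.ints"
  using LI[of a 0] by (simp add: L.ints_def K_ints algebraic_int_to_ac)

lemma w_ints: "w \<in> L.ints"
proof -
  have "algebraic_int w"
  proof (rule algebraic_int_root[of "to_ac D" "monom 1 2"])
    show "algebraic_int (to_ac D)" using D_int by (simp add: algebraic_int_to_ac)
    show "poly (monom 1 2) w = to_ac D" by (simp add: poly_monom w2)
  qed (auto simp: degree_monom_eq lead_coeff_monom coeff_monom)
  thus ?thesis using LI[of 0 1] by (simp add: L.ints_def)
qed

lemma D_ints: "D \<in> K.ints"
  using D_int by (simp add: K_ints)

section \<open>Conjugation and denominators of integers in L\<close>

lemma conjugate_power: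
  "\<exists>c d. (to_ac a + to_ac b * w) ^ k = to_ac c + to_ac d * w \<and> (to_ac a - to_ac b * w) ^ k = to_ac c - to_ac d * w"
proof (induction k)
  case 0
  show ?case by (rule exI[of _ 1], rule exI[of _ 0]) simp
next
  case (Suc k)
  then obtain c d where cd: "(to_ac a + to_ac b * w) ^ k = to_ac c + to_ac d * w"
    "(to_ac a - to_ac b * w) ^ k = to_ac c - to_ac d * w" by blast
  have "(to_ac a - to_ac b * w) * (to_ac c - to_ac d * w)
    = (to_ac a + to_ac (- b) * w) * (to_ac c + to_ac (- d) * w)" by simp
  also have "\<dots> = to_ac (a * c + b * d * D) - to_ac (a * d + b * c) * w"
    unfolding rep_mult by (simp add: algebra_simps)
  finally show ?case unfolding power_Suc cd rep_mult by blast
qed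

text \<open>Conjugation is not set up as an automorphism. By \<open>conjugate_power\<close> a
  polynomial over Z takes values u + v w and u - v w at the two conjugates, and u + v w = 0 forces u
  = v = 0.\<close>

lemma conjugate_algebraic_int:
  assumes "algebraic_int (to_ac a + to_ac b * w)"
  shows "algebraic_int (to_ac a - to_ac b * w)"
proof -
  obtain p where p: "poly (map_poly of_int p) (to_ac a + to_ac b * w) = 0" "lead_coeff p = 1"
    using assms unfolding algebraic_int_altdef_ipoly by blast
  obtain c d where cd: "\<And>k. (to_ac a + to_ac b * w) ^ k = to_ac (c k) + to_ac (d k) * w"
    "\<And>k. (to_ac a - to_ac b * w) ^ k = to_ac (c k) - to_ac (d k) * w"
    using conjugate_power by metis
  define u where "u = (\<Sum>i\<le>degree p. of_int (coeff p i) * c i)"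
  define v where "v = (\<Sum>i\<le>degree p. of_int (coeff p i) * d i)"
  have "0 = to_ac u + to_ac v * w"
    using p(1) by (simp add: poly_altdef cd u_def v_def to_ac_sum sum_distrib_right sum.distrib[symmetric] distrib_left mult.assoc)
  hence "u = 0" "v = 0" using rep_zero[of u v] by simp_all
  have "poly (map_poly of_int p) (to_ac a - to_ac b * w) = to_ac u - to_ac v * w"
    by (simp add: poly_altdef cd u_def v_def to_ac_sum sum_distrib_right sum_subtractf[symmetric] right_diff_distrib mult.assoc)
  thus ?thesis using p(2) \<open>u = 0\<close> \<open>v = 0\<close> unfolding algebraic_int_altdef_ipoly
    by (intro exI[of _ p]) simp
qed

text \<open>For x = a + b w with conjugate x', both x + x' = 2 a and (x - x') w = 2 b D are
  integral. Thus 2 D is a common denominator for the integers of L with respect to the subring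
  K.ints + K.ints w.\<close>

lemma ints_scaled_rep:
  assumes "x \<in> L.ints"
  shows "\<exists>a\<in>K.ints. \<exists>b\<in>K.ints. to_ac (2 * D) * x = to_ac a + to_ac b * w"
proof -
  obtain a b where x: "x = to_ac a + to_ac b * w" using L.ints_subset[OF assms] LE by blast
  have i: "algebraic_int (to_ac a + to_ac b * w)" using assms by (simp add: L.ints_def x)
  have j: "algebraic_int (to_ac a - to_ac b * w)" by (rule conjugate_algebraic_int[OF i])
  have "algebraic_int ((to_ac a + to_ac b * w) + (to_ac a - to_ac b * w))" by (rule algebraic_int_add[OF i j])
  hence 1: "algebraic_int (2 * a)" using algebraic_int_to_ac[of "2 * a"] by simp
  have "algebraic_int (((to_ac a + to_ac b * w) - (to_ac a - to_ac b * w)) * w)"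
    using w_ints by (intro algebraic_int_mult algebraic_int_diff i j) (simp add: L.ints_def)
  also have "((to_ac a + to_ac b * w) - (to_ac a - to_ac b * w)) * w = to_ac (2 * D * b)"
    by (simp add: algebra_simps ww)
  finally have 2: "algebraic_int (2 * D * b)" by (simp only: algebraic_int_to_ac)
  show ?thesis
  proof (intro bexI)
    show "to_ac (2 * D) * x = to_ac (D * (2 * a)) + to_ac (2 * D * b) * w"
      unfolding x by (simp add: algebra_simps)
    show "D * (2 * a) \<in> K.ints" using algebraic_int_mult[OF D_int 1] by (simp only: K_ints)
    show "2 * D * b \<in> K.ints" using 2 by (simp only: K_ints)
  qed
qed

end

section \<open>Primes of L above a prime of K\<close>

context quadratic_extension
begin

definition below :: "'k alg_closure set \<Rightarrow> 'k set" where "below Q = {a. to_ac a \<in> Q}"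

lemma below_iff: "a \<in> below Q \<longleftrightarrow> to_ac a \<in> Q"
  by (simp add: below_def)

lemma below_ints: "L.maxidl Q \<Longrightarrow> a \<in> below Q \<Longrightarrow> a \<in> K.ints"
  using L.idl_ints[OF L.max_idl] to_ac_L_ints by (auto simp: below_def)

lemma below_prime:
  assumes "L.maxidl Q" "a \<in> K.ints" "b \<in> K.ints" "a * b \<in> below Q"
  shows "a \<in> below Q \<or> b \<in> below Q"
  using L.maxidl_prime[OF assms(1), of "to_ac a" "to_ac b"] assms(2-) by (simp add: below_iff to_ac_L_ints)

lemma below_idl:
  assumes Q: "L.maxidl Q"
  shows "K.idl (below Q)"
proof (rule K.idlI)
  have I: "L.idl Q" by (rule L.max_idl[OF Q])
  show "below Q \<subseteq> K.ints" using below_ints[OF Q] by blast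
  show "0 \<in> below Q" using L.idl_0[OF I] by (simp add: below_iff)
  show "x + y \<in> below Q" if "x \<in> below Q" "y \<in> below Q" for x y
    using that L.idl_add[OF I] by (simp add: below_iff)
  show "r * x \<in> below Q" if "x \<in> below Q" "r \<in> K.ints" for x r
    using that L.idl_mult[OF I] by (simp add: below_iff to_ac_L_ints)
qed

text \<open>The contraction is prime and contains a nonzero rational integer. For a outside it the
  powers of a repeat, so some positive power of a is 1 modulo it, and an ideal containing a is
  everything.\<close>

lemma below_maxidl:
  assumes Q: "L.maxidl Q"
  shows "K.maxidl (below Q)"
  unfolding K.maxidl_def
proof (intro conjI allI impI)
  show I: "K.idl (below Q)" by (rule below_idl[OF Q])
  have one: "1 \<notin> below Q" using L.maxidl_one[OF Q] by (simp add: below_iff)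
  thus "below Q \<noteq> K.ints" using K.idl_one[OF I] by blast
  have "of_nat (fact (L.N Q)) \<in> below Q"
    using L.fact_norm_mem[OF L.max_nzidl[OF Q]] by (simp only: below_iff to_ac_of_nat)
  hence nz: "K.nzidl (below Q)" by (rule K.nzidlI[OF I]) simp
  fix J assume J: "K.idl J" "below Q \<subseteq> J"
  show "J = below Q \<or> J = K.ints"
  proof (cases "J = below Q")
    case False
    then obtain a where a: "a \<in> J" "a \<notin> below Q" using J(2) by blast
    have ai: "a \<in> K.ints" using K.idl_ints[OF J(1) a(1)] .
    obtain i j where ij: "i < j" "a ^ j - a ^ i \<in> below Q"
      using K.power_pigeonhole[OF nz, of "\<lambda>k. a ^ k"] K.ints_power[OF ai] by blast
    have pw: "a ^ k \<notin> below Q" for k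
    proof (induction k)
      case (Suc k)
      thus ?case using below_prime[OF Q ai K.ints_power[OF ai], of k] a(2) by auto
    qed (use one in simp)
    have "a ^ j - a ^ i = a ^ i * (a ^ (j - i) - 1)"
      using ij(1) by (simp add: right_diff_distrib power_add[symmetric])
    hence "a ^ (j - i) - 1 \<in> below Q"
      using below_prime[OF Q, of "a ^ i" "a ^ (j - i) - 1"] ij(2) pw[of i] ai
      by (auto intro: K.ints_power K.ints_diff K.ints_1)
    hence 1: "a ^ (j - i) - 1 \<in> J" using J(2) by blast
    obtain m where m: "j - i = Suc m" using ij(1) by (metis Suc_diff_Suc)
    have 2: "a ^ (j - i) \<in> J"
      using K.idl_mult_right[OF J(1) a(1) K.ints_power[OF ai], of m] by (simp add: m)
    have "a ^ (j - i) - (a ^ (j - i) - 1) \<in> J" by (rule K.idl_diff[OF J(1) 2 1])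
    thus ?thesis using K.idl_one[OF J(1)] by simp
  qed simp
qed

definition above :: "'k set \<Rightarrow> 'k alg_closure set set" where
  "above P = {Q. L.maxidl Q \<and> below Q = P}"

text \<open>With u an inverse of 2 D modulo P, the denominator disappears. One pair a, b serves all
  primes above P, which allows two of them to be compared.\<close>

lemma reduce_mod:
  assumes P: "K.maxidl P" "2 * D \<notin> P" and x: "x \<in> L.ints"
  shows "\<exists>a\<in>K.ints. \<exists>b\<in>K.ints. \<forall>Q\<in>above P. x - (to_ac a + to_ac b * w) \<in> Q"
proof -
  have DD: "2 * D \<in> K.ints" using K.ints_mult[OF K.ints_of_nat[of 2] D_ints] by simp
  obtain u p where u: "u \<in> K.ints" "p \<in> P" "u * (2 * D) + p = 1"
    using K.maxidl_unit_mod[OF P(1) DD P(2)] by blast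
  obtain a b where ab: "a \<in> K.ints" "b \<in> K.ints" "to_ac (2 * D) * x = to_ac a + to_ac b * w"
    using ints_scaled_rep[OF x] by blast
  have "x = to_ac (u * (2 * D) + p) * x" by (simp only: u(3) to_ac_1 mult_1_left)
  also have "\<dots> = to_ac u * (to_ac (2 * D) * x) + to_ac p * x"
    by (simp only: to_ac_add to_ac_mult distrib_right mult.assoc)
  also have "\<dots> = to_ac (u * a) + to_ac (u * b) * w + to_ac p * x"
    unfolding ab(3) by (simp add: algebra_simps)
  finally have "x - (to_ac (u * a) + to_ac (u * b) * w) = to_ac p * x" by (simp add: algebra_simps)
  moreover have "to_ac p * x \<in> Q" if "Q \<in> above P" for Q
  proof -
    have "to_ac p \<in> Q" "L.idl Q" using that u(2) L.max_idl by (auto simp: above_def below_def)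
    thus ?thesis using L.idl_mult_right x by blast
  qed
  moreover have "u * a \<in> K.ints" "u * b \<in> K.ints" using u ab by (auto intro: K.ints_mult)
  ultimately show ?thesis by metis
qed

text \<open>Since w is congruent to c modulo Q, the residue of x is that of a + b c in K. Hence Q is
  determined by c and has the same residue field as P.\<close>

lemma above_mem_iff:
  assumes Q: "Q \<in> above P" and c: "c \<in> K.ints" "w - to_ac c \<in> Q"
    and b: "b \<in> K.ints" and x: "x - (to_ac a + to_ac b * w) \<in> Q"
  shows "x \<in> Q \<longleftrightarrow> a + b * c \<in> P"
proof -
  have I: "L.idl Q" and P: "P = below Q" using Q L.max_idl by (auto simp: above_def)
  have "to_ac b * (w - to_ac c) \<in> Q" using L.idl_mult[OF I c(2)] b to_ac_L_ints by blast
  hence "(x - (to_ac a + to_ac b * w)) + to_ac b * (w - to_ac c) \<in> Q" by (rule L.idl_add[OF I x])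
  moreover have "(x - (to_ac a + to_ac b * w)) + to_ac b * (w - to_ac c) = x - to_ac (a + b * c)"
    by (simp add: algebra_simps)
  ultimately have d: "x - to_ac (a + b * c) \<in> Q" by simp
  show ?thesis
  proof
    assume "x \<in> Q"
    hence "x - (x - to_ac (a + b * c)) \<in> Q" using d by (rule L.idl_diff[OF I])
    thus "a + b * c \<in> P" unfolding P below_iff by simp
  next
    assume "a + b * c \<in> P"
    hence "(x - to_ac (a + b * c)) + to_ac (a + b * c) \<in> Q" unfolding P below_iff by (intro L.idl_add[OF I d])
    thus "x \<in> Q" by simp
  qed
qed

lemma above_unique_split:
  assumes P: "K.maxidl P" "2 * D \<notin> P" and c: "c \<in> K.ints"
    and Q: "Q \<in> above P" "w - to_ac c \<in> Q" and Q': "Q' \<in> above P" "w - to_ac c \<in> Q'"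
  shows "Q = Q'"
proof -
  have "x \<in> Q \<longleftrightarrow> x \<in> Q'" if x: "x \<in> L.ints" for x
  proof -
    obtain a b where ab: "b \<in> K.ints" "\<forall>Q\<in>above P. x - (to_ac a + to_ac b * w) \<in> Q"
      using reduce_mod[OF P x] by blast
    have "x \<in> Q \<longleftrightarrow> a + b * c \<in> P" by (rule above_mem_iff[OF Q(1) c Q(2) ab(1)]) (use ab(2) Q(1) in blast)
    moreover have "x \<in> Q' \<longleftrightarrow> a + b * c \<in> P" by (rule above_mem_iff[OF Q'(1) c Q'(2) ab(1)]) (use ab(2) Q'(1) in blast)
    ultimately show ?thesis by blast
  qed
  moreover have "Q \<subseteq> L.ints" "Q' \<subseteq> L.ints" using Q Q' L.max_idl L.idl_ints by (auto simp: above_def)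
  ultimately show ?thesis by blast
qed

lemma N_above_split:
  assumes P: "K.maxidl P" "2 * D \<notin> P" and c: "c \<in> K.ints" and Q: "Q \<in> above P" "w - to_ac c \<in> Q"
  shows "L.N Q = K.N P"
proof -
  have I: "L.idl Q" and below: "below Q = P" using Q L.max_idl by (auto simp: above_def)
  obtain R where R: "R \<subseteq> K.ints" "\<And>r r'. r \<in> R \<Longrightarrow> r' \<in> R \<Longrightarrow> r - r' \<in> P \<Longrightarrow> r = r'"
    "\<And>z. z \<in> K.ints \<Longrightarrow> \<exists>r\<in>R. z - r \<in> P" "K.N P = card R"
    using K.reps_exist[OF K.max_idl[OF P(1)]] by metis
  have "L.N Q = card (to_ac ` R)"
  proof (rule L.N_reps[OF _ I])
    show "to_ac ` R \<subseteq> L.ints" using R(1) to_ac_L_ints by blast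
    show "r = r'" if rr: "r \<in> to_ac ` R" "r' \<in> to_ac ` R" "r - r' \<in> Q" for r r'
    proof -
      obtain s s' where s: "s \<in> R" "s' \<in> R" "r = to_ac s" "r' = to_ac s'" using rr(1,2) by blast
      have "s - s' \<in> P" using rr(3) s unfolding below[symmetric] below_iff by simp
      thus ?thesis using R(2) s by blast
    qed
    show "\<exists>r\<in>to_ac ` R. z - r \<in> Q" if z: "z \<in> L.ints" for z
    proof -
      obtain a b where ab: "a \<in> K.ints" "b \<in> K.ints" "\<forall>Q\<in>above P. z - (to_ac a + to_ac b * w) \<in> Q"
        using reduce_mod[OF P z] by blast
      have "a + b * c \<in> K.ints" by (intro K.ints_add K.ints_mult ab c)
      then obtain r where r: "r \<in> R" "a + b * c - r \<in> P" using R(3) by blast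
      have "z - to_ac r \<in> Q \<longleftrightarrow> (a - r) + b * c \<in> P"
      proof (rule above_mem_iff[OF Q(1) c Q(2) ab(2)])
        have "z - (to_ac a + to_ac b * w) \<in> Q" using ab(3) Q(1) by blast
        thus "z - to_ac r - (to_ac (a - r) + to_ac b * w) \<in> Q" by (simp add: algebra_simps)
      qed
      thus ?thesis using r by (auto simp: algebra_simps)
    qed
  qed
  also have "\<dots> = card R" by (rule card_image) (simp add: inj_on_def)
  finally show ?thesis using R(4) by simp
qed

text \<open>\<open>Qc\<close> is the kernel of reduction modulo P with w sent to c: as 2 D is a unit
  modulo P, the element x = (a + b w) / (2 D) goes to 0 iff a + b c lies in P. It is enough that
  \<open>Qc\<close> is a proper ideal; a maximal ideal containing it lies above P.\<close>

lemma above_split_exists: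
  assumes P: "K.maxidl P" "2 * D \<notin> P" and c: "c \<in> K.ints" "c ^ 2 - D \<in> P"
  shows "\<exists>Q\<in>above P. w - to_ac c \<in> Q"
proof -
  have PP: "K.idl P" by (rule K.max_idl[OF P(1)])
  have DD: "2 * D \<in> K.ints" using K.ints_mult[OF K.ints_of_nat[of 2] D_ints] by simp
  define Qc where "Qc = {x \<in> L.ints. \<exists>a\<in>K.ints. \<exists>b\<in>K.ints. to_ac (2 * D) * x = to_ac a + to_ac b * w \<and> a + b * c \<in> P}"
  have QcI: "x \<in> Qc" if "x \<in> L.ints" "a \<in> K.ints" "b \<in> K.ints" "to_ac (2 * D) * x = to_ac a + to_ac b * w" "a + b * c \<in> P" for x a b
    using that unfolding Qc_def by blast
  have Qc: "L.idl Qc"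
  proof (rule L.idlI)
    show "Qc \<subseteq> L.ints" by (auto simp: Qc_def)
    show "0 \<in> Qc" by (rule QcI[of 0 0 0]) (auto intro: L.ints_0 K.ints_0 K.idl_0[OF PP])
    show "x + y \<in> Qc" if xy: "x \<in> Qc" "y \<in> Qc" for x y
    proof -
      obtain a b where x: "x \<in> L.ints" "a \<in> K.ints" "b \<in> K.ints" "to_ac (2 * D) * x = to_ac a + to_ac b * w" "a + b * c \<in> P"
        using xy(1) unfolding Qc_def by blast
      obtain a' b' where y: "y \<in> L.ints" "a' \<in> K.ints" "b' \<in> K.ints" "to_ac (2 * D) * y = to_ac a' + to_ac b' * w" "a' + b' * c \<in> P"
        using xy(2) unfolding Qc_def by blast
      show ?thesis
      proof (rule QcI)
        show "to_ac (2 * D) * (x + y) = to_ac (a + a') + to_ac (b + b') * w"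
          unfolding distrib_left x(4) y(4) by (simp add: algebra_simps)
        have "(a + b * c) + (a' + b' * c) \<in> P" by (rule K.idl_add[OF PP x(5) y(5)])
        thus "a + a' + (b + b') * c \<in> P" by (simp add: algebra_simps)
      qed (intro L.ints_add K.ints_add x y)+
    qed
    show "r * x \<in> Qc" if xr: "x \<in> Qc" "r \<in> L.ints" for x r
    proof -
      obtain a b where x: "x \<in> L.ints" "a \<in> K.ints" "b \<in> K.ints" "to_ac (2 * D) * x = to_ac a + to_ac b * w" "a + b * c \<in> P"
        using xr(1) unfolding Qc_def by blast
      obtain a' b' where r: "a' \<in> K.ints" "b' \<in> K.ints" "to_ac (2 * D) * r = to_ac a' + to_ac b' * w"
        using ints_scaled_rep[OF xr(2)] by blast
      obtain a'' b'' where rx: "a'' \<in> K.ints" "b'' \<in> K.ints" "to_ac (2 * D) * (r * x) = to_ac a'' + to_ac b'' * w"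
        using ints_scaled_rep[OF L.ints_mult[OF xr(2) x(1)]] by blast
      \<comment> \<open>Comparing coordinates of (2 D)^2 r x expresses those of the product by those
        of the factors, up to a factor 2 D. It is removed at the end because P is prime and does not
        contain 2 D.\<close>
      have "to_ac (2 * D * a'') + to_ac (2 * D * b'') * w = to_ac (2 * D) * (to_ac (2 * D) * (r * x))"
        unfolding rx(3) by (simp add: algebra_simps)
      also have "\<dots> = (to_ac (2 * D) * r) * (to_ac (2 * D) * x)" by (simp only: mult_ac)
      also have "\<dots> = to_ac (a' * a + b' * b * D) + to_ac (a' * b + b' * a) * w"
        unfolding r(3) x(4) by (rule rep_mult)
      finally have eq: "2 * D * a'' = a' * a + b' * b * D" "2 * D * b'' = a' * b + b' * a"
        using rep_unique by blast+
      have "2 * D * (a'' + b'' * c) = 2 * D * a'' + 2 * D * b'' * c" by (simp add: algebra_simps)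
      also have "\<dots> = (a' + b' * c) * (a + b * c) - (b' * b) * (c ^ 2 - D)"
        unfolding eq by (simp add: algebra_simps power2_eq_square)
      also have "\<dots> \<in> P"
        by (intro K.idl_diff[OF PP] K.idl_mult[OF PP] x c K.ints_add K.ints_mult r)
      finally have "a'' + b'' * c \<in> P"
        using K.maxidl_prime[OF P(1) DD, of "a'' + b'' * c"] P(2) rx(1,2) c(1) by (auto intro: K.ints_add K.ints_mult)
      thus ?thesis by (intro QcI[OF _ rx] L.ints_mult xr(2) x(1))
    qed
  qed
  have "1 \<notin> Qc"
  proof
    assume "1 \<in> Qc"
    then obtain a b where "to_ac (2 * D) * 1 = to_ac a + to_ac b * w" "a + b * c \<in> P" unfolding Qc_def by blast
    moreover have "to_ac (2 * D) * 1 = to_ac (2 * D) + to_ac 0 * w" by simp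
    ultimately have "to_ac (2 * D) + to_ac 0 * w = to_ac a + to_ac b * w" by metis
    hence "2 * D = a \<and> 0 = b" by (rule rep_unique)
    thus False using \<open>a + b * c \<in> P\<close> P(2) by auto
  qed
  have PQ: "to_ac p \<in> Qc" if p: "p \<in> P" for p
  proof (rule QcI)
    have pi: "p \<in> K.ints" using K.idl_ints[OF PP p] .
    show "to_ac p \<in> L.ints" "2 * D * p \<in> K.ints" "0 \<in> K.ints"
      using pi to_ac_L_ints K.ints_mult[OF DD pi] K.ints_0 by auto
    show "2 * D * p + 0 * c \<in> P" using K.idl_mult[OF PP p DD] by simp
  qed simp
  have wc: "w - to_ac c \<in> Qc"
  proof (rule QcI)
    show "w - to_ac c \<in> L.ints" using w_ints c(1) to_ac_L_ints by (intro L.ints_diff) auto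
    show "- (2 * D * c) \<in> K.ints" "2 * D \<in> K.ints" using K.ints_minus[OF K.ints_mult[OF DD c(1)]] DD by auto
    show "- (2 * D * c) + 2 * D * c \<in> P" using K.idl_0[OF PP] by simp
  qed (simp add: algebra_simps)
  have "L.nzidl Qc"
  proof (rule L.nzidlI[OF Qc wc])
    show "w - to_ac c \<noteq> 0" using w_notin[of c] by auto
  qed
  moreover have "Qc \<noteq> L.ints" using \<open>1 \<notin> Qc\<close> L.ints_1 by blast
  ultimately obtain Q where Q: "L.maxidl Q" "Qc \<subseteq> Q" using L.maxidl_exists by blast
  have "P \<subseteq> below Q" using PQ Q(2) by (auto simp: below_def)
  hence "P = below Q" by (rule K.maxidl_antisym[OF P(1) below_maxidl[OF Q(1)]])
  thus ?thesis using Q wc by (intro bexI[of _ Q]) (auto simp: above_def)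
qed

lemma above_split_distinct:
  assumes P: "K.maxidl P" "2 * D \<notin> P" and c: "c \<in> K.ints" "c ^ 2 - D \<in> P"
    and Q: "Q \<in> above P" "w - to_ac c \<in> Q" "w - to_ac (- c) \<in> Q"
  shows False
proof -
  have I: "L.idl Q" and below: "below Q = P" using Q L.max_idl by (auto simp: above_def)
  have "(w - to_ac (- c)) - (w - to_ac c) \<in> Q" by (rule L.idl_diff[OF I Q(3,2)])
  hence "2 * c \<in> P" unfolding below[symmetric] below_iff by simp
  thus False using K.double_root_notin[OF P c] by blast
qed

lemma above_split_cases:
  assumes c: "c \<in> K.ints" "c ^ 2 - D \<in> P" and Q: "Q \<in> above P"
  shows "w - to_ac c \<in> Q \<or> w - to_ac (- c) \<in> Q"
proof (rule L.maxidl_prime)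
  show "L.maxidl Q" using Q by (simp add: above_def)
  hence I: "L.idl Q" by (rule L.max_idl)
  have "(w - to_ac c) * (w - to_ac (- c)) = - to_ac (c ^ 2 - D)"
    by (simp add: algebra_simps ww power2_eq_square)
  moreover have "to_ac (c ^ 2 - D) \<in> Q" using c(2) Q by (auto simp: above_def below_def)
  ultimately show "(w - to_ac c) * (w - to_ac (- c)) \<in> Q" using L.idl_minus[OF I] by metis
  show "w - to_ac c \<in> L.ints" "w - to_ac (- c) \<in> L.ints"
    using w_ints c(1) K.ints_minus[OF c(1)] to_ac_L_ints by (auto intro!: L.ints_diff simp del: to_ac_minus)
qed

text \<open>If b were invertible modulo P, then w would be congruent to c = - a / b modulo Q, and D
  would be the square of c modulo P.\<close>

lemma inert_mem:
  assumes P: "K.maxidl P" and ns: "\<And>c. c \<in> K.ints \<Longrightarrow> c ^ 2 - D \<notin> P"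
    and Q: "Q \<in> above P" and ab: "a \<in> K.ints" "b \<in> K.ints" "to_ac a + to_ac b * w \<in> Q"
  shows "a \<in> P \<and> b \<in> P"
proof -
  have I: "L.idl Q" and below: "below Q = P" using Q L.max_idl by (auto simp: above_def)
  have PP: "K.idl P" by (rule K.max_idl[OF P])
  have b: "b \<in> P"
  proof (rule ccontr)
    assume "b \<notin> P"
    then obtain u p where u: "u \<in> K.ints" "p \<in> P" "u * b + p = 1"
      using K.maxidl_unit_mod[OF P ab(2)] by blast
    have pQ: "to_ac p \<in> Q" using u(2) unfolding below[symmetric] below_iff .
    define c where "c = - (u * a)"
    have c: "c \<in> K.ints" unfolding c_def by (intro K.ints_minus K.ints_mult u ab)
    have "w - to_ac c = to_ac (u * b + p) * w - to_ac c" by (simp only: u(3) to_ac_1 mult_1_left)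
    also have "\<dots> = to_ac u * (to_ac a + to_ac b * w) + to_ac p * w"
      by (simp add: c_def algebra_simps)
    also have "\<dots> \<in> Q"
      using u(1) to_ac_L_ints by (intro L.idl_add[OF I] L.idl_mult[OF I ab(3)] L.idl_mult_right[OF I pQ w_ints]) auto
    finally have wc: "w - to_ac c \<in> Q" .
    have "(w + to_ac c) * (w - to_ac c) \<in> Q"
      using w_ints c to_ac_L_ints by (intro L.idl_mult[OF I wc] L.ints_add) auto
    hence "- ((w + to_ac c) * (w - to_ac c)) \<in> Q" by (rule L.idl_minus[OF I])
    moreover have "- ((w + to_ac c) * (w - to_ac c)) = to_ac (c ^ 2 - D)"
      by (simp add: algebra_simps ww power2_eq_square)
    ultimately have "c ^ 2 - D \<in> P" unfolding below[symmetric] below_iff by simp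
    thus False using ns[OF c] by blast
  qed
  hence "to_ac b * w \<in> Q"
    unfolding below[symmetric] below_iff by (rule L.idl_mult_right[OF I _ w_ints])
  hence "(to_ac a + to_ac b * w) - to_ac b * w \<in> Q" by (rule L.idl_diff[OF I ab(3)])
  thus ?thesis using b unfolding below[symmetric] below_iff by simp
qed

lemma above_unique_inert:
  assumes P: "K.maxidl P" "2 * D \<notin> P" and ns: "\<And>c. c \<in> K.ints \<Longrightarrow> c ^ 2 - D \<notin> P"
    and Q: "Q \<in> above P" "Q' \<in> above P"
  shows "Q \<subseteq> Q'"
proof
  fix x assume x: "x \<in> Q"
  have I: "L.idl Q" "L.idl Q'" and below: "below Q' = P" using Q L.max_idl by (auto simp: above_def)
  obtain a b where ab: "a \<in> K.ints" "b \<in> K.ints" "\<forall>Q\<in>above P. x - (to_ac a + to_ac b * w) \<in> Q"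
    using reduce_mod[OF P L.idl_ints[OF I(1) x]] by blast
  have "x - (to_ac a + to_ac b * w) \<in> Q" using ab(3) Q(1) by blast
  hence "x - (x - (to_ac a + to_ac b * w)) \<in> Q" by (rule L.idl_diff[OF I(1) x])
  hence "to_ac a + to_ac b * w \<in> Q" by simp
  hence "a \<in> P \<and> b \<in> P" using inert_mem[OF P(1) ns Q(1) ab(1,2)] by simp
  hence "to_ac a \<in> Q'" "to_ac b \<in> Q'" unfolding below[symmetric] below_iff by auto
  hence 1: "to_ac a + to_ac b * w \<in> Q'"
    by (rule L.idl_add[OF I(2) _ L.idl_mult_right[OF I(2) _ w_ints]])
  have "x - (to_ac a + to_ac b * w) \<in> Q'" using ab(3) Q(2) by blast
  hence "(x - (to_ac a + to_ac b * w)) + (to_ac a + to_ac b * w) \<in> Q'"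
    using 1 by (rule L.idl_add[OF I(2)])
  thus "x \<in> Q'" by simp
qed

text \<open>The elements a + b w with a, b running modulo P are pairwise incongruent modulo Q. The
  inequality is all that is needed to bound the weight of Q by the square of that of P.\<close>

lemma N_above_inert:
  assumes P: "K.maxidl P" and ns: "\<And>c. c \<in> K.ints \<Longrightarrow> c ^ 2 - D \<notin> P" and Q: "Q \<in> above P"
  shows "K.N P ^ 2 \<le> L.N Q"
proof -
  have mQ: "L.maxidl Q" and I: "L.idl Q" using Q L.max_idl by (auto simp: above_def)
  obtain R where R: "R \<subseteq> K.ints" "\<And>r r'. r \<in> R \<Longrightarrow> r' \<in> R \<Longrightarrow> r - r' \<in> P \<Longrightarrow> r = r'"
    "K.N P = card R"
    using K.reps_exist[OF K.max_idl[OF P]] by metis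
  define f where "f = (\<lambda>(a, b). L.residue Q (to_ac a + to_ac b * w))"
  have "inj_on f (R \<times> R)"
  proof (rule inj_onI)
    fix u v assume uv: "u \<in> R \<times> R" "v \<in> R \<times> R" "f u = f v"
    obtain a b a' b' where *: "u = (a, b)" "v = (a', b')" by (cases u, cases v) blast
    have mem: "a \<in> R" "b \<in> R" "a' \<in> R" "b' \<in> R" using uv * by auto
    have "(to_ac a + to_ac b * w) - (to_ac a' + to_ac b' * w) \<in> Q"
      using uv(3) L.residue_eq_iff[OF I] by (simp add: f_def *)
    hence "to_ac (a - a') + to_ac (b - b') * w \<in> Q" by (simp add: algebra_simps)
    moreover have "a - a' \<in> K.ints" "b - b' \<in> K.ints" using mem R(1) by (auto intro: K.ints_diff)
    ultimately have "a - a' \<in> P \<and> b - b' \<in> P" using inert_mem[OF P ns Q] by blast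
    thus "u = v" using R(2) mem * by blast
  qed
  moreover have "f ` (R \<times> R) \<subseteq> L.residue Q ` L.ints"
    using R(1) to_ac_L_ints w_ints by (auto simp: f_def intro!: imageI L.ints_add L.ints_mult)
  ultimately have "card (R \<times> R) \<le> card (L.residue Q ` L.ints)"
    using L.finite_quotient[OF L.max_nzidl[OF mQ]] by (intro card_inj_on_le)
  thus ?thesis unfolding L.N_def R(3) by (simp add: card_cartesian_product power2_eq_square)
qed

end

section \<open>The sum over the split primes\<close>

context quadratic_extension
begin

definition split_primes :: "'k set set" where
  "split_primes = {P. K.maxidl P \<and> 2 * D \<notin> P \<and> (\<exists>c\<in>K.ints. c ^ 2 - D \<in> P)}"

lemma two_D: "2 * D \<in> K.ints" "2 * D \<noteq> 0"
proof -
  show "2 * D \<in> K.ints" using K.ints_mult[OF K.ints_of_nat[of 2] D_ints] by simp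
  have "D \<noteq> 0" using nonsquare[of 0] by auto
  thus "2 * D \<noteq> 0" by simp
qed

lemma split_prime_pair:
  assumes "P \<in> split_primes"
  shows "\<exists>Q Q'. Q \<noteq> Q' \<and> above P = {Q, Q'} \<and> L.N Q = K.N P \<and> L.N Q' = K.N P"
proof -
  obtain c where P: "K.maxidl P" "2 * D \<notin> P" and c: "c \<in> K.ints" "c ^ 2 - D \<in> P"
    using assms by (auto simp: split_primes_def)
  have c': "- c \<in> K.ints" "(- c) ^ 2 - D \<in> P" using c K.ints_minus by auto
  obtain Q where Q: "Q \<in> above P" "w - to_ac c \<in> Q" using above_split_exists[OF P c] by blast
  obtain Q' where Q': "Q' \<in> above P" "w - to_ac (- c) \<in> Q'" using above_split_exists[OF P c'] by blast
  have "Q \<noteq> Q'" using above_split_distinct[OF P c Q] Q'(2) by blast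
  moreover have "R = Q \<or> R = Q'" if R: "R \<in> above P" for R
    using above_split_cases[OF c R] above_unique_split[OF P c(1) R _ Q]
      above_unique_split[OF P c'(1) R _ Q'] by blast
  hence "above P = {Q, Q'}" using Q(1) Q'(1) by (intro equalityI subsetI) auto
  ultimately show ?thesis
    using N_above_split[OF P c(1) Q] N_above_split[OF P c'(1) Q']
    by (intro exI[of _ Q] exI[of _ Q'] conjI)
qed

text \<open>
  A split prime has two primes above it, both of the same norm; the remaining primes of \<open>L\<close>
  contribute a bounded amount, because they are finite in number or have large norm.
\<close>
lemma split_prime_sum:
  "\<exists>C. \<forall>s. 1 < s \<longrightarrow> s \<le> 2 \<longrightarrow> \<bar>2 * (\<Sum>\<^sub>\<infinity>P\<in>split_primes. K.wt s P) + ln (s - 1)\<bar> \<le> C"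
proof -
  obtain C1 where C1: "\<And>s. 1 < s \<Longrightarrow> s \<le> 2 \<Longrightarrow> \<bar>(\<Sum>\<^sub>\<infinity>Q\<in>{Q. L.maxidl Q}. L.wt s Q) + ln (s - 1)\<bar> \<le> C1"
    using L.prime_sum_asymptotic by blast
  obtain C2 where C2: "\<And>s (T :: 'k set set). 1 < s \<Longrightarrow> s \<le> 2 \<Longrightarrow> finite T \<Longrightarrow> \<forall>P\<in>T. K.maxidl P \<Longrightarrow>
      (\<Sum>P\<in>T. (K.wt s P)\<^sup>2) \<le> C2"
    using K.prime_square_sum_bounded by blast
  define Bad where "Bad = {Q. L.maxidl Q \<and> 2 * D \<in> below Q}"
  define Inert where "Inert = {Q. L.maxidl Q \<and> 2 * D \<notin> below Q \<and> below Q \<notin> split_primes}"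
  define Split where "Split = {Q. L.maxidl Q \<and> below Q \<in> split_primes}"
  have Bad: "finite Bad"
  proof (rule finite_subset)
    show "Bad \<subseteq> {J. L.idl J \<and> to_ac (2 * D) \<in> J}" by (auto simp: Bad_def below_def L.max_idl)
    show "finite {J. L.idl J \<and> to_ac (2 * D) \<in> J}"
      using two_D to_ac_L_ints by (intro L.finite_ideals_containing) (auto simp del: to_ac_mult)
  qed
  obtain g h where gh: "\<And>P. P \<in> split_primes \<Longrightarrow> g P \<noteq> h P \<and> above P = {g P, h P} \<and> L.N (g P) = K.N P \<and> L.N (h P) = K.N P"
    using split_prime_pair by metis
  have mem: "g P \<in> above P" "h P \<in> above P" if "P \<in> split_primes" for P using gh[OF that] by auto
  have bg: "below (g P) = P" "below (h P) = P" if "P \<in> split_primes" for P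
    using mem[OF that] by (auto simp: above_def)
  have inj: "inj_on g split_primes" "inj_on h split_primes"
    by (rule inj_on_inverseI[of _ below], rule bg, assumption)+
  have Split: "Split = g ` split_primes \<union> h ` split_primes"
  proof
    show "Split \<subseteq> g ` split_primes \<union> h ` split_primes"
    proof
      fix Q assume "Q \<in> Split"
      hence "below Q \<in> split_primes" "Q \<in> above (below Q)" by (auto simp: Split_def above_def)
      thus "Q \<in> g ` split_primes \<union> h ` split_primes" using gh[of "below Q"] by auto
    qed
    show "g ` split_primes \<union> h ` split_primes \<subseteq> Split"
      using mem bg by (auto simp: Split_def above_def)
  qed
  have disj: "g ` split_primes \<inter> h ` split_primes = {}"
  proof -
    have False if "P \<in> split_primes" "P' \<in> split_primes" "g P = h P'" for P P'
    proof -
      have "P = P'" using bg(1)[OF that(1)] bg(2)[OF that(2)] that(3) by simp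
      thus False using gh[OF that(1)] that(3) by simp
    qed
    thus ?thesis by blast
  qed
  have all: "{Q. L.maxidl Q} = (Bad \<union> Inert) \<union> Split" "(Bad \<union> Inert) \<inter> Split = {}" "Bad \<inter> Inert = {}"
    by (auto simp: Bad_def Inert_def Split_def split_primes_def)
  have "\<bar>2 * (\<Sum>\<^sub>\<infinity>P\<in>split_primes. K.wt s P) + ln (s - 1)\<bar> \<le> C1 + (real (card Bad) + C2)" if s: "1 < s" "s \<le> 2" for s
  proof -
    have summ: "L.wt s summable_on Z" if Z: "Z \<subseteq> {Q. L.maxidl Q}" for Z
      by (rule L.prime_sum_summable[OF s Z])
    have sSplit: "(\<Sum>\<^sub>\<infinity>Q\<in>Split. L.wt s Q) = 2 * (\<Sum>\<^sub>\<infinity>P\<in>split_primes. K.wt s P)"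
    proof -
      have "(\<Sum>\<^sub>\<infinity>Q\<in>Split. L.wt s Q) = (\<Sum>\<^sub>\<infinity>Q\<in>g ` split_primes. L.wt s Q) + (\<Sum>\<^sub>\<infinity>Q\<in>h ` split_primes. L.wt s Q)"
        unfolding Split by (rule infsum_Un_disjoint[OF summ summ disj]) (use Split Split_def in blast)+
      also have "(\<Sum>\<^sub>\<infinity>Q\<in>g ` split_primes. L.wt s Q) = (\<Sum>\<^sub>\<infinity>P\<in>split_primes. K.wt s P)"
        unfolding infsum_reindex[OF inj(1)] using gh by (intro infsum_cong) (simp add: L.wt_def K.wt_def)
      also have "(\<Sum>\<^sub>\<infinity>Q\<in>h ` split_primes. L.wt s Q) = (\<Sum>\<^sub>\<infinity>P\<in>split_primes. K.wt s P)"
        unfolding infsum_reindex[OF inj(2)] using gh by (intro infsum_cong) (simp add: L.wt_def K.wt_def)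
      finally show ?thesis by simp
    qed
    have "(\<Sum>\<^sub>\<infinity>Q\<in>{Q. L.maxidl Q}. L.wt s Q) = (\<Sum>\<^sub>\<infinity>Q\<in>Bad \<union> Inert. L.wt s Q) + (\<Sum>\<^sub>\<infinity>Q\<in>Split. L.wt s Q)"
      unfolding all(1) by (rule infsum_Un_disjoint[OF summ summ all(2)]) (use all(1) in blast)+
    also have "(\<Sum>\<^sub>\<infinity>Q\<in>Bad \<union> Inert. L.wt s Q) = (\<Sum>\<^sub>\<infinity>Q\<in>Bad. L.wt s Q) + (\<Sum>\<^sub>\<infinity>Q\<in>Inert. L.wt s Q)"
      by (rule infsum_Un_disjoint[OF summ summ all(3)]) (use all(1) in blast)+
    finally have tot: "(\<Sum>\<^sub>\<infinity>Q\<in>{Q. L.maxidl Q}. L.wt s Q)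
        = (\<Sum>\<^sub>\<infinity>Q\<in>Bad. L.wt s Q) + (\<Sum>\<^sub>\<infinity>Q\<in>Inert. L.wt s Q) + 2 * (\<Sum>\<^sub>\<infinity>P\<in>split_primes. K.wt s P)"
      unfolding sSplit .
    have le1: "L.wt s Q \<le> 1" if "L.maxidl Q" for Q
      using L.wt_prime_le_half[OF that, of s] s by simp
    have "(\<Sum>\<^sub>\<infinity>Q\<in>Bad. L.wt s Q) = (\<Sum>Q\<in>Bad. L.wt s Q)" using Bad by simp
    also have "\<dots> \<le> (\<Sum>Q\<in>Bad. 1)" using le1 by (intro sum_mono) (simp add: Bad_def)
    finally have bad: "(\<Sum>\<^sub>\<infinity>Q\<in>Bad. L.wt s Q) \<le> real (card Bad)" by simp
    have sI: "Inert \<subseteq> {Q. L.maxidl Q}" by (auto simp: Inert_def)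
    have inert: "(\<Sum>\<^sub>\<infinity>Q\<in>Inert. L.wt s Q) \<le> C2"
    proof (rule infsum_le_finite_sums[OF summ[OF sI]])
      fix T assume T: "finite T" "T \<subseteq> Inert"
      have ns: "c ^ 2 - D \<notin> below Q" if "Q \<in> Inert" "c \<in> K.ints" for Q c
        using that below_maxidl by (auto simp: Inert_def split_primes_def)
      have ab: "Q \<in> above (below Q)" "K.maxidl (below Q)" "2 * D \<notin> below Q" if "Q \<in> Inert" for Q
        using that below_maxidl by (auto simp: Inert_def above_def)
      have injb: "inj_on below T"
      proof (rule inj_onI)
        fix Q Q' assume Q: "Q \<in> T" "Q' \<in> T" "below Q = below Q'"
        have QI: "Q \<in> Inert" "Q' \<in> Inert" using Q T(2) by auto
        have "Q' \<in> above (below Q)" using ab(1)[OF QI(2)] Q(3) by simp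
        thus "Q = Q'"
          using above_unique_inert[OF ab(2,3)[OF QI(1)] ns[OF QI(1)]] ab(1)[OF QI(1)] by blast
      qed
      have "(\<Sum>Q\<in>T. L.wt s Q) \<le> (\<Sum>Q\<in>T. (K.wt s (below Q))\<^sup>2)"
      proof (rule sum_mono)
        fix Q assume "Q \<in> T"
        hence Q: "Q \<in> Inert" using T by blast
        have "K.N (below Q) ^ 2 \<le> L.N Q" by (rule N_above_inert[OF ab(2)[OF Q] ns[OF Q] ab(1)[OF Q]])
        hence "real (K.N (below Q)) ^ 2 \<le> real (L.N Q)" by (simp only: of_nat_power[symmetric] of_nat_le_iff)
        moreover have pos: "real (K.N (below Q)) > 0" using K.maxidl_N_ge_2[OF ab(2)[OF Q]] by simp
        ultimately have "real (L.N Q) powr (- s) \<le> (real (K.N (below Q)) ^ 2) powr (- s)"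
          using s by (intro powr_mono2') auto
        also have "\<dots> = (real (K.N (below Q)) powr (- s))\<^sup>2"
          using pos by (simp add: power2_eq_square powr_mult)
        finally show "L.wt s Q \<le> (K.wt s (below Q))\<^sup>2" by (simp add: L.wt_def K.wt_def)
      qed
      also have "\<dots> = (\<Sum>P\<in>below ` T. (K.wt s P)\<^sup>2)" by (simp add: sum.reindex[OF injb])
      also have "\<dots> \<le> C2" using T ab(2) by (intro C2[OF s]) auto
      finally show "(\<Sum>Q\<in>T. L.wt s Q) \<le> C2" .
    qed
    have "(\<Sum>\<^sub>\<infinity>Q\<in>Bad. L.wt s Q) \<ge> 0" "(\<Sum>\<^sub>\<infinity>Q\<in>Inert. L.wt s Q) \<ge> 0"
      by (intro infsum_nonneg L.wt_nonneg)+
    thus ?thesis using C1[OF s] tot bad inert by linarith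
  qed
  thus ?thesis by blast
qed

lemma filterlim_minus_ln_at_right_1: "filterlim (\<lambda>s::real. - ln (s - 1)) at_top (at_right 1)"
proof -
  have "filterlim (\<lambda>s::real. s - 1) (at_right 0) (at_right 1)"
    unfolding filterlim_at_right_to_0[of _ _ 1] by (simp add: filterlim_ident)
  from filterlim_compose[OF ln_at_0 this] show ?thesis
    by (subst filterlim_uminus_at_bot[symmetric])
qed

lemma split_sum_quotient:
  "((\<lambda>s. (\<Sum>\<^sub>\<infinity>P\<in>split_primes. K.wt s P) / (- ln (s - 1))) \<longlongrightarrow> 1 / 2) (at_right 1)"
proof -
  obtain C where C: "\<And>s. 1 < s \<Longrightarrow> s \<le> 2 \<Longrightarrow> \<bar>2 * (\<Sum>\<^sub>\<infinity>P\<in>split_primes. K.wt s P) + ln (s - 1)\<bar> \<le> C"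
    using split_prime_sum by blast
  note lnlim = filterlim_minus_ln_at_right_1
  have lim0: "((\<lambda>s. C / (2 * (- ln (s - 1)))) \<longlongrightarrow> 0) (at_right 1)"
    by (intro tendsto_divide_0[OF tendsto_const] filterlim_at_top_imp_at_infinity
        filterlim_tendsto_pos_mult_at_top[OF tendsto_const _ lnlim]) simp
  have ev: "\<forall>\<^sub>F s in at_right 1. norm ((\<Sum>\<^sub>\<infinity>P\<in>split_primes. K.wt s P) / (- ln (s - 1)) - 1 / 2)
      \<le> C / (2 * (- ln (s - 1)))"
  proof -
    have "\<forall>\<^sub>F s in at_right (1::real). s \<in> {1<..<2}" by (rule eventually_at_right_real) simp
    thus ?thesis
    proof eventually_elim
      case (elim s)
      define l where "l = - ln (s - 1)"
      have l: "l > 0" unfolding l_def using elim by simp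
      let ?S = "\<Sum>\<^sub>\<infinity>P\<in>split_primes. K.wt s P"
      have "?S / l - 1 / 2 = (2 * ?S - l) / (2 * l)" using l by (simp add: field_simps)
      also have "norm \<dots> = \<bar>2 * ?S - l\<bar> / (2 * l)" using l by simp
      also have "\<dots> \<le> C / (2 * l)"
        using C[of s] elim l by (intro divide_right_mono) (auto simp: l_def)
      finally show ?case by (simp add: l_def)
    qed
  qed
  have "((\<lambda>s. (\<Sum>\<^sub>\<infinity>P\<in>split_primes. K.wt s P) / (- ln (s - 1)) - 1 / 2) \<longlongrightarrow> 0) (at_right 1)"
  proof (rule tendsto_0_le[OF lim0])
    show "\<forall>\<^sub>F s in at_right 1. norm ((\<Sum>\<^sub>\<infinity>P\<in>split_primes. K.wt s P) / (- ln (s - 1)) - 1 / 2)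
        \<le> norm (C / (2 * (- ln (s - 1)))) * 1"
      using ev by (rule eventually_mono) (rule order_trans, assumption, simp only: real_norm_def mult_1_right abs_ge_self)
  qed
  thus ?thesis by (rule LIM_zero_cancel)
qed

text \<open>If almost all primes were split, their sum would be both \<open>L/2 + O(1)\<close> and
  \<open>L + O(1)\<close> with \<open>L = - ln (s - 1)\<close> unbounded.\<close>
lemma nonsplit_infinite: "infinite ({P. K.maxidl P} - split_primes)"
proof
  assume fin: "finite ({P. K.maxidl P} - split_primes)"
  obtain C where C: "\<And>s. 1 < s \<Longrightarrow> s \<le> 2 \<Longrightarrow> \<bar>2 * (\<Sum>\<^sub>\<infinity>P\<in>split_primes. K.wt s P) + ln (s - 1)\<bar> \<le> C"
    using split_prime_sum by blast
  obtain C1 where C1: "\<And>s. 1 < s \<Longrightarrow> s \<le> 2 \<Longrightarrow> \<bar>(\<Sum>\<^sub>\<infinity>P\<in>{P::'k set. K.maxidl P}. K.wt s P) + ln (s - 1)\<bar> \<le> C1"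
    using K.prime_sum_asymptotic by blast
  define R where "R = {P. K.maxidl P} - split_primes"
  define S where "S s = (\<Sum>\<^sub>\<infinity>P\<in>split_primes. K.wt s P)" for s
  define A where "A s = (\<Sum>\<^sub>\<infinity>P\<in>{P::'k set. K.maxidl P}. K.wt s P)" for s
  define r where "r = real (card R)"
  \<comment> \<open>M will be - ln (s - 1). The estimates imply M \<le> C + 2 C1 + 2 r, and this
    value exceeds that bound.\<close>
  define M where "M = 2 * (C + C1 + r) + 1"
  have C0: "C \<ge> 0" using order_trans[OF abs_ge_zero C[of 2]] by simp
  have C10: "C1 \<ge> 0" using order_trans[OF abs_ge_zero C1[of 2]] by simp
  have M: "M \<ge> 1" unfolding M_def using C0 C10 by (simp add: r_def)
  define s where "s = 1 + exp (- M)"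
  have s: "1 < s" "s \<le> 2" using M by (auto simp: s_def)
  have ln: "ln (s - 1) = - M" by (simp add: s_def)
  have sub: "split_primes \<subseteq> {P. K.maxidl P}" by (auto simp: split_primes_def)
  have un: "{P. K.maxidl P} = R \<union> split_primes" using sub by (auto simp: R_def)
  have RP: "R \<subseteq> {P. K.maxidl P}" by (auto simp: R_def)
  have "A s = (\<Sum>\<^sub>\<infinity>P\<in>R. K.wt s P) + S s"
    unfolding A_def S_def un
    by (rule infsum_Un_disjoint[OF K.prime_sum_summable[OF s RP] K.prime_sum_summable[OF s sub]])
       (auto simp: R_def)
  also have "(\<Sum>\<^sub>\<infinity>P\<in>R. K.wt s P) = (\<Sum>P\<in>R. K.wt s P)" using fin by (simp add: R_def)
  also have "\<dots> \<le> (\<Sum>P\<in>R. 1)"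
  proof (rule sum_mono)
    fix P assume "P \<in> R"
    thus "K.wt s P \<le> 1" using K.wt_prime_le_half[of P s] s by (simp add: R_def)
  qed
  finally have "A s \<le> r + S s" by (simp add: r_def)
  moreover have "\<bar>2 * S s - M\<bar> \<le> C" using C[OF s] ln by (simp add: S_def)
  moreover have "\<bar>A s - M\<bar> \<le> C1" using C1[OF s] ln by (simp add: A_def)
  ultimately have 1: "A s \<le> r + S s" "2 * S s - M \<le> C" "M - A s \<le> C1" by linarith+
  hence "2 * M \<le> 2 * C1 + 2 * r + C + M" by linarith
  hence "M \<le> 2 * C1 + 2 * r + C" by linarith
  hence "2 * C + 2 * C1 + 2 * r + 1 \<le> 2 * C1 + 2 * r + C" by (simp add: M_def)
  hence "C + 1 \<le> 0" by simp
  thus False using C0 by simp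
qed

end

section \<open>The valuation of a prime\<close>

lemma iprod_left_comm: "iprod A (iprod B C) = iprod B (iprod A C)"
  by (simp only: iprod_assoc[symmetric] iprod_comm[of A B])

context number_subfield
begin

primrec ipow :: "'a set \<Rightarrow> nat \<Rightarrow> 'a set" where
  "ipow P 0 = ints"
| "ipow P (Suc n) = iprod (ipow P n) P"

context
  fixes P assumes P: "maxidl P"
begin

lemma ipow_nzidl: "nzidl (ipow P n)"
  by (induction n) (auto intro: ints_nzidl iprod_nzidl max_nzidl[OF P])

lemma ipow_idl: "idl (ipow P n)"
  by (rule nz_idl[OF ipow_nzidl])

lemma ipow_add: "ipow P (m + n) = iprod (ipow P m) (ipow P n)"
proof (induction n)
  case 0
  show ?case using iprod_ints[OF ipow_idl] iprod_comm by (metis add_0_right ipow.simps(1))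
next
  case (Suc n)
  thus ?case by (simp add: iprod_assoc)
qed

lemma ipow_antimono: "m \<le> n \<Longrightarrow> ipow P n \<subseteq> ipow P m"
  using iprod_subset_left[OF ipow_idl ipow_idl, of m "n - m"] ipow_add[of m "n - m"] by simp

lemma ipow_1: "ipow P (Suc 0) = P"
  using iprod_ints[OF max_idl[OF P]] by simp

lemma N_ipow: "N (ipow P n) = N P ^ n"
  by (induction n) (simp_all add: N_ints N_mult ipow_nzidl max_nzidl[OF P])

text \<open>Compares norms: n < 2^n \<le> (N P)^n \<le> N (a). The bound makes the greatest exponent
  in \<open>ord\<close> exist.\<close>

lemma ipow_bound:
  assumes "a \<in> ipow P n" "a \<noteq> 0"
  shows "n \<le> N (principal a)"
proof -
  have ai: "a \<in> ints" using idl_ints[OF ipow_idl assms(1)] .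
  have "principal a \<subseteq> ipow P n" by (rule principal_subset[OF ipow_idl assms(1)])
  hence "principal a = ipow P n \<or> principal a \<subset> ipow P n" by blast
  hence "N (ipow P n) \<le> N (principal a)"
    using N_less[OF principal_nzidl[OF ai assms(2)] ipow_idl, of n] by (elim disjE) auto
  moreover have "n < 2 ^ n" by (rule less_exp)
  moreover have "2 ^ n \<le> N P ^ n" using maxidl_N_ge_2[OF P] by (rule power_mono) simp
  ultimately show ?thesis unfolding N_ipow by linarith
qed

definition ord :: "'a \<Rightarrow> nat" where "ord a = (GREATEST n. a \<in> ipow P n)"

lemma ord_iff:
  assumes "a \<in> ints" "a \<noteq> 0"
  shows "a \<in> ipow P n \<longleftrightarrow> n \<le> ord a"
proof -
  have b: "\<And>y. a \<in> ipow P y \<Longrightarrow> y \<le> N (principal a)" using ipow_bound assms(2) by blast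
  have z: "a \<in> ipow P 0" using assms(1) by simp
  have mem: "a \<in> ipow P (ord a)"
    unfolding ord_def by (rule GreatestI_nat[where P = "\<lambda>n. a \<in> ipow P n", OF z b])
  show ?thesis
  proof
    assume "a \<in> ipow P n"
    thus "n \<le> ord a" unfolding ord_def by (rule Greatest_le_nat[where P = "\<lambda>n. a \<in> ipow P n", OF _ b])
  next
    assume "n \<le> ord a"
    thus "a \<in> ipow P n" using ipow_antimono mem by blast
  qed
qed

lemma principal_factor:
  assumes "a \<in> ints" "a \<noteq> 0"
  obtains A where "nzidl A" "principal a = iprod (ipow P (ord a)) A" "\<not> A \<subseteq> P"
proof -
  have "a \<in> ipow P (ord a)" using ord_iff[OF assms] by simp
  then obtain A where A: "nzidl A" "principal a = iprod (ipow P (ord a)) A"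
    using contains_imp_divides[OF ipow_nzidl principal_nzidl[OF assms] principal_subset[OF ipow_idl]] by blast
  have "\<not> A \<subseteq> P"
  proof
    assume "A \<subseteq> P"
    hence "principal a \<subseteq> ipow P (Suc (ord a))" unfolding A(2) ipow.simps by (intro iprod_mono order_refl)
    hence "a \<in> ipow P (Suc (ord a))" using principal_self by blast
    hence "Suc (ord a) \<le> ord a" using ord_iff[OF assms] by blast
    thus False by simp
  qed
  thus ?thesis using that A by blast
qed

text \<open>The cofactors A and B of a and b are not contained in P, so neither is their product. A
  higher exponent for a b would, after cancelling the power of P, put that product into P.\<close>

lemma ord_mult:
  assumes a: "a \<in> ints" "a \<noteq> 0" and b: "b \<in> ints" "b \<noteq> 0"
  shows "ord (a * b) = ord a + ord b"
proof -
  have ab: "a * b \<in> ints" "a * b \<noteq> 0" using a b ints_mult by auto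
  have "a * b \<in> ipow P (ord a + ord b)"
    unfolding ipow_add using ord_iff[OF a] ord_iff[OF b] by (intro iprod.prod) auto
  hence 1: "ord a + ord b \<le> ord (a * b)" using ord_iff[OF ab] by blast
  have "\<not> Suc (ord a + ord b) \<le> ord (a * b)"
  proof
    assume "Suc (ord a + ord b) \<le> ord (a * b)"
    hence "a * b \<in> ipow P (Suc (ord a + ord b))" using ord_iff[OF ab] by blast
    hence sub: "principal (a * b) \<subseteq> ipow P (Suc (ord a + ord b))" by (rule principal_subset[OF ipow_idl])
    obtain A where A: "nzidl A" "principal a = iprod (ipow P (ord a)) A" "\<not> A \<subseteq> P"
      using principal_factor[OF a] .
    obtain B where B: "nzidl B" "principal b = iprod (ipow P (ord b)) B" "\<not> B \<subseteq> P"
      using principal_factor[OF b] .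
    have AB: "nzidl (iprod A B)" by (rule iprod_nzidl[OF A(1) B(1)])
    have "iprod (principal a) (principal b) \<subseteq> principal (a * b)"
    proof (rule iprod_subsetI)
      fix i j assume "i \<in> principal a" "j \<in> principal b"
      then obtain r s where rs: "r \<in> ints" "s \<in> ints" "i = a * r" "j = b * s" by (auto simp: principal_def)
      have "i * j = (a * b) * (r * s)" using rs by (simp add: mult_ac)
      thus "i * j \<in> principal (a * b)" using principalI[OF ints_mult[OF rs(1,2)]] by metis
    qed (rule idl_add[OF principal_idl[OF ab(1)]])
    hence "iprod (principal a) (principal b) \<subseteq> ipow P (Suc (ord a + ord b))" using sub by blast
    moreover have "iprod (principal a) (principal b) = iprod (ipow P (ord a + ord b)) (iprod A B)"
      unfolding A(2) B(2) ipow_add by (simp only: iprod_assoc iprod_left_comm[of A])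
    ultimately have "iprod (ipow P (ord a + ord b)) (iprod A B) \<subseteq> iprod (ipow P (ord a + ord b)) P"
      by simp
    hence "iprod A B \<subseteq> P" by (rule iprod_cancel_subset[OF ipow_nzidl nz_idl[OF AB] max_idl[OF P]])
    thus False using maxidl_contains_prod[OF P nz_idl[OF A(1)] nz_idl[OF B(1)]] A(3) B(3) by blast
  qed
  thus ?thesis using 1 by simp
qed

lemma ord_add:
  assumes a: "a \<in> ints" "a \<noteq> 0" and b: "b \<in> ints" "b \<noteq> 0" and ab: "a + b \<noteq> 0"
  shows "min (ord a) (ord b) \<le> ord (a + b)"
proof -
  have "a \<in> ipow P (min (ord a) (ord b))" "b \<in> ipow P (min (ord a) (ord b))"
    using ord_iff[OF a] ord_iff[OF b] by simp_all
  hence "a + b \<in> ipow P (min (ord a) (ord b))" by (rule idl_add[OF ipow_idl])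
  thus ?thesis using ord_iff[OF ints_add[OF a(1) b(1)] ab] by blast
qed

text \<open>An element of nonnegative valuation lies in the localization at P. The denominator t
  comes from the cofactor A of b outside P: a t lies in the product of the power of P with A, which
  is (b).\<close>

lemma ord_denominator:
  assumes a: "a \<in> ints" "a \<noteq> 0" and b: "b \<in> ints" "b \<noteq> 0" and le: "ord b \<le> ord a"
  obtains t where "t \<in> ints" "t \<notin> P" "t * (a / b) \<in> ints"
proof -
  obtain A where A: "nzidl A" "principal b = iprod (ipow P (ord b)) A" "\<not> A \<subseteq> P"
    using principal_factor[OF b] .
  obtain t where t: "t \<in> A" "t \<notin> P" using A(3) by blast
  have ti: "t \<in> ints" using idl_ints[OF nz_idl[OF A(1)] t(1)] .
  have "a \<in> ipow P (ord b)" using ord_iff[OF a] le by blast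
  hence "a * t \<in> principal b" unfolding A(2) using t(1) by (rule iprod.prod)
  then obtain r where "r \<in> ints" "a * t = b * r" by (auto simp: principal_def)
  hence "t * (a / b) \<in> ints" using b(2) by (simp add: field_simps)
  thus ?thesis by (rule that[OF ti t(2)])
qed

end

end

section \<open>Agreement with the ideals, norms and powers of HOL-Algebra\<close>

lemma ring_of_integers_cring: "cring (ring_of_integers :: 'k::number_field ring)"
proof (rule cringI)
  show "abelian_group (ring_of_integers :: 'k ring)"
  proof (rule abelian_groupI)
    fix x assume "x \<in> carrier (ring_of_integers :: 'k ring)"
    thus "\<exists>y\<in>carrier ring_of_integers. y \<oplus>\<^bsub>ring_of_integers\<^esub> x = \<zero>\<^bsub>ring_of_integers\<^esub>"
      by (intro bexI[of _ "- x"]) (auto simp: ring_of_integers_def)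
  qed (auto simp: ring_of_integers_def algebraic_int_add add_ac)
  show "Group.comm_monoid (ring_of_integers :: 'k ring)"
    by (rule comm_monoidI) (auto simp: ring_of_integers_def algebraic_int_mult mult_ac)
qed (auto simp: ring_of_integers_def distrib_right)

lemma ideal_ring_of_integers: "ideal I ring_of_integers \<longleftrightarrow> K.idl (I :: 'k::number_field set)"
proof
  assume I: "ideal I (ring_of_integers :: 'k ring)"
  interpret ideal I "ring_of_integers :: 'k ring" by (rule I)
  show "K.idl I"
  proof (rule K.idlI)
    show "I \<subseteq> K.ints" using Icarr by (auto simp: ring_of_integers_def K_ints)
    show "0 \<in> I" using additive_subgroup.zero_closed[OF ideal.axioms(1)[OF I]] by (simp add: ring_of_integers_def)
    show "x + y \<in> I" if "x \<in> I" "y \<in> I" for x y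
      using additive_subgroup.a_closed[OF ideal.axioms(1)[OF I] that] by (simp add: ring_of_integers_def)
    show "r * x \<in> I" if "x \<in> I" "r \<in> K.ints" for x r
      using I_l_closed[OF that(1), of r] that(2) by (simp add: ring_of_integers_def K_ints)
  qed
next
  assume I: "K.idl I"
  interpret R: cring "ring_of_integers :: 'k ring" by (rule ring_of_integers_cring)
  have inv: "\<ominus>\<^bsub>ring_of_integers\<^esub> x = - x" if "x \<in> I" for x
    using that K.idl_ints[OF I] by (intro R.minus_equality) (auto simp: ring_of_integers_def K_ints)
  show "ideal I ring_of_integers"
  proof (rule idealI[OF R.ring_axioms])
    show "subgroup I (add_monoid (ring_of_integers :: 'k ring))"
    proof (rule R.add.subgroupI)
      show "I \<subseteq> carrier ring_of_integers" using K.idl_ints[OF I] by (auto simp: ring_of_integers_def K_ints)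
      show "I \<noteq> {}" using K.idl_0[OF I] by blast
      show "\<ominus>\<^bsub>ring_of_integers\<^esub> x \<in> I" if "x \<in> I" for x
        using inv[OF that] K.idl_minus[OF I that] by simp
      show "x \<oplus>\<^bsub>ring_of_integers\<^esub> y \<in> I" if "x \<in> I" "y \<in> I" for x y
        using K.idl_add[OF I that] by (simp add: ring_of_integers_def)
    qed
    show "x \<otimes>\<^bsub>ring_of_integers\<^esub> a \<in> I" "a \<otimes>\<^bsub>ring_of_integers\<^esub> x \<in> I"
      if "a \<in> I" "x \<in> carrier ring_of_integers" for a x
      using that K.idl_mult[OF I that(1), of x] K.idl_mult_right[OF I that(1), of x]
      by (auto simp: ring_of_integers_def K_ints)
  qed
qed

lemma carrier_ring_of_integers: "carrier ring_of_integers = (K.ints :: 'k::number_field set)"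
  by (auto simp: ring_of_integers_def K_ints)

lemma maximalideal_ring_of_integers:
  "maximalideal P ring_of_integers \<longleftrightarrow> K.maxidl (P :: 'k::number_field set)"
proof
  assume "maximalideal P (ring_of_integers :: 'k ring)"
  then interpret maximalideal P "ring_of_integers :: 'k ring" .
  show "K.maxidl P"
    unfolding K.maxidl_def
  proof (intro conjI allI impI)
    show "K.idl P" using is_ideal by (simp add: ideal_ring_of_integers)
    show "P \<noteq> K.ints" using I_notcarr by (simp add: carrier_ring_of_integers)
    show "J = P \<or> J = K.ints" if "K.idl J" "P \<subseteq> J" for J
      using I_maximal[of J] that K.idl_ints[OF that(1)]
      by (auto simp: ideal_ring_of_integers carrier_ring_of_integers)
  qed
next
  assume P: "K.maxidl P"
  show "maximalideal P (ring_of_integers :: 'k ring)"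
    by (rule maximalidealI)
       (use P in \<open>auto simp: K.maxidl_def ideal_ring_of_integers carrier_ring_of_integers\<close>)
qed

lemma primes_of_field_eq: "primes_of_field = {P :: 'k::number_field set. K.maxidl P}"
  by (simp add: primes_of_field_def maximalideal_ring_of_integers)

lemma prime_norm_eq: "prime_norm P = K.N (P :: 'k::number_field set)"
proof -
  have "carrier (ring_of_integers Quot P) = K.residue P ` K.ints"
    by (auto simp: FactRing_def A_RCOSETS_def' a_r_coset_def' K.residue_def carrier_ring_of_integers[symmetric])
       (auto simp: ring_of_integers_def)
  thus ?thesis by (simp add: prime_norm_def K.N_def)
qed

lemma ideal_power_eq: "P [^]\<^bsub>ideals_set ring_of_integers\<^esub> n = K.ipow (P :: 'k::number_field set) n"
proof -
  have prod: "ideal_prod ring_of_integers I J = iprod I J" for I J :: "'k set"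
  proof (intro equalityI subsetI)
    fix x assume "x \<in> ideal_prod ring_of_integers I J"
    thus "x \<in> iprod I J"
      by induction (auto simp: ring_of_integers_def intro: iprod.intros)
  next
    fix x assume "x \<in> iprod I J"
    thus "x \<in> ideal_prod ring_of_integers I J"
    proof induction
      case (prod i j)
      thus ?case using ideal_prod.prod[of i I j J "ring_of_integers"] by (simp add: ring_of_integers_def)
    next
      case (sum x y)
      thus ?case using ideal_prod.sum[of x "ring_of_integers" I J y] by (simp add: ring_of_integers_def)
    qed
  qed
  show ?thesis
    by (induction n) (auto simp: nat_pow_def ideals_set_def carrier_ring_of_integers prod)
qed

section \<open>The absolute value at a prime\<close>

locale field_prime =
  fixes P :: "'k::number_field set"
  assumes P: "K.maxidl P"
begin

abbreviation v :: "'k \<Rightarrow> real" where "v \<equiv> prime_abs P"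

lemma integer_ord_eq: "integer_ord P a = K.ord P a"
  by (simp add: integer_ord_def K.ord_def[OF P] ideal_power_eq)

lemma fraction:
  fixes x :: 'k assumes "x \<noteq> 0"
  obtains a b where "a \<in> K.ints" "b \<in> K.ints" "a \<noteq> 0" "b \<noteq> 0" "x = a / b"
proof -
  obtain m :: int where m: "m \<noteq> 0" "of_int m * x \<in> K.ints" using K.multiple_integral[of x] by auto
  show ?thesis
    using assms m by (intro that[of "of_int m * x" "of_int m"]) (auto intro: K.ints_of_int)
qed

text \<open>Justifies the definite description: cross-multiplying two fractions and applying
  \<open>ord_mult\<close> shows independence of numerator and denominator.\<close>

lemma prime_ord_fraction:
  assumes a: "a \<in> K.ints" "a \<noteq> 0" and b: "b \<in> K.ints" "b \<noteq> 0"
  shows "prime_ord P (a / b) = int (K.ord P a) - int (K.ord P b)"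
  unfolding prime_ord_def
proof (rule the_equality)
  show "\<exists>c d. algebraic_int c \<and> algebraic_int d \<and> c \<noteq> 0 \<and> d \<noteq> 0 \<and> a / b = c / d \<and>
      int (K.ord P a) - int (K.ord P b) = int (integer_ord P c) - int (integer_ord P d)"
    using a b by (intro exI[of _ a] exI[of _ b]) (auto simp: K_ints integer_ord_eq)
next
  fix k assume "\<exists>c d. algebraic_int c \<and> algebraic_int d \<and> c \<noteq> 0 \<and> d \<noteq> 0 \<and> a / b = c / d \<and>
      k = int (integer_ord P c) - int (integer_ord P d)"
  then obtain c d where cd: "c \<in> K.ints" "d \<in> K.ints" "c \<noteq> 0" "d \<noteq> 0" "a / b = c / d"
    "k = int (K.ord P c) - int (K.ord P d)" by (auto simp: K_ints integer_ord_eq)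
  have "a * d = c * b" using cd b by (simp add: field_simps)
  hence "K.ord P a + K.ord P d = K.ord P c + K.ord P b"
    using K.ord_mult[OF P a cd(2,4)] K.ord_mult[OF P cd(1,3) b] by simp
  thus "k = int (K.ord P a) - int (K.ord P b)" using cd(6) by linarith
qed

lemma prime_ord_mult:
  assumes "x \<noteq> 0" "y \<noteq> 0"
  shows "prime_ord P (x * y) = prime_ord P x + prime_ord P y"
proof -
  obtain a b where x: "a \<in> K.ints" "b \<in> K.ints" "a \<noteq> 0" "b \<noteq> 0" "x = a / b" using fraction[OF assms(1)] .
  obtain c d where y: "c \<in> K.ints" "d \<in> K.ints" "c \<noteq> 0" "d \<noteq> 0" "y = c / d" using fraction[OF assms(2)] .
  have "x * y = (a * c) / (b * d)" using x y by simp
  hence "prime_ord P (x * y) = int (K.ord P (a * c)) - int (K.ord P (b * d))"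
    using x y by (simp only:) (rule prime_ord_fraction; simp add: K.ints_mult)
  thus ?thesis using x y by (simp add: K.ord_mult[OF P] prime_ord_fraction)
qed

lemma prime_ord_add:
  assumes "x \<noteq> 0" "y \<noteq> 0" "x + y \<noteq> 0"
  shows "min (prime_ord P x) (prime_ord P y) \<le> prime_ord P (x + y)"
proof -
  obtain a b where x: "a \<in> K.ints" "b \<in> K.ints" "a \<noteq> 0" "b \<noteq> 0" "x = a / b" using fraction[OF assms(1)] .
  obtain c d where y: "c \<in> K.ints" "d \<in> K.ints" "c \<noteq> 0" "d \<noteq> 0" "y = c / d" using fraction[OF assms(2)] .
  have i: "a * d \<in> K.ints" "c * b \<in> K.ints" "b * d \<in> K.ints" using x y K.ints_mult by auto
  have nz: "a * d \<noteq> 0" "c * b \<noteq> 0" "b * d \<noteq> 0" using x y by auto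
  have eq: "x = (a * d) / (b * d)" "y = (c * b) / (b * d)" "x + y = (a * d + c * b) / (b * d)"
    using x y by (simp_all add: field_simps)
  hence nz': "a * d + c * b \<noteq> 0" using assms(3) by auto
  have "min (K.ord P (a * d)) (K.ord P (c * b)) \<le> K.ord P (a * d + c * b)"
    by (rule K.ord_add[OF P i(1) nz(1) i(2) nz(2) nz'])
  thus ?thesis
    unfolding eq(3) unfolding eq(1,2) prime_ord_fraction[OF i(1) nz(1) i(3) nz(3)]
      prime_ord_fraction[OF i(2) nz(2) i(3) nz(3)] prime_ord_fraction[OF K.ints_add[OF i(1,2)] nz' i(3) nz(3)]
    by linarith
qed

lemma norm_gt_1: "real (prime_norm P) > 1"
  using K.maxidl_N_ge_2[OF P] by (simp add: prime_norm_eq)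

lemma v_0 [simp]: "v 0 = 0"
  by (simp add: prime_abs_def)

lemma v_pos: "x \<noteq> 0 \<Longrightarrow> v x > 0"
  using norm_gt_1 by (simp add: prime_abs_def)

lemma v_nonneg: "v x \<ge> 0"
  using v_pos[of x] by (cases "x = 0") auto

lemma v_mult: "v (x * y) = v x * v y"
proof (cases "x = 0 \<or> y = 0")
  case False
  thus ?thesis using norm_gt_1
    by (simp add: prime_abs_def prime_ord_mult power_int_add[symmetric] algebra_simps)
qed (auto simp: prime_abs_def)

lemma v_ultra: "v (x + y) \<le> max (v x) (v y)"
proof (cases "x = 0 \<or> y = 0 \<or> x + y = 0")
  case False
  have mono: "real (prime_norm P) powi (- j) \<le> real (prime_norm P) powi (- i)" if "i \<le> j" for i j
    using norm_gt_1 that by (intro power_int_increasing) auto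
  have "min (prime_ord P x) (prime_ord P y) \<le> prime_ord P (x + y)" using prime_ord_add False by blast
  hence "prime_ord P x \<le> prime_ord P (x + y) \<or> prime_ord P y \<le> prime_ord P (x + y)" by linarith
  thus ?thesis using mono False by (auto simp: prime_abs_def le_max_iff_disj)
qed (use v_nonneg in \<open>auto simp: prime_abs_def le_max_iff_disj\<close>)

lemma v_1 [simp]: "v 1 = 1"
  using v_mult[of 1 1] v_pos[of 1] by simp

lemma v_minus [simp]: "v (- x) = v x"
proof -
  have "v (- 1) * v (- 1) = 1" using v_mult[of "- 1" "- 1"] by simp
  hence "v (- 1) = 1" using v_nonneg[of "- 1"] by (metis abs_of_nonneg power2_eq_square power2_eq_1_iff abs_minus_cancel abs_one)
  thus ?thesis using v_mult[of "- 1" x] by simp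
qed

lemma v_ultra_diff: "v (x - y) \<le> max (v x) (v y)"
  using v_ultra[of x "- y"] by simp

lemma v_power: "v (x ^ n) = v x ^ n"
  by (induction n) (simp_all add: v_mult)

lemma v_int:
  assumes "a \<in> K.ints" "a \<noteq> 0"
  shows "v a = real (prime_norm P) powi (- int (K.ord P a))"
proof -
  have "1 \<in> K.ipow P n \<longleftrightarrow> n = 0" for n
  proof (cases n)
    case (Suc m)
    have "K.ipow P n \<subseteq> P" using K.ipow_antimono[OF P, of "Suc 0" n] K.ipow_1[OF P] Suc by simp
    thus ?thesis using K.maxidl_one[OF P] Suc by auto
  qed (simp add: K.ints_1)
  hence "K.ord P 1 = 0" using K.ord_iff[OF P K.ints_1, of "K.ord P 1"] by simp
  hence "prime_ord P a = int (K.ord P a)" using prime_ord_fraction[OF assms K.ints_1] by simp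
  thus ?thesis using assms by (simp add: prime_abs_def)
qed

lemma v_int_le_1: "a \<in> K.ints \<Longrightarrow> v a \<le> 1"
proof (cases "a = 0")
  case False
  assume a: "a \<in> K.ints"
  have "real (prime_norm P) powi (- int (K.ord P a)) \<le> real (prime_norm P) powi 0"
    using norm_gt_1 by (intro power_int_increasing) auto
  thus ?thesis using v_int[OF a False] by simp
qed simp

lemma v_ipow: "a \<in> K.ipow P n \<Longrightarrow> v a \<le> (1 / real (prime_norm P)) ^ n"
proof (cases "a = 0")
  case False
  assume a: "a \<in> K.ipow P n"
  have ai: "a \<in> K.ints" using K.idl_ints[OF K.ipow_idl[OF P] a] .
  have "n \<le> K.ord P a" using K.ord_iff[OF P ai False] a by blast
  hence "real (prime_norm P) powi (- int (K.ord P a)) \<le> real (prime_norm P) powi (- int n)"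
    using norm_gt_1 by (intro power_int_increasing) auto
  also have "\<dots> = (1 / real (prime_norm P)) ^ n"
    by (simp add: power_int_minus power_divide inverse_eq_divide)
  finally show ?thesis using v_int[OF ai False] by simp
qed (use norm_gt_1 in simp)

lemma v_int_less_1: "a \<in> K.ints \<Longrightarrow> v a < 1 \<longleftrightarrow> a \<in> P"
proof (cases "a = 0")
  case True
  thus ?thesis using K.idl_0[OF K.max_idl[OF P]] by simp
next
  case False
  assume a: "a \<in> K.ints"
  have P1: "a \<in> P \<longleftrightarrow> Suc 0 \<le> K.ord P a" using K.ord_iff[OF P a False, of "Suc 0"] K.ipow_1[OF P] by simp
  show ?thesis
  proof
    assume "v a < 1"
    moreover have "v a = 1" if "K.ord P a = 0" using v_int[OF a False] that by simp
    ultimately have "K.ord P a \<noteq> 0" by auto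
    thus "a \<in> P" using P1 by simp
  next
    assume "a \<in> P"
    hence "a \<in> K.ipow P (Suc 0)" using K.ipow_1[OF P] by simp
    hence "v a \<le> (1 / real (prime_norm P)) ^ Suc 0" by (rule v_ipow)
    also have "\<dots> < 1" using norm_gt_1 by simp
    finally show "v a < 1" .
  qed
qed

text \<open>Integers of K represent all residues of the valuation ring. For t outside P with t x
  integral and u t + p = 1, the choice a = u t x leaves the error p x.\<close>

lemma v_le_1_approx:
  assumes "v x \<le> 1"
  shows "\<exists>a\<in>K.ints. v (x - a) < 1"
proof (cases "x = 0")
  case False
  obtain a b where x: "a \<in> K.ints" "b \<in> K.ints" "a \<noteq> 0" "b \<noteq> 0" "x = a / b" using fraction[OF False] .
  have "v a = v x * v b" using v_mult[of x b] x by simp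
  also have "\<dots> \<le> 1 * v b" by (rule mult_right_mono[OF assms v_nonneg])
  finally have "real (prime_norm P) powi (- int (K.ord P a)) \<le> real (prime_norm P) powi (- int (K.ord P b))"
    using v_int x by simp
  hence "K.ord P b \<le> K.ord P a"
    using power_int_strict_increasing[of "- int (K.ord P b)" "- int (K.ord P a)" "real (prime_norm P)"] norm_gt_1
    by (meson linorder_not_less neg_less_iff_less of_nat_less_iff)
  then obtain t where t: "t \<in> K.ints" "t \<notin> P" "t * x \<in> K.ints"
    using K.ord_denominator[OF P x(1,3,2,4)] x(5) by metis
  obtain u p where u: "u \<in> K.ints" "p \<in> P" "u * t + p = 1" using K.maxidl_unit_mod[OF P t(1,2)] by blast
  have "x - u * (t * x) = (u * t + p) * x - u * (t * x)" by (simp only: u(3) mult_1_left)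
  also have "\<dots> = p * x" by (simp add: algebra_simps)
  finally have "v (x - u * (t * x)) = v p * v x" by (simp add: v_mult)
  also have "\<dots> \<le> v p * 1" by (rule mult_left_mono[OF assms v_nonneg])
  also have "v p < 1" using v_int_less_1[of p] u(2) K.idl_ints[OF K.max_idl[OF P]] by blast
  finally have "v (x - u * (t * x)) < 1" by simp
  thus ?thesis using K.ints_mult[OF u(1) t(3)] by blast
qed (use K.ints_0 in \<open>auto intro!: bexI[of _ 0]\<close>)

end

section \<open>The completion\<close>

context field_prime
begin

abbreviation null :: "(nat \<Rightarrow> 'k) \<Rightarrow> bool" where
  "null s \<equiv> (\<lambda>i. v (s i)) \<longlonglongrightarrow> 0"

lemma null_iff: "null s \<longleftrightarrow> (\<forall>e>0. \<exists>M. \<forall>i\<ge>M. v (s i) < e)"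
  unfolding lim_sequentially by (auto simp: dist_real_def v_nonneg)

lemma nullD: "null s \<Longrightarrow> e > 0 \<Longrightarrow> \<exists>M. \<forall>i\<ge>M. v (s i) < e"
  by (simp add: null_iff)

lemma null_squeeze:
  assumes "g \<longlonglongrightarrow> 0" "\<forall>\<^sub>F i in sequentially. v (s i) \<le> g i"
  shows "null s"
  by (rule tendsto_sandwich[OF _ assms(2) tendsto_const[of 0] assms(1)]) (simp add: v_nonneg)

lemma null_0: "null (\<lambda>_. 0)"
  by simp

lemma null_add: "null s \<Longrightarrow> null t \<Longrightarrow> null (\<lambda>i. s i + t i)"
proof -
  assume "null s" "null t"
  hence "(\<lambda>i. max (v (s i)) (v (t i))) \<longlonglongrightarrow> max 0 0" by (rule tendsto_max)
  hence "(\<lambda>i. max (v (s i)) (v (t i))) \<longlonglongrightarrow> 0" by simp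
  thus ?thesis by (rule null_squeeze) (simp add: v_ultra)
qed

lemma null_minus: "null s \<Longrightarrow> null (\<lambda>i. - s i)"
  by simp

lemma null_mult_bounded:
  assumes "null s" "\<And>i. v (t i) \<le> B"
  shows "null (\<lambda>i. s i * t i)"
proof (rule null_squeeze)
  show "(\<lambda>i. v (s i) * B) \<longlonglongrightarrow> 0" using tendsto_mult_left_zero[OF assms(1)] by simp
  show "\<forall>\<^sub>F i in sequentially. v (s i * t i) \<le> v (s i) * B"
    using assms(2) by (simp add: v_mult mult_left_mono v_nonneg)
qed

abbreviation cauchy :: "(nat \<Rightarrow> 'k) \<Rightarrow> bool" where
  "cauchy s \<equiv> prime_Cauchy P s"

lemma cauchyD: "cauchy s \<Longrightarrow> e > 0 \<Longrightarrow> \<exists>M. \<forall>i\<ge>M. \<forall>j\<ge>M. v (s i - s j) < e"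
  by (simp add: prime_Cauchy_def)

lemma cauchy_const: "cauchy (\<lambda>_. x)"
  by (simp add: prime_Cauchy_def)

lemma cauchy_add:
  assumes "cauchy s" "cauchy t"
  shows "cauchy (\<lambda>i. s i + t i)"
  unfolding prime_Cauchy_def
proof (intro allI impI)
  fix e :: real assume e: "e > 0"
  obtain M1 where M1: "\<forall>i\<ge>M1. \<forall>j\<ge>M1. v (s i - s j) < e" using assms(1) e unfolding prime_Cauchy_def by blast
  obtain M2 where M2: "\<forall>i\<ge>M2. \<forall>j\<ge>M2. v (t i - t j) < e" using assms(2) e unfolding prime_Cauchy_def by blast
  have "v (s i + t i - (s j + t j)) < e" if "i \<ge> max M1 M2" "j \<ge> max M1 M2" for i j
  proof -
    have "v (s i + t i - (s j + t j)) \<le> max (v (s i - s j)) (v (t i - t j))"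
      using v_ultra[of "s i - s j" "t i - t j"] by (simp add: algebra_simps)
    also have "\<dots> < e" using M1 M2 that by simp
    finally show ?thesis .
  qed
  thus "\<exists>M. \<forall>i\<ge>M. \<forall>j\<ge>M. v (s i + t i - (s j + t j)) < e" by blast
qed

lemma cauchy_bounded:
  assumes "cauchy s"
  shows "\<exists>B\<ge>0. \<forall>i. v (s i) \<le> B"
proof -
  obtain M where M: "\<forall>i\<ge>M. \<forall>j\<ge>M. v (s i - s j) < 1"
    using cauchyD[OF assms, of 1] by auto
  define B where "B = max 1 (Max ((\<lambda>i. v (s i)) ` {..M}))"
  have B: "v (s i) \<le> B" if "i \<le> M" for i
    unfolding B_def using that by (intro max.coboundedI2 Max_ge) auto
  have "v (s i) \<le> B" for i
  proof (cases "i \<le> M")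
    case False
    have "v (s i) \<le> max (v (s i - s M)) (v (s M))" using v_ultra[of "s i - s M" "s M"] by simp
    moreover have "v (s i - s M) < 1" using M False by simp
    moreover have "1 \<le> B" by (simp add: B_def)
    ultimately show ?thesis using B[of M] by linarith
  qed (rule B)
  moreover have "B \<ge> 0" by (simp add: B_def)
  ultimately show ?thesis by blast
qed

lemma cauchy_mult:
  assumes "cauchy s" "cauchy t"
  shows "cauchy (\<lambda>i. s i * t i)"
  unfolding prime_Cauchy_def
proof (intro allI impI)
  fix e :: real assume e: "e > 0"
  obtain A where A: "A \<ge> 0" "\<forall>i. v (s i) \<le> A" using cauchy_bounded[OF assms(1)] by blast
  obtain B where B: "B \<ge> 0" "\<forall>i. v (t i) \<le> B" using cauchy_bounded[OF assms(2)] by blast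
  \<comment> \<open>The 1 keeps the denominator positive and makes both d * A and d * B strictly
    smaller than e.\<close>
  define d where "d = e / (A + B + 1)"
  have d: "d > 0" using e A(1) B(1) by (simp add: d_def)
  obtain M1 where M1: "\<forall>i\<ge>M1. \<forall>j\<ge>M1. v (s i - s j) < d" using assms(1) d unfolding prime_Cauchy_def by blast
  obtain M2 where M2: "\<forall>i\<ge>M2. \<forall>j\<ge>M2. v (t i - t j) < d" using assms(2) d unfolding prime_Cauchy_def by blast
  have "v (s i * t i - s j * t j) < e" if ij: "i \<ge> max M1 M2" "j \<ge> max M1 M2" for i j
  proof -
    have dd: "v (s i - s j) < d" "v (t i - t j) < d" using M1 M2 ij by auto
    have "d * A < d * (A + B + 1)" "d * B < d * (A + B + 1)" using d A(1) B(1) by (auto intro!: mult_strict_left_mono)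
    moreover have "d * (A + B + 1) = e" unfolding d_def using A(1) B(1) by simp
    moreover have "v ((s i - s j) * t i) \<le> d * B"
      unfolding v_mult using dd B d by (intro mult_mono) (auto simp: v_nonneg less_imp_le)
    moreover have "v (s j * (t i - t j)) \<le> d * A"
      unfolding v_mult using dd A d by (subst mult.commute, intro mult_mono) (auto simp: v_nonneg less_imp_le)
    moreover have "v (s i * t i - s j * t j) \<le> max (v ((s i - s j) * t i)) (v (s j * (t i - t j)))"
      using v_ultra[of "(s i - s j) * t i" "s j * (t i - t j)"] by (simp add: algebra_simps)
    ultimately show ?thesis by linarith
  qed
  thus "\<exists>M. \<forall>i\<ge>M. \<forall>j\<ge>M. v (s i * t i - s j * t j) < e" by blast
qed

lemma cauchy_minus: "cauchy s \<Longrightarrow> cauchy (\<lambda>i. - s i)"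
  using cauchy_mult[OF cauchy_const[of "- 1"]] by simp

lemma cauchy_diff: "cauchy s \<Longrightarrow> cauchy t \<Longrightarrow> cauchy (\<lambda>i. s i - t i)"
  using cauchy_add[OF _ cauchy_minus, of s t] by simp

lemma cauchy_power: "cauchy s \<Longrightarrow> cauchy (\<lambda>i. s i ^ n)"
  by (induction n) (auto intro: cauchy_const cauchy_mult)

lemma cauchy_sum: "(\<And>n. n \<in> A \<Longrightarrow> cauchy (s n)) \<Longrightarrow> cauchy (\<lambda>i. \<Sum>n\<in>A. s n i)"
  by (induction A rule: infinite_finite_induct) (auto intro: cauchy_const cauchy_add)

lemma cauchy_poly: "cauchy s \<Longrightarrow> cauchy (\<lambda>i. poly F (s i))"
  unfolding poly_altdef by (intro cauchy_sum cauchy_mult cauchy_const cauchy_power)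

lemma null_cauchy: "null s \<Longrightarrow> cauchy s"
  unfolding prime_Cauchy_def
proof (intro allI impI)
  fix e :: real assume "null s" "e > 0"
  then obtain M where M: "\<forall>i\<ge>M. v (s i) < e" unfolding null_iff by blast
  have "v (s i - s j) < e" if "i \<ge> M" "j \<ge> M" for i j
    using v_ultra_diff[of "s i" "s j"] M that by (smt (verit))
  thus "\<exists>M. \<forall>i\<ge>M. \<forall>j\<ge>M. v (s i - s j) < e" by blast
qed

text \<open>By the ultrametric inequality, one late term of size at least e together with all late
  differences below e forces every late term to have size at least e.\<close>

lemma cauchy_not_null:
  assumes s: "cauchy s" "\<not> null s"
  obtains e M where "e > 0" "\<And>i. i \<ge> M \<Longrightarrow> v (s i) \<ge> e"
proof -
  obtain e where e: "e > 0" "\<And>M. \<exists>i\<ge>M. v (s i) \<ge> e"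
    using s(2) unfolding null_iff by (meson not_less)
  obtain M where M: "\<forall>i\<ge>M. \<forall>j\<ge>M. v (s i - s j) < e" using s(1) e(1) unfolding prime_Cauchy_def by blast
  obtain j where j: "j \<ge> M" "v (s j) \<ge> e" using e(2) by blast
  have "v (s i) \<ge> e" if "i \<ge> M" for i
    using v_ultra[of "s j - s i" "s i"] M[rule_format, of j i] j that by (simp add: le_max_iff_disj)
  thus ?thesis using that e(1) by blast
qed

text \<open>Absence of zero divisors in the completion, at the level of sequences.\<close>

lemma null_mult_cancel:
  assumes s: "cauchy s" "\<not> null s" and st: "null (\<lambda>i. s i * t i)"
  shows "null t"
proof -
  obtain e M where e: "e > 0" "\<And>i. i \<ge> M \<Longrightarrow> v (s i) \<ge> e" using cauchy_not_null[OF s] by metis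
  show ?thesis
  proof (rule null_squeeze)
    show "(\<lambda>i. v (s i * t i) * (1 / e)) \<longlonglongrightarrow> 0" by (rule tendsto_mult_left_zero[OF st])
    show "\<forall>\<^sub>F i in sequentially. v (t i) \<le> v (s i * t i) * (1 / e)"
      unfolding eventually_sequentially
    proof (intro exI[of _ M] allI impI)
      fix i assume "M \<le> i"
      hence "e * v (t i) \<le> v (s i * t i)" unfolding v_mult using e(2) by (intro mult_right_mono v_nonneg) auto
      thus "v (t i) \<le> v (s i * t i) * (1 / e)" using e(1) by (simp add: field_simps)
    qed
  qed
qed

section \<open>The completion as a quotient ring\<close>

abbreviation R :: "(nat \<Rightarrow> 'k) ring" where "R \<equiv> Cauchy_ring P"

lemma Cauchy_ring_cring: "cring R"
proof (rule cringI)
  show "abelian_group R"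
  proof (rule abelian_groupI)
    fix x assume "x \<in> carrier R"
    thus "\<exists>y\<in>carrier R. y \<oplus>\<^bsub>R\<^esub> x = \<zero>\<^bsub>R\<^esub>"
      by (intro bexI[of _ "\<lambda>i. - x i"]) (auto simp: Cauchy_ring_def cauchy_minus)
  qed (auto simp: Cauchy_ring_def cauchy_add cauchy_const add_ac)
  show "Group.comm_monoid R"
    by (rule comm_monoidI) (auto simp: Cauchy_ring_def cauchy_mult cauchy_const mult_ac)
qed (auto simp: Cauchy_ring_def distrib_right)

lemma null_sequences_mem: "s \<in> null_sequences P \<longleftrightarrow> null s"
  by (simp add: null_sequences_def)

lemma Cauchy_ring_minus:
  assumes "cauchy s" shows "\<ominus>\<^bsub>R\<^esub> s = (\<lambda>i. - s i)"
proof -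
  interpret R: cring R by (rule Cauchy_ring_cring)
  show ?thesis
    using assms by (intro R.minus_equality) (auto simp: Cauchy_ring_def cauchy_minus)
qed

lemma null_sequences_ideal: "ideal (null_sequences P) R"
proof -
  interpret R: cring R by (rule Cauchy_ring_cring)
  have bd: "null (\<lambda>i. a i * x i)" "null (\<lambda>i. x i * a i)" if ax: "null a" "cauchy x" for a x
  proof -
    obtain B where "\<forall>i. v (x i) \<le> B" using cauchy_bounded[OF ax(2)] by blast
    thus "null (\<lambda>i. a i * x i)" using null_mult_bounded[OF ax(1)] by blast
    thus "null (\<lambda>i. x i * a i)" by (simp add: mult.commute)
  qed
  show ?thesis
  proof (rule idealI[OF R.ring_axioms])
    show "subgroup (null_sequences P) (add_monoid R)"
    proof (rule R.add.subgroupI)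
      show "null_sequences P \<subseteq> carrier R" by (auto simp: Cauchy_ring_def null_sequences_mem null_cauchy)
      have "(\<lambda>_. 0) \<in> null_sequences P" using null_0 by (simp only: null_sequences_mem)
      thus "null_sequences P \<noteq> {}" by (metis empty_iff)
      show "\<ominus>\<^bsub>R\<^esub> x \<in> null_sequences P" if "x \<in> null_sequences P" for x
      proof -
        have n: "null x" using that by (simp add: null_sequences_mem)
        show ?thesis unfolding Cauchy_ring_minus[OF null_cauchy[OF n]] null_sequences_mem by (rule null_minus[OF n])
      qed
      show "x \<oplus>\<^bsub>R\<^esub> y \<in> null_sequences P" if "x \<in> null_sequences P" "y \<in> null_sequences P" for x y
      proof -
        have "x \<oplus>\<^bsub>R\<^esub> y = (\<lambda>i. x i + y i)" by (simp add: Cauchy_ring_def)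
        moreover have "null x" "null y" using that by (simp_all only: null_sequences_mem)
        ultimately show ?thesis unfolding null_sequences_mem by (simp only:) (rule null_add)
      qed
    qed
    show "x \<otimes>\<^bsub>R\<^esub> a \<in> null_sequences P" "a \<otimes>\<^bsub>R\<^esub> x \<in> null_sequences P"
      if "a \<in> null_sequences P" "x \<in> carrier R" for a x
      using that bd by (auto simp: null_sequences_mem Cauchy_ring_def)
  qed
qed

definition cls :: "(nat \<Rightarrow> 'k) \<Rightarrow> (nat \<Rightarrow> 'k) set" where "cls s = null_sequences P +>\<^bsub>R\<^esub> s"

lemma cls_eq: "cls s = {\<lambda>i. t i + s i | t. null t}"
  by (auto simp: cls_def a_r_coset_def' Cauchy_ring_def null_sequences_mem)

lemma cls_eq_iff: "cls s = cls t \<longleftrightarrow> null (\<lambda>i. s i - t i)"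
proof
  assume "cls s = cls t"
  moreover have "s \<in> cls s" unfolding cls_eq using null_0 by (intro CollectI exI[of _ "\<lambda>_. 0"]) auto
  ultimately have "s \<in> cls t" by simp
  then obtain u where "null u" "s = (\<lambda>i. u i + t i)" by (auto simp: cls_eq)
  thus "null (\<lambda>i. s i - t i)" by simp
next
  have "cls s \<subseteq> cls t" if n: "null (\<lambda>i. s i - t i)" for s t
  proof
    fix x assume "x \<in> cls s"
    then obtain u where u: "null u" "x = (\<lambda>i. u i + s i)" by (auto simp: cls_eq)
    have "x = (\<lambda>i. (u i + (s i - t i)) + t i)" using u(2) by auto
    moreover have "null (\<lambda>i. u i + (s i - t i))" by (rule null_add[OF u(1) n])
    ultimately show "x \<in> cls t" unfolding cls_eq by (intro CollectI exI[of _ "\<lambda>i. u i + (s i - t i)"]) simp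
  qed
  moreover assume n: "null (\<lambda>i. s i - t i)"
  moreover have "null (\<lambda>i. t i - s i)" using null_minus[OF n] by simp
  ultimately show "cls s = cls t" by blast
qed

lemma completion_cring: "cring (completion P)"
  unfolding completion_def by (rule ideal.quotient_is_cring[OF null_sequences_ideal Cauchy_ring_cring])

lemma cls_hom: "cls \<in> Ring.ring_hom R (completion P)"
  using ideal.rcos_ring_hom[OF null_sequences_ideal] by (simp add: completion_def cls_def[abs_def])

lemma completion_carrierE:
  assumes "\<alpha> \<in> carrier (completion P)"
  obtains s where "cauchy s" "\<alpha> = cls s"
  using assms by (auto simp: completion_def FactRing_def A_RCOSETS_def' cls_def Cauchy_ring_def)

lemma cls_carrier: "cauchy s \<Longrightarrow> cls s \<in> carrier (completion P)"
  using Ring.ring_hom_closed[OF cls_hom, of s] by (simp add: Cauchy_ring_def)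

lemma completion_zero: "\<zero>\<^bsub>completion P\<^esub> = cls (\<lambda>_. 0)"
  by (auto simp: completion_def FactRing_def cls_eq null_sequences_mem)

lemma cls_mult: "cauchy s \<Longrightarrow> cauchy t \<Longrightarrow> cls s \<otimes>\<^bsub>completion P\<^esub> cls t = cls (\<lambda>i. s i * t i)"
  using Ring.ring_hom_mult[OF cls_hom, of s t] by (simp add: Cauchy_ring_def)

lemma cls_add: "cauchy s \<Longrightarrow> cauchy t \<Longrightarrow> cls s \<oplus>\<^bsub>completion P\<^esub> cls t = cls (\<lambda>i. s i + t i)"
  using Ring.ring_hom_add[OF cls_hom, of s t] by (simp add: Cauchy_ring_def)

lemma cls_one: "\<one>\<^bsub>completion P\<^esub> = cls (\<lambda>_. 1)"
  using Ring.ring_hom_one[OF cls_hom] by (simp add: Cauchy_ring_def)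

lemma cls_power: "cauchy s \<Longrightarrow> cls s [^]\<^bsub>completion P\<^esub> (n::nat) = cls (\<lambda>i. s i ^ n)"
  by (induction n) (simp_all add: nat_pow_def cls_one cls_mult cauchy_power mult.commute)

text \<open>Transfers roots and periods in the completion to sequences in K modulo null sequences.
  After this the quotient ring no longer enters the argument.\<close>

lemma poly_completion_cls:
  assumes s: "cauchy s"
  shows "poly_completion P F (cls s) = cls (\<lambda>i. poly F (s i))"
proof -
  interpret C: cring "completion P" by (rule completion_cring)
  define g where "g n = to_completion P (coeff F n) \<otimes>\<^bsub>completion P\<^esub> (cls s [^]\<^bsub>completion P\<^esub> n)" for n
  have g: "g n = cls (\<lambda>i. coeff F n * s i ^ n)" for n
    unfolding g_def cls_power[OF s] to_completion_def cls_def[symmetric]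
    by (rule cls_mult[OF cauchy_const cauchy_power[OF s]])
  have term_cauchy: "cauchy (\<lambda>i. coeff F n * s i ^ n)" for n
    by (intro cauchy_mult cauchy_const cauchy_power s)
  have gc: "g n \<in> carrier (completion P)" for n unfolding g by (intro cls_carrier term_cauchy)
  have "finsum (completion P) g {..n} = cls (\<lambda>i. \<Sum>k\<le>n. coeff F k * s i ^ k)" for n
  proof (induction n)
    case 0
    have "finsum (completion P) g {..0} = g 0" using gc by (intro C.finsum_0) auto
    also have "g 0 = cls (\<lambda>i. \<Sum>k\<le>0. coeff F k * s i ^ k)" by (simp add: g)
    finally show ?case .
  next
    case (Suc n)
    have "finsum (completion P) g {..Suc n} = g (Suc n) \<oplus>\<^bsub>completion P\<^esub> finsum (completion P) g {..n}"
      using gc by (intro C.finsum_Suc) auto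
    also have "\<dots> = cls (\<lambda>i. coeff F (Suc n) * s i ^ Suc n + (\<Sum>k\<le>n. coeff F k * s i ^ k))"
      unfolding Suc.IH g by (rule cls_add[OF term_cauchy cauchy_sum[OF term_cauchy]])
    finally show ?case by (simp add: add.commute)
  qed
  from this[of "degree F"] show ?thesis
    by (simp only: poly_completion_def g_def[abs_def] poly_altdef)
qed

lemma local_root_iff:
  "P \<in> local_root_primes F \<longleftrightarrow> (\<exists>s. cauchy s \<and> null (\<lambda>i. poly F (s i)))"
proof -
  have "P \<in> primes_of_field" using P by (simp add: primes_of_field_eq)
  moreover have "poly_completion P F (cls s) = \<zero>\<^bsub>completion P\<^esub> \<longleftrightarrow> null (\<lambda>i. poly F (s i))" if "cauchy s" for s
    unfolding poly_completion_cls[OF that] completion_zero cls_eq_iff by simp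
  ultimately show ?thesis
    unfolding local_root_primes_def using completion_carrierE cls_carrier by (auto; metis)
qed

lemma local_period_1:
  assumes "\<exists>\<alpha>\<in>carrier (completion P). has_period (poly_completion P f) 1 \<alpha>"
  shows "\<exists>s. cauchy s \<and> null (\<lambda>i. poly f (s i) - s i)"
proof -
  obtain \<alpha> where \<alpha>: "\<alpha> \<in> carrier (completion P)" "poly_completion P f \<alpha> = \<alpha>"
    using assms by (auto simp: has_period_def)
  obtain s where s: "cauchy s" "\<alpha> = cls s" using completion_carrierE[OF \<alpha>(1)] .
  show ?thesis using \<alpha>(2) s(1) unfolding s(2) poly_completion_cls[OF s(1)] cls_eq_iff by blast
qed

lemma local_period_2:
  assumes "\<exists>\<alpha>\<in>carrier (completion P). has_period (poly_completion P f) 2 \<alpha>"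
  shows "\<exists>s. cauchy s \<and> null (\<lambda>i. poly f (poly f (s i)) - s i) \<and> \<not> null (\<lambda>i. poly f (s i) - s i)"
proof -
  obtain \<alpha> where \<alpha>0: "\<alpha> \<in> carrier (completion P)" "has_period (poly_completion P f) 2 \<alpha>"
    using assms by blast
  have 1: "poly_completion P f (poly_completion P f \<alpha>) = \<alpha>"
    using \<alpha>0(2) by (simp add: has_period_def numeral_2_eq_2)
  have 2: "poly_completion P f \<alpha> \<noteq> \<alpha>"
    using \<alpha>0(2)[unfolded has_period_def, THEN conjunct2, rule_format, of 1] by simp
  note \<alpha> = \<alpha>0(1) 1 2
  obtain s where s: "cauchy s" "\<alpha> = cls s" using completion_carrierE[OF \<alpha>(1)] .
  show ?thesis
    using \<alpha>(2,3) s(1) unfolding s(2) poly_completion_cls[OF s(1)] poly_completion_cls[OF cauchy_poly[OF s(1)]] cls_eq_iff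
    by blast
qed

text \<open>Linear convergence suffices, so the inverse of the derivative is only needed modulo \<open>P\<close>;
  this keeps the iteration inside the ring of integers.\<close>
lemma hensel_sqrt:
  assumes D: "D \<in> K.ints" "2 * D \<notin> P" and c: "c \<in> K.ints" "c ^ 2 - D \<in> P"
  shows "\<exists>s. cauchy s \<and> null (\<lambda>i. s i ^ 2 - D)"
proof -
  have PP: "K.idl P" by (rule K.max_idl[OF P])
  have two: "2 \<in> K.ints" using K.ints_of_nat[of 2] by simp
  have c2: "2 * c \<notin> P" by (rule K.double_root_notin[OF P D(2) c])
  obtain u p where u: "u \<in> K.ints" "p \<in> P" "u * (2 * c) + p = 1"
    using K.maxidl_unit_mod[OF P K.ints_mult[OF two c(1)] c2] by blast
  define s where "s = rec_nat c (\<lambda>_ x. x - (x ^ 2 - D) * u)"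
  have s0: "s 0 = c" and sS: "s (Suc n) = s n - (s n ^ 2 - D) * u" for n by (simp_all add: s_def)
  have inv: "s n \<in> K.ints \<and> s n - c \<in> P \<and> s n ^ 2 - D \<in> K.ipow P (Suc n)" for n
  proof (induction n)
    case 0
    show ?case using c K.idl_0[OF PP] K.ipow_1[OF P] by (simp add: s0)
  next
    case (Suc n)
    define e where "e = s n ^ 2 - D"
    have sn: "s n \<in> K.ints" "s n - c \<in> P" and e: "e \<in> K.ipow P (Suc n)" using Suc by (auto simp: e_def)
    have ei: "e \<in> K.ints" unfolding e_def by (intro K.ints_diff K.ints_power sn D)
    have eP: "e \<in> P" using e K.ipow_antimono[OF P, of "Suc 0" "Suc n"] K.ipow_1[OF P] by auto
    have 1: "s (Suc n) \<in> K.ints" unfolding sS e_def[symmetric] by (intro K.ints_diff K.ints_mult sn ei u)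
    have "(s n - c) - e * u \<in> P" by (rule K.idl_diff[OF PP sn(2) K.idl_mult_right[OF PP eP u(1)]])
    hence 2: "s (Suc n) - c \<in> P" unfolding sS e_def[symmetric] by (simp add: algebra_simps)
    \<comment> \<open>This is the factor by which the error e is multiplied in one step. It lies in
      P because u (2 c) = 1 - p, and both \<open>s n - c\<close> and e lie in P.\<close>
    have "p - 2 * u * (s n - c) + e * u ^ 2 \<in> P"
      by (intro K.idl_add[OF PP K.idl_diff[OF PP u(2) K.idl_mult[OF PP sn(2)]] K.idl_mult_right[OF PP eP]]
          K.ints_mult K.ints_power two u)
    hence "e * (p - 2 * u * (s n - c) + e * u ^ 2) \<in> K.ipow P (Suc (Suc n))"
      unfolding K.ipow.simps(2)[of P "Suc n"] by (rule iprod.prod[OF e])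
    moreover have "e * (p - 2 * u * (s n - c) + e * u ^ 2) = s (Suc n) ^ 2 - D"
    proof -
      have p: "p = 1 - u * (2 * c)" using u(3) by (simp add: algebra_simps)
      have "s n ^ 2 = e + D" by (simp add: e_def)
      moreover have "(s n - e * u) ^ 2 - D = s n ^ 2 - 2 * s n * e * u + e ^ 2 * u ^ 2 - D"
        by (simp add: power2_eq_square algebra_simps)
      ultimately show ?thesis unfolding sS e_def[symmetric] p by (simp add: power2_eq_square algebra_simps)
    qed
    ultimately show ?case using 1 2 by simp
  qed
  define q where "q = 1 / real (prime_norm P)"
  have q: "0 < q" "q < 1" using norm_gt_1 by (auto simp: q_def)
  have le: "v (s n ^ 2 - D) \<le> q ^ Suc n" for n
    unfolding q_def by (rule v_ipow) (use inv in blast)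
  have "(\<lambda>n. q ^ n) \<longlonglongrightarrow> 0" using q by (intro LIMSEQ_power_zero) simp
  hence "(\<lambda>n. q ^ Suc n) \<longlonglongrightarrow> 0" by (rule LIMSEQ_Suc)
  hence nl: "null (\<lambda>n. s n ^ 2 - D)" by (rule null_squeeze) (rule always_eventually, rule allI, rule le)
  have step: "v (s (Suc n) - s n) \<le> q ^ Suc n" for n
  proof -
    have "s (Suc n) - s n = - ((s n ^ 2 - D) * u)" by (simp add: sS)
    hence "v (s (Suc n) - s n) = v (s n ^ 2 - D) * v u" by (simp add: v_mult)
    also have "\<dots> \<le> q ^ Suc n * 1"
      using v_ipow[of "s n ^ 2 - D" "Suc n"] inv v_int_le_1[OF u(1)] q
      by (intro mult_mono) (auto simp: v_nonneg q_def)
    finally show ?thesis by simp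
  qed
  have tail: "v (s (n + k) - s n) \<le> q ^ Suc n" for n k
  proof (induction k)
    case (Suc k)
    have "q ^ Suc (n + k) \<le> q ^ Suc n" using q by (intro power_decreasing) auto
    moreover have "v (s (n + Suc k) - s n) \<le> max (v (s (Suc (n + k)) - s (n + k))) (v (s (n + k) - s n))"
      using v_ultra[of "s (Suc (n + k)) - s (n + k)" "s (n + k) - s n"] by simp
    ultimately show ?case using step[of "n + k"] Suc by linarith
  qed (use q in simp)
  have "cauchy s"
    unfolding prime_Cauchy_def
  proof (intro allI impI)
    fix e :: real assume "e > 0"
    then obtain M where M: "q ^ M < e" using real_arch_pow_inv q(2) by blast
    have "q ^ Suc M \<le> q ^ M" using q by (intro power_decreasing) auto
    hence small: "v (s i - s M) < e" if "i \<ge> M" for i using tail[of M "i - M"] M that by simp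
    have "v (s i - s j) < e" if "i \<ge> M" "j \<ge> M" for i j
      using v_ultra_diff[of "s i - s M" "s j - s M"] small[OF that(1)] small[OF that(2)] by simp
    thus "\<exists>M. \<forall>i\<ge>M. \<forall>j\<ge>M. v (s i - s j) < e" by blast
  qed
  thus ?thesis using nl by blast
qed

text \<open>A late term y satisfies v (y^2 - D) < 1, hence v y \<le> 1, and it can be replaced by an
  integer c close to it; the change is (y - c) (y + c).\<close>

lemma sqrt_imp_residue_square:
  assumes D: "D \<in> K.ints" and s: "null (\<lambda>i. s i ^ 2 - D)"
  shows "\<exists>c\<in>K.ints. c ^ 2 - D \<in> P"
proof -
  obtain M where "\<forall>i\<ge>M. v (s i ^ 2 - D) < 1" using nullD[OF s, of 1] by auto
  then obtain y where y: "v (y ^ 2 - D) < 1" by blast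
  have "v y ^ 2 \<le> max (v (y ^ 2 - D)) (v D)" using v_ultra[of "y ^ 2 - D" D] by (simp add: v_power)
  hence "v y ^ 2 \<le> 1" using y v_int_le_1[OF D] by simp
  hence y1: "v y \<le> 1" using v_nonneg by (simp add: power_le_one_iff)
  then obtain c where c: "c \<in> K.ints" "v (y - c) < 1" using v_le_1_approx by blast
  have "v (y + c) \<le> 1" using v_ultra[of y c] y1 v_int_le_1[OF c(1)] by linarith
  hence "v (y - c) * v (y + c) \<le> v (y - c) * 1" by (intro mult_left_mono v_nonneg)
  hence "v ((y - c) * (y + c)) < 1" using c(2) by (simp add: v_mult)
  moreover have "c ^ 2 - D = (y ^ 2 - D) - (y - c) * (y + c)" by (simp add: power2_eq_square algebra_simps)
  ultimately have "v (c ^ 2 - D) < 1"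
    using v_ultra_diff[of "y ^ 2 - D" "(y - c) * (y + c)"] y by (simp only:)
  moreover have "c ^ 2 - D \<in> K.ints" by (intro K.ints_diff K.ints_power c D)
  ultimately show ?thesis using v_int_less_1 c(1) by blast
qed

end

section \<open>Dynatomic polynomials of a quadratic\<close>

lemma dynatomic_eqI:
  assumes "to_fract p = (\<Prod>d | d dvd n. to_fract (iterate_poly f d - [:0, 1:]) powi moebius_mu (n div d))"
  shows "dynatomic n f = p"
  unfolding dynatomic_def
proof (rule the_equality)
  fix q assume "to_fract q = (\<Prod>d | d dvd n. to_fract (iterate_poly f d - [:0, 1:]) powi moebius_mu (n div d))"
  hence "to_fract q = to_fract p" using assms by simp
  thus "q = p" by simp
qed (rule assms)

lemma moebius_mu_1: "moebius_mu 1 = 1"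
  by (simp add: moebius_mu_def)

lemma moebius_mu_2: "moebius_mu 2 = -1"
proof -
  have "prime_factors (2::nat) = {2}" by (simp add: prime_factorization_prime)
  moreover have "squarefree (2::nat)" by (simp add: squarefree_prime)
  ultimately show ?thesis by (simp add: moebius_mu_def)
qed

lemma dynatomic_1: "dynatomic 1 f = f - [:0, 1:]"
proof (rule dynatomic_eqI)
  have "{d. d dvd (1::nat)} = {1}" by auto
  thus "to_fract (f - [:0, 1:]) = (\<Prod>d | d dvd 1. to_fract (iterate_poly f d - [:0, 1:]) powi moebius_mu (1 div d))"
    by (simp add: moebius_mu_1[unfolded One_nat_def] iterate_poly_def)
qed

context
  fixes a b c :: "'a::field_char_0"
  assumes a: "a \<noteq> 0"
begin

lemma dynatomic_2_quadratic: "dynatomic 2 [:c, b, a:] = [:a * c + b + 1, a * (b + 1), a ^ 2:]"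
proof (rule dynatomic_eqI)
  let ?f = "[:c, b, a:]" and ?x = "[:0, 1:] :: 'a poly"
  let ?p = "[:a * c + b + 1, a * (b + 1), a ^ 2:]"
  have divs: "{d. d dvd (2::nat)} = {1, 2}"
    using two_is_prime_nat by (auto simp: prime_nat_iff)
  have it1: "iterate_poly ?f 1 = ?f" by (simp add: iterate_poly_def)
  have it2: "iterate_poly ?f 2 = ?f \<circ>\<^sub>p ?f" by (simp add: iterate_poly_def numeral_2_eq_2)
  \<comment> \<open>Fixed points of f are fixed by its square, so f - x divides f(f(x)) - x;
    \<open>?p\<close> is the quotient.\<close>
  have eq: "?f \<circ>\<^sub>p ?f - ?x = ?p * (?f - ?x)"
    by (rule poly_ext) (simp add: poly_pcompose power2_eq_square algebra_simps)
  have nz: "?f - ?x \<noteq> 0" using a by simp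
  have prod2: "(\<Prod>d\<in>{1, 2}. g d) = g 1 * g 2" for g :: "nat \<Rightarrow> 'a poly fract" by simp
  have div2: "(2::nat) div 1 = 2" "(2::nat) div 2 = 1" by simp_all
  have "(\<Prod>d | d dvd 2. to_fract (iterate_poly ?f d - ?x) powi moebius_mu (2 div d))
      = to_fract (?f - ?x) powi moebius_mu 2 * to_fract (?f \<circ>\<^sub>p ?f - ?x) powi moebius_mu 1"
    unfolding divs prod2 div2 it1 it2 ..
  also have "\<dots> = inverse (to_fract (?f - ?x)) * to_fract (?p * (?f - ?x))"
    by (simp only: moebius_mu_1 moebius_mu_2 eq power_int_1_right power_int_minus1_right)
  also have "to_fract (?p * (?f - ?x)) = to_fract ?p * to_fract (?f - ?x)" by (rule to_fract_mult)
  also have "inverse (to_fract (?f - ?x)) * (to_fract ?p * to_fract (?f - ?x)) = to_fract ?p"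
    using nz by (simp add: field_simps)
  finally show "to_fract ?p = (\<Prod>d | d dvd 2. to_fract (iterate_poly ?f d - ?x) powi moebius_mu (2 div d))" ..
qed

end

lemma (in number_subfield) maxidl_nonempty: "\<exists>P. maxidl P"
proof -
  obtain a where a: "a \<in> ints" "a \<noteq> 0" "inverse a \<notin> ints" using not_all_units by blast
  have "1 \<notin> principal a"
  proof
    assume "1 \<in> principal a"
    then obtain r where "r \<in> ints" "1 = a * r" by (auto simp: principal_def)
    thus False using a by (metis inverse_unique)
  qed
  hence "principal a \<noteq> ints" using ints_1 by blast
  thus ?thesis using maxidl_exists[OF principal_nzidl[OF a(1,2)]] by blast
qed

section \<open>Local roots of quadratic polynomials\<close>

lemma integral_common_multiple:
  fixes x y z :: "'k::number_field"
  obtains m :: 'k where "m \<noteq> 0" "m * x \<in> K.ints" "m * y \<in> K.ints" "m * z \<in> K.ints" "m \<in> K.ints"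
proof -
  obtain i :: int where i: "i \<noteq> 0" "of_int i * x \<in> K.ints" using K.multiple_integral[of x] by auto
  obtain j :: int where j: "j \<noteq> 0" "of_int j * y \<in> K.ints" using K.multiple_integral[of y] by auto
  obtain k :: int where k: "k \<noteq> 0" "of_int k * z \<in> K.ints" using K.multiple_integral[of z] by auto
  define m :: 'k where "m = of_int i * of_int j * of_int k"
  show ?thesis
  proof (rule that[of m])
    show "m \<noteq> 0" using i j k by (simp add: m_def)
    have "of_int (j * k) * (of_int i * x) \<in> K.ints" by (intro K.ints_mult K.ints_of_int i)
    thus "m * x \<in> K.ints" by (simp add: m_def mult_ac)
    have "of_int (i * k) * (of_int j * y) \<in> K.ints" by (intro K.ints_mult K.ints_of_int j)
    thus "m * y \<in> K.ints" by (simp add: m_def mult_ac)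
    have "of_int (i * j) * (of_int k * z) \<in> K.ints" by (intro K.ints_mult K.ints_of_int k)
    thus "m * z \<in> K.ints" by (simp add: m_def mult_ac)
    show "m \<in> K.ints" unfolding m_def by (intro K.ints_mult K.ints_of_int)
  qed
qed

lemma quadratic_no_root_discriminant:
  fixes a b c :: "'a::field_char_0"
  assumes a: "a \<noteq> 0" and nr: "\<nexists>x. poly [:c, b, a:] x = 0"
  shows "x ^ 2 \<noteq> b ^ 2 - 4 * a * c"
proof
  assume x: "x ^ 2 = b ^ 2 - 4 * a * c"
  define y where "y = (x - b) / (2 * a)"
  have y: "2 * a * y + b = x" using a by (simp add: y_def)
  have "4 * a * poly [:c, b, a:] y = (2 * a * y + b) ^ 2 - (b ^ 2 - 4 * a * c)"
    by (simp add: power2_eq_square algebra_simps)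
  hence "4 * a * poly [:c, b, a:] y = 0" using x y by simp
  thus False using a nr by simp
qed

text \<open>The discriminant is scaled by \<open>m\<^sup>2\<close> to make it integral; away from the finitely many primes
  containing \<open>2 D\<close>, a local root exists iff \<open>D\<close> is a square modulo the prime.\<close>
lemma local_roots_quadratic:
  fixes a b c :: "'k::number_field"
  assumes a: "a \<noteq> 0" and nr: "\<nexists>x. poly [:c, b, a:] x = 0"
  shows "has_Dirichlet_density (local_root_primes [:c, b, a:]) (1/2)
    \<and> \<not> primes_of_field \<subseteq> local_root_primes [:c, b, a:]"
proof -
  let ?F = "[:c, b, a:]"
  obtain m :: 'k where m: "m \<noteq> 0" "m * a \<in> K.ints" "m * b \<in> K.ints" "m * c \<in> K.ints" "m \<in> K.ints"
    using integral_common_multiple[of a b c] by metis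
  define D where "D = (m * b) ^ 2 - 4 * (m * a) * (m * c)"
  have four: "4 \<in> (K.ints :: 'k set)" using K.ints_of_nat[of 4] by simp
  have D: "D \<in> K.ints" unfolding D_def
    by (intro K.ints_diff K.ints_power K.ints_mult four m)
  have sq: "x ^ 2 \<noteq> D" for x
  proof
    assume "x ^ 2 = D"
    hence "(x / m) ^ 2 = b ^ 2 - 4 * a * c" using m(1) by (simp add: D_def field_simps power2_eq_square)
    thus False using quadratic_no_root_discriminant[OF a nr] by blast
  qed
  obtain w :: "'k alg_closure" where w: "w ^ 2 = to_ac D" using nth_root_exists[of 2 "to_ac D"] by auto
  interpret quadratic_extension D w
    by standard (use w sq D in \<open>auto simp: K_ints\<close>)
  let ?S = "local_root_primes ?F"
  \<comment> \<open>At these primes nothing is claimed about local roots. Being finite in number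
    they affect neither the limit nor the existence of a prime without a local root.\<close>
  define E where "E = {P. K.maxidl P \<and> 2 * D \<in> P}"
  have finE: "finite E" unfolding E_def
    by (rule finite_subset[OF _ K.finite_ideals_containing[OF two_D]]) (auto dest: K.max_idl)
  have SP: "?S \<subseteq> {P. K.maxidl P}" by (auto simp: local_root_primes_def primes_of_field_eq)
  have good: "P \<in> ?S \<longleftrightarrow> P \<in> split_primes" if max: "K.maxidl P" and DP: "2 * D \<notin> P" for P
  proof -
    interpret field_prime P by unfold_locales (rule max)
    \<comment> \<open>Completing the square: up to an invertible affine substitution, roots of the
      quadratic are square roots of D.\<close>
    have key: "4 * a * m ^ 2 * poly ?F y = (m * (2 * a * y + b)) ^ 2 - D" for y
      by (simp add: D_def power2_eq_square algebra_simps)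
    have nzc: "4 * a * m ^ 2 \<noteq> 0" using a m(1) by simp
    show ?thesis
    proof
      assume "P \<in> ?S"
      then obtain s where s: "cauchy s" "null (\<lambda>i. poly ?F (s i))" using local_root_iff by blast
      have "null (\<lambda>i. poly ?F (s i) * (4 * a * m ^ 2))" by (rule null_mult_bounded[OF s(2) order_refl])
      hence "null (\<lambda>i. (m * (2 * a * s i + b)) ^ 2 - D)" unfolding key[symmetric] by (simp only: mult.commute)
      hence "\<exists>c\<in>K.ints. c ^ 2 - D \<in> P" by (rule sqrt_imp_residue_square[OF D])
      thus "P \<in> split_primes" using max DP by (auto simp: split_primes_def)
    next
      assume "P \<in> split_primes"
      then obtain e where e: "e \<in> K.ints" "e ^ 2 - D \<in> P" by (auto simp: split_primes_def)
      obtain s where s: "cauchy s" "null (\<lambda>i. s i ^ 2 - D)" using hensel_sqrt[OF D DP e] by blast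
      \<comment> \<open>Solves m (2 a t + b) = s for t.\<close>
      define t where "t i = s i * (1 / (2 * a * m)) + - b / (2 * a)" for i
      have t: "m * (2 * a * t i + b) = s i" for i
        using a m(1) by (simp add: t_def field_simps)
      have "cauchy t" unfolding t_def[abs_def] by (intro cauchy_add cauchy_mult cauchy_const s)
      moreover have "null (\<lambda>i. poly ?F (t i))"
      proof -
        define k where "k = 4 * a * m ^ 2"
        have "k \<noteq> 0" unfolding k_def by (rule nzc)
        hence "poly ?F (t i) = (k * poly ?F (t i)) * (1 / k)" for i by simp
        also have "k * poly ?F (t i) = s i ^ 2 - D" for i unfolding k_def key t ..
        finally have eq: "poly ?F (t i) = (s i ^ 2 - D) * (1 / k)" for i .
        show ?thesis unfolding eq by (rule null_mult_bounded[OF s(2) order_refl])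
      qed
      ultimately show "P \<in> ?S" using local_root_iff by blast
    qed
  qed
  have S_eq: "?S = split_primes \<union> (?S \<inter> E)"
  proof -
    have "P \<in> ?S \<longleftrightarrow> P \<in> split_primes \<or> P \<in> ?S \<inter> E" for P
    proof (cases "K.maxidl P")
      case True
      thus ?thesis using good[OF True] by (cases "2 * D \<in> P") (auto simp: E_def split_primes_def)
    next
      case False
      thus ?thesis using SP by (auto simp: split_primes_def)
    qed
    thus ?thesis by blast
  qed
  have disj: "split_primes \<inter> (?S \<inter> E) = {}" by (auto simp: split_primes_def E_def)
  have fin: "finite (?S \<inter> E)" using finE by blast
  have wt: "real (prime_norm P) powr (- s) = K.wt s P" for P :: "'k set" and s
    by (simp add: K.wt_def prime_norm_eq)
  have lnlim: "filterlim (\<lambda>s::real. - ln (s - 1)) at_top (at_right 1)" by (rule filterlim_minus_ln_at_right_1)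
  have "((\<lambda>s. (\<Sum>\<^sub>\<infinity>P\<in>?S. K.wt s P) / (- ln (s - 1))) \<longlongrightarrow> 1 / 2) (at_right 1)"
  proof -
    have "((\<lambda>s. (\<Sum>P\<in>?S \<inter> E. K.wt s P)) \<longlongrightarrow> (\<Sum>P\<in>?S \<inter> E. K.wt 1 P)) (at_right 1)"
    proof (rule tendsto_sum)
      fix P assume "P \<in> ?S \<inter> E"
      hence "real (K.N P) \<noteq> 0" using K.maxidl_N_ge_2[of P] by (auto simp: E_def)
      thus "((\<lambda>s. K.wt s P) \<longlongrightarrow> K.wt 1 P) (at_right 1)"
        unfolding K.wt_def by (intro tendsto_powr tendsto_const tendsto_minus tendsto_ident_at)
    qed
    hence "((\<lambda>s. (\<Sum>P\<in>?S \<inter> E. K.wt s P) / (- ln (s - 1))) \<longlongrightarrow> 0) (at_right 1)"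
      by (rule tendsto_divide_0[OF _ filterlim_at_top_imp_at_infinity[OF lnlim]])
    from tendsto_add[OF split_sum_quotient this]
    have "((\<lambda>s. (\<Sum>\<^sub>\<infinity>P\<in>split_primes. K.wt s P) / (- ln (s - 1)) + (\<Sum>P\<in>?S \<inter> E. K.wt s P) / (- ln (s - 1))) \<longlongrightarrow> 1 / 2) (at_right 1)"
      by simp
    moreover have "\<forall>\<^sub>F s in at_right 1. (\<Sum>\<^sub>\<infinity>P\<in>split_primes. K.wt s P) / (- ln (s - 1)) + (\<Sum>P\<in>?S \<inter> E. K.wt s P) / (- ln (s - 1))
        = (\<Sum>\<^sub>\<infinity>P\<in>?S. K.wt s P) / (- ln (s - 1))"
    proof -
      have "\<forall>\<^sub>F s in at_right (1::real). s \<in> {1<..<2}" by (rule eventually_at_right_real) simp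
      thus ?thesis
      proof eventually_elim
        case (elim s)
        hence s: "1 < s" "s \<le> 2" by auto
        have "(\<Sum>\<^sub>\<infinity>P\<in>?S. K.wt s P) = (\<Sum>\<^sub>\<infinity>P\<in>split_primes \<union> (?S \<inter> E). K.wt s P)"
          by (rule arg_cong[OF S_eq])
        also have "\<dots> = (\<Sum>\<^sub>\<infinity>P\<in>split_primes. K.wt s P) + (\<Sum>\<^sub>\<infinity>P\<in>?S \<inter> E. K.wt s P)"
          by (rule infsum_Un_disjoint[OF K.prime_sum_summable[OF s] K.prime_sum_summable[OF s] disj])
             (use SP in \<open>auto simp: split_primes_def\<close>)
        also have "(\<Sum>\<^sub>\<infinity>P\<in>?S \<inter> E. K.wt s P) = (\<Sum>P\<in>?S \<inter> E. K.wt s P)" using fin by simp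
        finally show ?case by (simp only: add_divide_distrib)
      qed
    qed
    ultimately show ?thesis by (rule Lim_transform_eventually)
  qed
  hence "has_Dirichlet_density ?S (1 / 2)" unfolding has_Dirichlet_density_def wt .
  moreover have "\<not> primes_of_field \<subseteq> ?S"
  proof
    assume "primes_of_field \<subseteq> ?S"
    hence "{P. K.maxidl P} - split_primes \<subseteq> E"
      unfolding primes_of_field_eq using S_eq by blast
    thus False using nonsplit_infinite finite_subset finE by blast
  qed
  ultimately show ?thesis by blast
qed

lemma degree_2_eq: "degree f = 2 \<Longrightarrow> f = [:coeff f 0, coeff f 1, coeff f 2:] \<and> coeff f 2 \<noteq> 0"
proof
  assume d: "degree f = 2"
  show "f = [:coeff f 0, coeff f 1, coeff f 2:]"
  proof (rule poly_eqI)
    fix n show "coeff f n = coeff [:coeff f 0, coeff f 1, coeff f 2:] n"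
      using d coeff_eq_0[of f n] by (auto simp: coeff_pCons numeral_2_eq_2 split: nat.splits)
  qed
  show "coeff f 2 \<noteq> 0" using leading_coeff_0_iff[of f] d by force
qed

section \<open>From local to global points of exact period 2\<close>

lemma local_period_imp_period_2:
  fixes a b c :: "'k::number_field"
  assumes a: "a \<noteq> 0"
    and loc: "\<forall>P\<in>primes_of_field. \<exists>\<alpha>\<in>carrier (completion P). has_period (poly_completion P [:c, b, a:]) 2 \<alpha>"
  shows "\<exists>x. has_period (poly [:c, b, a:]) 2 x"
proof (rule ccontr)
  let ?f = "[:c, b, a:]" and ?G = "[:a * c + b + 1, a * (b + 1), a ^ 2:]"
  assume np: "\<nexists>x. has_period (poly ?f) 2 x"
  have fact: "poly ?f (poly ?f x) - x = (poly ?f x - x) * poly ?G x" for x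
    by (simp add: power2_eq_square algebra_simps)
  have fix_root: "poly ?f x = x" if "poly ?G x = 0" for x
  proof (rule ccontr)
    assume ne: "poly ?f x \<noteq> x"
    have "poly ?f (poly ?f x) = x" using fact[of x] that by simp
    hence "has_period (poly ?f) 2 x" using ne by (auto simp: has_period_def numeral_2_eq_2 less_Suc_eq)
    thus False using np by blast
  qed
  \<comment> \<open>Exact period 2 means that f(s) - s is not null, so this factor of f(f(s)) - s
    can be cancelled and G(s) must be null.\<close>
  have locG: "\<exists>s. prime_Cauchy P s \<and> (\<lambda>i. prime_abs P (poly ?G (s i))) \<longlonglongrightarrow> 0 \<and>
      \<not> (\<lambda>i. prime_abs P (poly ?f (s i) - s i)) \<longlonglongrightarrow> 0" if pf: "P \<in> primes_of_field" for P
  proof -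
    interpret field_prime P by unfold_locales (use pf in \<open>simp add: primes_of_field_eq\<close>)
    obtain s where s: "cauchy s" "null (\<lambda>i. poly ?f (poly ?f (s i)) - s i)" "\<not> null (\<lambda>i. poly ?f (s i) - s i)"
      using local_period_2 loc pf by blast
    have "cauchy (\<lambda>i. poly ?f (s i) - s i)" by (intro cauchy_diff cauchy_poly s)
    hence "null (\<lambda>i. poly ?G (s i))"
      using s(2) unfolding fact by (rule null_mult_cancel[OF _ s(3)])
    thus ?thesis using s by blast
  qed
  have a2: "a ^ 2 \<noteq> 0" using a by simp
  show False
  proof (cases "\<exists>x. poly ?G x = 0")
    case False
    obtain P where pf: "P \<in> primes_of_field" and nl: "P \<notin> local_root_primes ?G"
      using local_roots_quadratic[OF a2 False] by blast
    then interpret field_prime P by unfold_locales (simp add: primes_of_field_eq)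
    show False using locG[OF pf] nl local_root_iff by blast
  next
    case True
    then obtain x where x: "poly ?G x = 0" by blast
    have fx: "poly ?f x = x" by (rule fix_root[OF x])
    \<comment> \<open>The last summand is f'(x) + 1: a fixed point that is a root of G has
      multiplier -1. Since G'(x) = a (f'(x) + 1), it is a double root.\<close>
    have "poly ?G x = a * (poly ?f x - x) + (2 * a * x + b + 1)" by (simp add: power2_eq_square algebra_simps)
    hence "0 = a * (x - x) + (2 * a * x + b + 1)" unfolding x fx .
    hence lin: "2 * a * x + b + 1 = 0" by simp
    have sq: "poly ?G y = (a * (y - x)) ^ 2" for y
    proof -
      have "poly ?G y = poly ?G x + (a * (y - x)) ^ 2 + a * (y - x) * (2 * a * x + b + 1)"
        by (simp add: power2_eq_square algebra_simps)
      thus ?thesis unfolding x lin by (simp only: add_0_left mult_zero_right add_0_right)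
    qed
    obtain P :: "'k set" where pf: "P \<in> primes_of_field"
      using K.maxidl_nonempty by (auto simp: primes_of_field_eq)
    then interpret field_prime P by unfold_locales (simp add: primes_of_field_eq)
    obtain s where s: "cauchy s" "null (\<lambda>i. poly ?G (s i))" "\<not> null (\<lambda>i. poly ?f (s i) - s i)"
      using locG[OF pf] by blast
    have cy: "cauchy (\<lambda>i. s i - x)" by (intro cauchy_diff cauchy_const s)
    have "null (\<lambda>i. (s i - x) * ((s i - x) * a ^ 2))"
      using s(2) unfolding sq by (simp add: power2_eq_square mult_ac)
    hence n: "null (\<lambda>i. s i - x)"
    proof (rule contrapos_pp)
      assume nn: "\<not> null (\<lambda>i. s i - x)"
      show "\<not> null (\<lambda>i. (s i - x) * ((s i - x) * a ^ 2))"
      proof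
        assume "null (\<lambda>i. (s i - x) * ((s i - x) * a ^ 2))"
        hence "null (\<lambda>i. (s i - x) * a ^ 2)" by (rule null_mult_cancel[OF cy nn])
        hence "null (\<lambda>i. (s i - x) * a ^ 2 * (1 / a ^ 2))" by (rule null_mult_bounded[OF _ order_refl])
        thus False using nn a by simp
      qed
    qed
    \<comment> \<open>f(y) - y vanishes at x. With s converging to x, it is null along s, against
      exact local period 2; this contradiction arises at any single prime.\<close>
    have "poly ?f (s i) - s i = (s i - x) * (a * (s i + x) + b - 1)" for i
    proof -
      have "poly ?f (s i) - s i = (poly ?f x - x) + (s i - x) * (a * (s i + x) + b - 1)"
        by (simp add: algebra_simps)
      thus ?thesis unfolding fx by (simp only: diff_self add_0_left)
    qed
    moreover obtain B where "\<forall>i. v (a * (s i + x) + b - 1) \<le> B"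
      using cauchy_bounded[of "\<lambda>i. a * (s i + x) + b - 1"]
        cauchy_diff[OF cauchy_add[OF cauchy_mult[OF cauchy_const cauchy_add[OF s(1) cauchy_const]] cauchy_const] cauchy_const]
      by metis
    hence "null (\<lambda>i. (s i - x) * (a * (s i + x) + b - 1))" by (intro null_mult_bounded[OF n, where B = B]) blast
    ultimately show False using s(3) by simp
  qed
qed

theorem theorem4p1:
  fixes f :: "'k::number_field poly" and n :: nat
  assumes "degree f = 2" and "n \<in> {1, 2}"
  shows "((\<nexists>x. poly (dynatomic n f) x = 0) \<longrightarrow>
            (\<exists>\<delta>. has_Dirichlet_density (local_root_primes (dynatomic n f)) \<delta> \<and> \<delta> < 1)) \<and>
         ((\<forall>P\<in>primes_of_field. \<exists>\<alpha>\<in>carrier (completion P). has_period (poly_completion P f) n \<alpha>) \<longrightarrow>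
            (\<exists>x. has_period (poly f) n x))"
proof -
  define a b c where "a = coeff f 2" and "b = coeff f 1" and "c = coeff f 0"
  have f: "f = [:c, b, a:]" and a: "a \<noteq> 0"
    using degree_2_eq[OF assms(1)] by (auto simp: a_def b_def c_def)
  have dens: "\<exists>\<delta>. has_Dirichlet_density (local_root_primes [:z, y, x:]) \<delta> \<and> \<delta> < 1"
    if "x \<noteq> 0" "\<nexists>t. poly [:z, y, x:] t = 0" for x y z :: 'k
    using local_roots_quadratic[OF that] by (intro exI[of _ "1 / 2"]) simp
  have "n = 1 \<or> n = 2" using assms(2) by auto
  thus ?thesis
  proof
    assume n: "n = 1"
    have dyn: "dynatomic n f = [:c, b - 1, a:]" unfolding n dynatomic_1 f by simp
    have "\<exists>x. has_period (poly f) 1 x"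
      if loc: "\<forall>P\<in>primes_of_field. \<exists>\<alpha>\<in>carrier (completion P). has_period (poly_completion P f) 1 \<alpha>"
    proof (rule ccontr)
      assume np: "\<nexists>x. has_period (poly f) 1 x"
      have rt: "poly [:c, b - 1, a:] x = poly f x - x" for x by (simp add: f algebra_simps)
      have "\<nexists>x. poly [:c, b - 1, a:] x = 0"
        unfolding rt using np by (auto simp: has_period_def)
      then obtain P where pf: "P \<in> primes_of_field" and nl: "P \<notin> local_root_primes [:c, b - 1, a:]"
        using local_roots_quadratic[OF a] by blast
      then interpret field_prime P by unfold_locales (simp add: primes_of_field_eq)
      obtain s where "cauchy s" "null (\<lambda>i. poly f (s i) - s i)" using local_period_1 loc pf by blast
      thus False using nl local_root_iff rt by auto
    qed
    thus ?thesis using dens[OF a, of c "b - 1"] unfolding dyn unfolding n by blast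
  next
    assume n: "n = 2"
    have dyn: "dynatomic n f = [:a * c + b + 1, a * (b + 1), a ^ 2:]"
      unfolding n f by (rule dynatomic_2_quadratic[OF a])
    have "a ^ 2 \<noteq> 0" using a by simp
    thus ?thesis
      using dens[of "a ^ 2" "a * c + b + 1" "a * (b + 1)"] local_period_imp_period_2[OF a, of c b]
      unfolding dyn unfolding n f by blast
  qed
qed

end
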